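(* Fix $p\in(1,\infty)$ and assume hypothesis (H1). Then the $C^0$-semigroup $(S_p(t))_{t\geq0}$ on $X_p$ generated by the weak solutions of the damped wave equation is exponentially stable: there exist constants $M\geq 1$ and $\gamma>0$ such that $\|S_p(t)(z_0,z_1)\|_{X_p}\le M e^{-\gamma t}\|(z_0,z_1)\|_{X_p}$ for all $t\ge0$ and all $(z_0,z_1)\in X_p$.
   Context: Hypothesis (H1): $a:[0,1]\to\mathbb{R}$ is continuous and nonnegative, and there exist $a_0>0$ and an interval $\omega=[c,d]\subset[0,1]$ with $c<d$ and ($c=0$ or $d=1$) such that $a\ge a_0$ on $\omega$. The damped wave equation is $z_{tt}-z_{xx}+a(x)z_t=0$ on $\mathbb{R}_+\times(0,1)$, $z(t,0)=z(t,1)=0$, $z(0,\cdot)=z_0$, $z_t(0,\cdot)=z_1$. $X_p=W^{1,p}_0(0,1)\times L^p(0,1)$ with norm $\|(u,v)\|_{X_p}=\big(\frac1p\int_0^1(|u'+v|^p+|u'-v|^p)\,dx\big)^{1/p}$. Weak solutions: for $(z_0,z_1)\in X_p$, let $\tilde z_0,\tilde z_1$ be the $2$-periodic extensions to $\mathbb{R}$ of the odd extensions of $z_0,z_1$ to $[-1,1]$, and $\tilde a$ the $2$-periodic extension of the even extension of $a$. A weak solution is a function $z\in L^\infty(\mathbb{R}_+,W^{1,p}_0(0,1))\cap W^{1,\infty}(\mathbb{R}_+,L^p(0,1))$ (extended in $x$ as an odd $2$-periodic function) satisfying the d'Alembert–Duhamel formula $z(t,x)=\frac12[\tilde z_0(x+t)+\tilde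 z_0(x-t)]+\frac12\int_{x-t}^{x+t}\tilde z_1(s)\,ds-\frac12\int_0^t\int_{x-(t-s)}^{x+(t-s)}\tilde a(\tau)z_t(s,\tau)\,d\tau\,ds.$ Weak solutions exist, are unique and global, and $S_p(t)(z_0,z_1):=(z(t,\cdot),z_t(t,\cdot))$ defines a $C^0$-semigroup of contractions on $X_p$. *)

theory Defs
  imports "HOL-Analysis.Analysis"
begin

text \<open>Functions on (0,1) are represented as functions real => real; only their values
on [0,1] matter. An element u of W^{1,p}_0(0,1) is given together with a
representative ud of its weak derivative.\<close>

definition Lp :: "real \<Rightarrow> (real \<Rightarrow> real) \<Rightarrow> bool" where
  "Lp p v \<longleftrightarrow> v \<in> borel_measurable lborel \<and>
     set_integrable lborel {0..1} (\<lambda>x. \<bar>v x\<bar> powr p)"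

definition W1p0 :: "real \<Rightarrow> (real \<Rightarrow> real) \<Rightarrow> (real \<Rightarrow> real) \<Rightarrow> bool" where
  "W1p0 p u ud \<longleftrightarrow> Lp p ud \<and> set_integrable lborel {0..1} ud \<and>
     (\<forall>x\<in>{0..1}. u x = (LBINT s=0..x. ud s)) \<and> u 1 = 0"

definition Xnorm :: "real \<Rightarrow> (real \<Rightarrow> real) \<Rightarrow> (real \<Rightarrow> real) \<Rightarrow> real" where
  "Xnorm p ud v = ((1 / p) * (LBINT x=0..1. \<bar>ud x + v x\<bar> powr p + \<bar>ud x - v x\<bar> powr p))
                    powr (1 / p)"

definition Lp_dist :: "real \<Rightarrow> (real \<Rightarrow> real) \<Rightarrow> (real \<Rightarrow> real) \<Rightarrow> real" where
  "Lp_dist p f g = (LBINT x=0..1. \<bar>f x - g x\<bar> powr p)"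

text \<open>2-periodic extension of the odd (resp. even) extension of f from [0,1] to [-1,1].\<close>
definition oddext :: "(real \<Rightarrow> real) \<Rightarrow> real \<Rightarrow> real" where
  "oddext f x = (let y = x - 2 * of_int \<lfloor>(x + 1) / 2\<rfloor> in if 0 \<le> y then f y else - f (- y))"

definition evenext :: "(real \<Rightarrow> real) \<Rightarrow> real \<Rightarrow> real" where
  "evenext f x = (let y = x - 2 * of_int \<lfloor>(x + 1) / 2\<rfloor> in f \<bar>y\<bar>)"

definition H1 :: "(real \<Rightarrow> real) \<Rightarrow> bool" where
  "H1 a \<longleftrightarrow> continuous_on {0..1} a \<and> (\<forall>x\<in>{0..1}. 0 \<le> a x) \<and>
     (\<exists>a0 c d. a0 > 0 \<and> 0 \<le> c \<and> c < d \<and> d \<le> 1 \<and> (c = 0 \<or> d = 1) \<and>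
        (\<forall>x\<in>{c..d}. a0 \<le> a x))"

text \<open>Weak solution with data (z0, z1): z t x is the solution, zx t its spatial
derivative, zt t its time derivative (the second component of S_p(t)).
Besides L^infinity(R+, W^{1,p}_0) and W^{1,infinity}(R+, L^p) regularity and the
d'Alembert--Duhamel formula, we require (z, z_t) to be continuous into X_p,
as holds for the C^0-semigroup, so that S_p(t) is meaningful for every t.\<close>
definition weak_sol ::
  "real \<Rightarrow> (real \<Rightarrow> real) \<Rightarrow> (real \<Rightarrow> real) \<Rightarrow> (real \<Rightarrow> real)
    \<Rightarrow> (real \<Rightarrow> real \<Rightarrow> real) \<Rightarrow> (real \<Rightarrow> real \<Rightarrow> real) \<Rightarrow> (real \<Rightarrow> real \<Rightarrow> real) \<Rightarrow> bool" where
  "weak_sol p a z0 z1 z zx zt \<longleftrightarrow>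
     (\<forall>t\<ge>0. W1p0 p (z t) (zx t) \<and> Lp p (zt t)) \<and>
     (\<exists>C. \<forall>t\<ge>0. (LBINT x=0..1. \<bar>zx t x\<bar> powr p) \<le> C \<and> (LBINT x=0..1. \<bar>zt t x\<bar> powr p) \<le> C) \<and>
     (\<lambda>(s, x). zt s x) \<in> borel_measurable borel \<and>
     (\<forall>t\<ge>0. AE x in lborel. x \<in> {0..1} \<longrightarrow> z t x = z 0 x + (LBINT s=0..t. zt s x)) \<and>
     (\<forall>t\<ge>0. ((\<lambda>s. Lp_dist p (zt s) (zt t)) \<longlongrightarrow> 0) (at t within {0..}) \<and>
             ((\<lambda>s. Lp_dist p (zx s) (zx t)) \<longlongrightarrow> 0) (at t within {0..})) \<and>
     (\<forall>x\<in>{0..1}. z 0 x = z0 x) \<and>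
     (AE x in lborel. x \<in> {0..1} \<longrightarrow> zt 0 x = z1 x) \<and>
     (\<forall>t\<ge>0. \<forall>x\<in>{0..1}.
        z t x = (oddext z0 (x + t) + oddext z0 (x - t)) / 2
                + (1/2) * (LBINT s=x-t..x+t. oddext z1 s)
                - (1/2) * (LBINT s=0..t. (LBINT r=x-(t-s)..x+(t-s). evenext a r * oddext (zt s) r)))"

end

theory Submission
  imports Defs
begin

text \<open>Along characteristics, in the moving frame \<open>y = x + t\<close>, the Riemann invariant \<open>F = z\<^sub>x + z\<^sub>t\<close> of the
  odd \<open>2\<close>-periodic extension solves
  \<open>\<partial>\<^sub>t F(t,y) = - b(y - t) (F(t,y) - F(t,2t - y))\<close> with \<open>b = a/2\<close>: the damping only exchanges the
  values at \<open>y\<close> and at its mirror image \<open>2t - y\<close>. With \<open>\<phi>(x) = sgn x \<bar>x\<bar>\<^sup>p\<^sup>-\<^sup>1\<close>, the energy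
  \<open>E = \<integral> \<bar>F\<bar>\<^sup>p\<close> over a period therefore dissipates \<open>b (F - F') (\<phi> F - \<phi> F')\<close>, where \<open>F'\<close> is the mirror value.
  This controls \<open>b \<bar>F - F'\<bar>\<^sup>p\<close> up to \<open>\<epsilon> E\<close>, hence also the displacement of \<open>F\<close> over one period of time, so
  \<open>F\<close> may be frozen at the initial time: the dissipation bounds \<open>\<integral> \<bar>F(y) - F(y + 2u)\<bar>\<^sup>p\<close> averaged over the \<open>u\<close>
  in the damped interval. Chaining such increments bounds all increments, and as \<open>F\<close> has mean zero they
  bound \<open>E\<close> itself. So a fixed fraction of the energy is lost in every period.\<close>

section \<open>Powers\<close>

text \<open>The term \<open>\<epsilon> E\<close> is forced when p < 2: for x near 1 and y = x + h
  the product (x - y) (\<phi> x - \<phi> y) is only of order h^2, much smaller than |h|^p. It is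
  harmless because the chain of estimates ends in a bound for the initial energy itself, where a
  small multiple can be absorbed. Freezing is needed because a mirror pair compares two points at a
  time that varies with the pair. For a fixed profile, averaging over a time interval as long as the
  spatial period turns the pairs at distance 2u into a full translation increment. This is why the
  loss of energy is measured over time intervals of length 2. A second obstacle is regularity:
  \<open>zt\<close> is tied to \<open>z\<close> only through time integrals. So F is given by an
  explicit formula from the data and the damping term, and is matched with z_x and z_t only for
  almost every time. The equation for F is used in integrated form along almost every
  characteristic, the energy law is an inequality, and continuity into X_p reaches the remaining
  times.\<close>

definition spow :: "real \<Rightarrow> real \<Rightarrow> real" where
  "spow p x = sgn x * \<bar>x\<bar> powr (p - 1)"

lemma spow_mult_self: "spow p x * x = \<bar>x\<bar> powr p"
proof (cases "x = 0")
  case False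
  have "spow p x * x = \<bar>x\<bar> * \<bar>x\<bar> powr (p - 1)"
    by (simp add: spow_def sgn_if)
  also have "\<dots> = \<bar>x\<bar> powr p"
    by (simp add: powr_mult_base)
  finally show ?thesis .
qed (simp add: spow_def)

lemma abs_spow: "\<bar>spow p x\<bar> = \<bar>x\<bar> powr (p - 1)"
  by (cases "x = 0") (auto simp: spow_def abs_mult)

lemma spow_scale: "0 < r \<Longrightarrow> spow p (r * x) = r powr (p - 1) * spow p x"
  by (simp add: spow_def sgn_mult abs_mult powr_mult)

text \<open>Young's inequality for the conjugate exponents \<open>p / (p - 1)\<close> and
  \<open>p\<close>, multiplied by \<open>p\<close> so that no quotients remain.\<close>

lemma powr_young:
  fixes x y :: real
  assumes "1 < p" "0 \<le> x" "0 \<le> y"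
  shows "p * (x powr (p - 1) * y) \<le> (p - 1) * x powr p + y powr p"
proof -
  have "y * x powr (p - 1) \<le> y powr p / p + (x powr (p - 1)) powr (p / (p - 1)) / (p / (p - 1))"
    using assms by (intro Youngs_inequality) (auto simp: field_simps)
  also have "(x powr (p - 1)) powr (p / (p - 1)) = x powr p"
    using assms by (simp add: powr_powr)
  finally have "p * (y * x powr (p - 1)) \<le> p * (y powr p / p + x powr p / (p / (p - 1)))"
    using assms by (intro mult_left_mono) auto
  also have "\<dots> = y powr p + (p - 1) * x powr p"
    using assms by (simp add: field_simps)
  finally show ?thesis by (simp add: mult_ac)
qed

text \<open>Convexity of the power. Because \<open>spow p x * x\<close> is
  \<open>\<bar>x\<bar> powr p\<close>, the tangent inequality rearranges to Young's inequality, so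
  no derivative is taken.\<close>

lemma powr_tangent:
  assumes "1 < p"
  shows "\<bar>x\<bar> powr p + p * (spow p x * (y - x)) \<le> \<bar>y\<bar> powr p"
proof -
  have "spow p x * y \<le> \<bar>spow p x * y\<bar>" by simp
  also have "\<dots> = \<bar>x\<bar> powr (p - 1) * \<bar>y\<bar>"
    by (simp add: abs_mult abs_spow)
  finally have "p * (spow p x * y) \<le> p * (\<bar>x\<bar> powr (p - 1) * \<bar>y\<bar>)"
    using assms by simp
  also have "\<dots> \<le> (p - 1) * \<bar>x\<bar> powr p + \<bar>y\<bar> powr p"
    by (rule powr_young) (use assms in auto)
  finally show ?thesis
    using spow_mult_self[of p x] by (simp add: algebra_simps)
qed

lemma abs_spow_mult_le:
  assumes "1 < p"
  shows "\<bar>spow p x * y\<bar> \<le> \<bar>x\<bar> powr p + \<bar>y\<bar> powr p"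
proof -
  have "p * \<bar>spow p x * y\<bar> \<le> (p - 1) * \<bar>x\<bar> powr p + 1 * \<bar>y\<bar> powr p"
    using powr_young[OF assms, of "\<bar>x\<bar>" "\<bar>y\<bar>"] by (simp add: abs_mult abs_spow)
  also have "\<dots> \<le> p * \<bar>x\<bar> powr p + p * \<bar>y\<bar> powr p"
    using assms by (intro add_mono mult_right_mono) auto
  also have "\<dots> = p * (\<bar>x\<bar> powr p + \<bar>y\<bar> powr p)"
    by (simp add: algebra_simps)
  finally show ?thesis
    using assms by simp
qed

lemma powr_add2_le:
  fixes x y :: real
  assumes "0 \<le> p"
  shows "\<bar>x + y\<bar> powr p \<le> 2 powr p * (\<bar>x\<bar> powr p + \<bar>y\<bar> powr p)"
proof -
  have "\<bar>x + y\<bar> powr p \<le> (2 * max \<bar>x\<bar> \<bar>y\<bar>) powr p"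
    using assms by (intro powr_mono2) auto
  also have "\<dots> = 2 powr p * max \<bar>x\<bar> \<bar>y\<bar> powr p"
    by (simp add: powr_mult)
  also have "\<dots> \<le> 2 powr p * (\<bar>x\<bar> powr p + \<bar>y\<bar> powr p)"
    by (intro mult_left_mono) (auto simp: max_def)
  finally show ?thesis .
qed

lemma powr_add3_le:
  fixes x y z :: real
  assumes "0 \<le> p"
  shows "\<bar>x + y + z\<bar> powr p \<le> 3 powr p * (\<bar>x\<bar> powr p + \<bar>y\<bar> powr p + \<bar>z\<bar> powr p)"
proof -
  let ?m = "max \<bar>x\<bar> (max \<bar>y\<bar> \<bar>z\<bar>)"
  have "\<bar>x + y + z\<bar> powr p \<le> (3 * ?m) powr p"
    using assms by (intro powr_mono2) auto
  also have "\<dots> = 3 powr p * ?m powr p"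
    by (simp add: powr_mult)
  also have "\<dots> \<le> 3 powr p * (\<bar>x\<bar> powr p + \<bar>y\<bar> powr p + \<bar>z\<bar> powr p)"
    by (intro mult_left_mono) (auto simp: max_def)
  finally show ?thesis .
qed

text \<open>Puts p-integrable functions on bounded intervals into L^1.\<close>

lemma powr_ge_self: "1 \<le> p \<Longrightarrow> \<bar>x::real\<bar> \<le> 1 + \<bar>x\<bar> powr p"
  using powr_ge_zero[of "\<bar>x\<bar>" p] powr_mono[of 1 p "\<bar>x\<bar>"] by (cases "\<bar>x\<bar> \<le> 1") (linarith, simp)

lemma continuous_on_abs_powr:
  assumes "0 < p"
  shows "continuous_on A (\<lambda>x::real. \<bar>x\<bar> powr p)"
  using assms by (intro continuous_on_powr' continuous_intros) auto

text \<open>Only 0 is delicate: the sign jumps there, but the modulus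
  \<open>\<bar>x\<bar> powr (p - 1)\<close> tends to 0 since \<open>1 < p\<close>.\<close>

lemma isCont_spow:
  assumes "1 < p"
  shows "isCont (spow p) x"
proof (cases "x = 0")
  case True
  have "((\<lambda>x::real. \<bar>x\<bar> powr (p - 1)) \<longlongrightarrow> 0) (at 0)"
    using assms continuous_on_abs_powr[of "p - 1" UNIV]
    by (auto simp: continuous_on_eq_continuous_at isCont_def dest: spec[of _ 0])
  then have "((\<lambda>x. \<bar>spow p x\<bar>) \<longlongrightarrow> 0) (at 0)"
    by (simp add: abs_spow)
  then have "(spow p \<longlongrightarrow> 0) (at 0)"
    by (rule tendsto_rabs_zero_cancel)
  moreover have "spow p 0 = 0"
    by (simp add: spow_def)
  ultimately show ?thesis
    using True by (simp add: isCont_def)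
next
  case False
  have "isCont (\<lambda>x::real. \<bar>x\<bar> powr (p - 1)) x" 
    using assms continuous_on_abs_powr[of "p - 1" UNIV]
    by (simp add: continuous_on_eq_continuous_at)
  with False show ?thesis
    unfolding spow_def[abs_def] by (intro isCont_mult isCont_sgn) auto
qed

lemma continuous_on_spow: "1 < p \<Longrightarrow> continuous_on A (spow p)"
  by (simp add: isCont_spow continuous_at_imp_continuous_on)

lemma borel_measurable_spow [measurable]: "spow p \<in> borel_measurable borel"
  unfolding spow_def[abs_def] by measurable

lemma spow_strict_mono:
  assumes "1 < p" "x < y"
  shows "spow p x < spow p y"
  using assms powr_less_mono2[of "p - 1" x y] powr_less_mono2[of "p - 1" "-y" "-x"]
  by (cases x "0::real" rule: linorder_cases; cases y "0::real" rule: linorder_cases)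
     (auto simp: spow_def sgn_if, smt (verit) powr_ge_zero powr_gt_zero)

lemma spow_diff_mult_pos:
  assumes "1 < p" "x \<noteq> y"
  shows "0 < (x - y) * (spow p x - spow p y)"
  using spow_strict_mono[OF assms(1), of x y] spow_strict_mono[OF assms(1), of y x] assms(2)
  by (cases "x < y") (simp_all add: zero_less_mult_iff)

lemma spow_diff_mult_nonneg:
  assumes "1 < p"
  shows "0 \<le> (x - y) * (spow p x - spow p y)"
  using spow_diff_mult_pos[OF assms, of x y] by (cases "x = y") auto

text \<open>Both sides are homogeneous of degree \<open>p\<close>, so it is enough to look at
  \<open>\<bar>x\<bar> powr p + \<bar>y\<bar> powr p = 1\<close>. Where the \<open>e\<close>-term
  does not already suffice, the points form a compact set away from the diagonal, on which the
  monotonicity product has a positive minimum.\<close>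

lemma diff_powr_le_spow:
  assumes p: "1 < p" and e: "0 < e"
  obtains C where "0 \<le> C"
    "\<And>x y. \<bar>x - y\<bar> powr p \<le> e * (\<bar>x\<bar> powr p + \<bar>y\<bar> powr p) + C * ((x - y) * (spow p x - spow p y))"
proof -
  define \<psi> where "\<psi> = (\<lambda>(x, y). (x - y) * (spow p x - spow p y))"
  define S where "S = {(x, y). \<bar>x\<bar> powr p + \<bar>y\<bar> powr p = 1 \<and> e \<le> \<bar>x - y\<bar> powr p}"
  have cont_comp: "continuous_on A (\<lambda>z. \<bar>g z\<bar> powr p)" "continuous_on A (\<lambda>z. spow p (g z))"
    if "continuous_on A g" for g and A :: "(real \<times> real) set"
    using continuous_on_compose2[OF continuous_on_abs_powr[of p UNIV] that]
      continuous_on_compose2[OF continuous_on_spow[of p UNIV] that] p by auto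
  have "closed S"
    unfolding S_def case_prod_beta
    by (intro closed_Collect_conj closed_Collect_eq closed_Collect_le cont_comp continuous_intros)
  moreover have "S \<subseteq> {-1..1} \<times> {-1..1}"
  proof clarify
    fix x y assume "(x, y) \<in> S"
    then have *: "\<bar>x\<bar> powr p + \<bar>y\<bar> powr p = 1" by (simp add: S_def)
    have "\<bar>x\<bar> powr p \<le> 1 powr p" "\<bar>y\<bar> powr p \<le> 1 powr p"
      using * powr_ge_zero[of "\<bar>x\<bar>" p] powr_ge_zero[of "\<bar>y\<bar>" p] by (simp_all del: powr_ge_zero)
    then have "\<bar>x\<bar> \<le> 1" "\<bar>y\<bar> \<le> 1"
      using p powr_less_mono2[of p 1 "\<bar>x\<bar>"] powr_less_mono2[of p 1 "\<bar>y\<bar>"] by (smt (verit))+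
    then show "x \<in> {-1..1} \<and> y \<in> {-1..1}" by auto
  qed
  ultimately have "compact S"
    using compact_Int_closed[of "{-1..1} \<times> {-1..1::real}" S]
    by (simp add: compact_Times inf.absorb2)
  have cont: "continuous_on S \<psi>"
    unfolding \<psi>_def case_prod_beta by (intro cont_comp continuous_intros)
  \<comment> \<open>\<open>m\<close> is the minimum of \<open>\<psi>\<close> on \<open>S\<close>;
    for an empty \<open>S\<close> any positive number does.\<close>
  have "\<exists>m>0. \<forall>z\<in>S. m \<le> \<psi> z"
  proof (cases "S = {}")
    case False
    then obtain z where z: "z \<in> S" "\<And>w. w \<in> S \<Longrightarrow> \<psi> z \<le> \<psi> w"
      using continuous_attains_inf[OF \<open>compact S\<close> _ cont] by blast
    moreover have "0 < \<psi> z"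
    proof -
      obtain x y where xy: "z = (x, y)" by (cases z)
      then have "x \<noteq> y" using z(1) e by (auto simp: S_def)
      then show ?thesis using spow_diff_mult_pos[OF p] xy by (simp add: \<psi>_def)
    qed
    ultimately show ?thesis by blast
  qed (auto intro: exI[of _ 1])
  then obtain m where m: "0 < m" "\<And>z. z \<in> S \<Longrightarrow> m \<le> \<psi> z" by blast
  show ?thesis
  proof
    \<comment> \<open>On \<open>S\<close> the left side is at most \<open>2 powr p\<close> and
      \<open>\<psi>\<close> is at least \<open>m\<close>, whence the constant.\<close>
    show "0 \<le> 2 powr p / m" using m by simp
  next
    fix x y :: real
    define R where "R = \<bar>x\<bar> powr p + \<bar>y\<bar> powr p"
    \<comment> \<open>Dividing by \<open>r\<close> rescales \<open>(x, y)\<close> to the normalised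
      pair \<open>(x', y')\<close>.\<close>
    define r where "r = R powr (1 / p)"
    show "\<bar>x - y\<bar> powr p \<le> e * (\<bar>x\<bar> powr p + \<bar>y\<bar> powr p) + 2 powr p / m * ((x - y) * (spow p x - spow p y))"
    proof (cases "\<bar>x - y\<bar> powr p \<le> e * R")
      case True
      have "0 \<le> 2 powr p / m * ((x - y) * (spow p x - spow p y))"
        by (rule mult_nonneg_nonneg[OF _ spow_diff_mult_nonneg[OF p]]) (use m in simp)
      with True show ?thesis by (simp add: R_def)
    next
      case False
      have "0 \<le> R" by (simp add: R_def)
      moreover have "R \<noteq> 0"
      proof
        assume "R = 0"
        then have "x = 0 \<and> y = 0"
          unfolding R_def by (smt (verit) powr_gt_zero powr_ge_zero)
        with False \<open>R = 0\<close> show False by simp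
      qed
      ultimately have R: "0 < R" by simp
      then have r: "0 < r" and rp: "r powr p = R" using p by (auto simp: r_def powr_powr)
      define x' y' where "x' = x / r" and "y' = y / r"
      have xy: "x = r * x'" "y = r * y'" using r by (auto simp: x'_def y'_def)
      have xy_diff: "x - y = r * (x' - y')" by (simp add: xy algebra_simps)
      have eqs: "\<bar>x - y\<bar> powr p = R * \<bar>x' - y'\<bar> powr p"
        using r unfolding rp[symmetric] xy_diff by (simp add: abs_mult powr_mult)
      have "R = r powr p * (\<bar>x'\<bar> powr p + \<bar>y'\<bar> powr p)"
        using r unfolding R_def xy by (simp add: abs_mult powr_mult algebra_simps)
      then have eqs2: "\<bar>x'\<bar> powr p + \<bar>y'\<bar> powr p = 1"
        using rp R by simp
      have "(x', y') \<in> S"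
        using eqs eqs2 R False by (auto simp: S_def mult.commute[of e])
      then have "m \<le> \<psi> (x', y')" by (rule m)
      then have *: "1 \<le> (1 / m) * \<psi> (x', y')" using m(1) by (simp add: field_simps)
      have "\<bar>x' - y'\<bar> powr p \<le> 2 powr p"
        using powr_add2_le[of p x' "- y'"] p eqs2 by simp
      also have "\<dots> \<le> 2 powr p * ((1 / m) * \<psi> (x', y'))"
        using * mult_left_mono[OF *, of "2 powr p"] by simp
      finally have "\<bar>x - y\<bar> powr p \<le> R * (2 powr p * ((1 / m) * \<psi> (x', y')))"
        unfolding eqs using R by (intro mult_left_mono) auto
      also have "R = r * r powr (p - 1)"
        using r rp by (simp add: powr_mult_base)
      also have "r * r powr (p - 1) * (2 powr p * ((1 / m) * \<psi> (x', y'))) =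
          2 powr p / m * ((x - y) * (spow p x - spow p y))"
        unfolding xy \<psi>_def using r by (simp add: spow_scale algebra_simps)
      finally show ?thesis using R e by (simp add: R_def add_increasing)
    qed
  qed
qed

section \<open>Lebesgue measure on intervals and periodic functions\<close>

text \<open>A density on the whole line rather than a restricted space: measurability stays Borel
  measurability, and \<open>lint a b\<close> is a finite measure to which Fubini and Jensen apply
  directly.\<close>

definition lint :: "real \<Rightarrow> real \<Rightarrow> real measure" where
  "lint a b = density lborel (\<lambda>x. ennreal (indicator {a..b} x))"

lemma sets_lint [measurable_cong, simp]: "sets (lint a b) = sets borel"
  by (simp add: lint_def)

lemma space_lint [simp]: "space (lint a b) = UNIV"
  by (simp add: lint_def)

lemma measurable_lint1 [simp]: "measurable (lint a b) N = measurable borel N"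
  by (rule measurable_cong_sets) auto

lemma nn_integral_lint:
  assumes [measurable]: "f \<in> borel_measurable borel"
  shows "(\<integral>\<^sup>+x. f x \<partial>lint a b) = (\<integral>\<^sup>+x. f x * indicator {a..b} x \<partial>lborel)"
  unfolding lint_def by (subst nn_integral_density) (auto simp: ennreal_indicator mult.commute)

lemma AE_lint: "(AE x in lint a b. P x) \<longleftrightarrow> (AE x in lborel. x \<in> {a..b} \<longrightarrow> P x)"
  unfolding lint_def by (subst AE_density) (auto simp: indicator_def)

lemma AE_lint_mem: "AE x in lint a b. x \<in> {a..b}"
  by (simp add: AE_lint)

lemma emeasure_lint:
  assumes "A \<in> sets borel"
  shows "emeasure (lint a b) A = emeasure lborel (A \<inter> {a..b})"
  unfolding lint_def using assms
  by (subst emeasure_density)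
     (auto simp: ennreal_indicator indicator_inter_arith[symmetric] Int_commute
       simp flip: nn_integral_indicator)

lemma measure_lint_UNIV: "a \<le> b \<Longrightarrow> measure (lint a b) UNIV = b - a"
  by (simp add: measure_def emeasure_lint)

lemma finite_measure_lint: "finite_measure (lint a b)"
  by (rule finite_measureI) (simp add: emeasure_lint emeasure_lborel_Icc_eq)

interpretation lint: finite_measure "lint a b" for a b
  by (rule finite_measure_lint)

interpretation lint_pair: pair_sigma_finite "lint a b" "lint c d" for a b c d
  by unfold_locales

lemma integrable_lint:
  fixes f :: "real \<Rightarrow> real"
  assumes [measurable]: "f \<in> borel_measurable borel"
  shows "integrable (lint a b) f \<longleftrightarrow> set_integrable lborel {a..b} f"
  unfolding lint_def set_integrable_def
  by (subst integrable_density) auto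

lemma integral_lint:
  fixes f :: "real \<Rightarrow> real"
  assumes [measurable]: "f \<in> borel_measurable borel"
  shows "integral\<^sup>L (lint a b) f = (LINT x:{a..b}|lborel. f x)"
  unfolding lint_def set_lebesgue_integral_def
  by (subst integral_density) auto

text \<open>Stated for measures, so that the substitution rules for nonnegative integrals, Bochner
  integrals and integrability are all instances.\<close>

lemma distr_lint_shift: "distr (lint a b) borel (\<lambda>y. h + y) = lint (h + a) (h + b)"
proof (rule measure_eqI)
  fix A assume "A \<in> sets (distr (lint a b) borel ((+) h))"
  then have [measurable]: "A \<in> sets borel" by simp
  have pre: "(\<lambda>y. h + y) -` A \<in> sets borel"
    by (rule measurable_sets_borel[where M=borel]) auto
  have "emeasure (lint (h + a) (h + b)) A = (\<integral>\<^sup>+x. indicator (A \<inter> {h + a..h + b}) x \<partial>lborel)"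
    by (simp add: emeasure_lint)
  also have "\<dots> = (\<integral>\<^sup>+x. indicator (A \<inter> {h + a..h + b}) (h + 1 * x) \<partial>lborel)"
    by (subst nn_integral_real_affine[where t=h and c=1]) auto
  also have "\<dots> = (\<integral>\<^sup>+x. indicator ((\<lambda>y. h + y) -` A \<inter> {a..b}) x \<partial>lborel)"
    by (intro nn_integral_cong) (auto simp: indicator_def)
  also have "\<dots> = emeasure lborel ((\<lambda>y. h + y) -` A \<inter> {a..b})"
    using pre by (intro nn_integral_indicator) auto
  also have "\<dots> = emeasure (distr (lint a b) borel (\<lambda>y. h + y)) A"
    by (subst emeasure_distr) (auto simp: emeasure_lint[OF pre])
  finally show "emeasure (distr (lint a b) borel (\<lambda>y. h + y)) A = emeasure (lint (h + a) (h + b)) A" ..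
qed simp

lemma distr_lint_reflect: "distr (lint a b) borel (\<lambda>y. h - y) = lint (h - b) (h - a)"
proof (rule measure_eqI)
  fix A assume "A \<in> sets (distr (lint a b) borel ((-) h))"
  then have [measurable]: "A \<in> sets borel" by simp
  have pre: "(\<lambda>y. h - y) -` A \<in> sets borel"
    by (rule measurable_sets_borel[where M=borel]) auto
  have "emeasure (lint (h - b) (h - a)) A = (\<integral>\<^sup>+x. indicator (A \<inter> {h - b..h - a}) x \<partial>lborel)"
    by (simp add: emeasure_lint)
  also have "\<dots> = (\<integral>\<^sup>+x. indicator (A \<inter> {h - b..h - a}) (h + (-1) * x) \<partial>lborel)"
    by (subst nn_integral_real_affine[where t=h and c="-1"]) auto
  also have "\<dots> = (\<integral>\<^sup>+x. indicator ((\<lambda>y. h - y) -` A \<inter> {a..b}) x \<partial>lborel)"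
    by (intro nn_integral_cong) (auto simp: indicator_def)
  also have "\<dots> = emeasure lborel ((\<lambda>y. h - y) -` A \<inter> {a..b})"
    using pre by (intro nn_integral_indicator) auto
  also have "\<dots> = emeasure (distr (lint a b) borel (\<lambda>y. h - y)) A"
    by (subst emeasure_distr) (auto simp: emeasure_lint[OF pre])
  finally show "emeasure (distr (lint a b) borel (\<lambda>y. h - y)) A = emeasure (lint (h - b) (h - a)) A" ..
qed simp

lemma nn_integral_lint_shift:
  assumes [measurable]: "f \<in> borel_measurable borel"
  shows "(\<integral>\<^sup>+y. f (h + y) \<partial>lint a b) = (\<integral>\<^sup>+y. f y \<partial>lint (h + a) (h + b))"
  unfolding distr_lint_shift[symmetric] by (subst nn_integral_distr) auto

lemma nn_integral_lint_reflect:
  assumes [measurable]: "f \<in> borel_measurable borel"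
  shows "(\<integral>\<^sup>+y. f (h - y) \<partial>lint a b) = (\<integral>\<^sup>+y. f y \<partial>lint (h - b) (h - a))"
  unfolding distr_lint_reflect[symmetric] by (subst nn_integral_distr) auto

lemma integral_lint_shift:
  fixes f :: "real \<Rightarrow> real"
  assumes [measurable]: "f \<in> borel_measurable borel"
  shows "(\<integral>y. f (h + y) \<partial>lint a b) = (\<integral>y. f y \<partial>lint (h + a) (h + b))"
  unfolding distr_lint_shift[symmetric] by (subst integral_distr) auto

lemma integral_lint_reflect:
  fixes f :: "real \<Rightarrow> real"
  assumes [measurable]: "f \<in> borel_measurable borel"
  shows "(\<integral>y. f (h - y) \<partial>lint a b) = (\<integral>y. f y \<partial>lint (h - b) (h - a))"
  unfolding distr_lint_reflect[symmetric] by (subst integral_distr) auto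

lemma nn_integral_lint_split:
  assumes [measurable]: "f \<in> borel_measurable borel" and "a \<le> b" "b \<le> c"
  shows "(\<integral>\<^sup>+y. f y \<partial>lint a c) = (\<integral>\<^sup>+y. f y \<partial>lint a b) + (\<integral>\<^sup>+y. f y \<partial>lint b c)"
proof -
  have "AE y in lborel. y \<noteq> b"
    by (rule AE_lborel_singleton)
  then have "(\<integral>\<^sup>+y. f y * indicator {a..c} y \<partial>lborel)
      = (\<integral>\<^sup>+y. f y * indicator {a..b} y + f y * indicator {b..c} y \<partial>lborel)"
    by (intro nn_integral_cong_AE) (use assms in \<open>auto elim!: eventually_mono split: split_indicator\<close>)
  then show ?thesis
    by (simp add: nn_integral_lint nn_integral_add)
qed

lemma nn_integral_lint_mono_set:
  assumes [measurable]: "f \<in> borel_measurable borel" and "{a..b} \<subseteq> {c..d}"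
  shows "(\<integral>\<^sup>+y. f y \<partial>lint a b) \<le> (\<integral>\<^sup>+y. f y \<partial>lint c d)"
  unfolding nn_integral_lint[OF assms(1)]
  by (intro nn_integral_mono) (use assms(2) in \<open>auto split: split_indicator\<close>)

section \<open>Functions of period 2\<close>

lemma periodic_of_int:
  fixes f :: "real \<Rightarrow> 'a"
  assumes "\<And>x. f (x + 2) = f x"
  shows "f (x + 2 * of_int k) = f x"
proof -
  have nat: "f (x + 2 * of_nat n) = f x" for x n
  proof (induction n)
    case (Suc n)
    then show ?case using assms[of "x + 2 * of_nat n"] by (simp add: algebra_simps)
  qed simp
  show ?thesis
  proof (cases k)
    case (nonneg n)
    then show ?thesis using nat[of x n] by simp
  next
    case (neg n)
    then show ?thesis using nat[of "x + 2 * of_int k" "Suc n"] by simp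
  qed
qed

text \<open>The representative of \<open>x\<close> modulo 2 in [-1,1), that is, the local
  \<open>y\<close> of \<open>oddext\<close> and \<open>evenext\<close>.\<close>

definition wrap :: "real \<Rightarrow> real" where
  "wrap x = x - 2 * of_int \<lfloor>(x + 1) / 2\<rfloor>"

lemma wrap_bounds: "-1 \<le> wrap x" "wrap x < 1"
  using floor_correct[of "(x + 1) / 2"] unfolding wrap_def by (simp_all add: field_simps)

lemma wrap_add2 [simp]: "wrap (x + 2) = wrap x"
proof -
  have "(x + 2 + 1) / 2 = (x + 1) / 2 + 1" by (simp add: field_simps)
  then have "\<lfloor>(x + 2 + 1) / 2\<rfloor> = \<lfloor>(x + 1) / 2\<rfloor> + 1"
    using floor_add_int[of "(x + 1) / 2" 1] by (simp only: of_int_1)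
  then show ?thesis unfolding wrap_def by simp
qed

lemma wrap_eq: "-1 \<le> x \<Longrightarrow> x < 1 \<Longrightarrow> wrap x = x"
  using floor_unique[of 0 "(x + 1) / 2"] unfolding wrap_def by simp

lemma borel_measurable_wrap [measurable]: "wrap \<in> borel_measurable borel"
  unfolding wrap_def[abs_def] by measurable

lemma periodic_wrap:
  assumes "\<And>x. f (x + 2) = f x"
  shows "f (wrap x) = f x"
  using periodic_of_int[where f=f, OF assms, of x "- \<lfloor>(x + 1) / 2\<rfloor>"] by (simp add: wrap_def)

text \<open>Up to a multiple of 2 the interval is \<open>{r - 1..r + 1}\<close> with
  \<open>r\<close> in [0,2]; the part beyond 1 is moved back by 2 and fills
  \<open>{-1..r - 1}\<close>.\<close>

lemma nn_integral_period:
  assumes [measurable]: "f \<in> borel_measurable borel" and per: "\<And>x. f (x + 2) = f x"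
  shows "(\<integral>\<^sup>+y. f y \<partial>lint s (s + 2)) = (\<integral>\<^sup>+y. f y \<partial>lint (-1) 1)"
proof -
  define k where "k = \<lfloor>(s + 1) / 2\<rfloor>"
  define r where "r = s + 1 - 2 * of_int k"
  have r: "0 \<le> r" "r \<le> 2"
    using floor_correct[of "(s + 1) / 2"] unfolding r_def k_def by (simp_all add: field_simps)
  have s: "s = 2 * of_int k + (r - 1)" "s + 2 = 2 * of_int k + (r + 1)" by (simp_all add: r_def)
  have shift: "f (2 * of_int k + y) = f y" for y
    using periodic_of_int[where f=f, OF per, of y k] by (simp add: add.commute)
  have "(\<integral>\<^sup>+y. f y \<partial>lint s (s + 2)) = (\<integral>\<^sup>+y. f y \<partial>lint (r - 1) (r + 1))"
    by (subst s(2), subst s(1), subst nn_integral_lint_shift[symmetric]) (auto simp: shift)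
  also have "\<dots> = (\<integral>\<^sup>+y. f y \<partial>lint (r - 1) 1) + (\<integral>\<^sup>+y. f y \<partial>lint (2 + -1) (2 + (r - 1)))"
    using r by (subst nn_integral_lint_split[where b=1]) (auto simp: add.commute[of 1 r])
  also have "(\<integral>\<^sup>+y. f y \<partial>lint (2 + -1) (2 + (r - 1))) = (\<integral>\<^sup>+y. f y \<partial>lint (-1) (r - 1))"
    by (subst nn_integral_lint_shift[symmetric]) (auto simp: add.commute[of 2] per)
  also have "(\<integral>\<^sup>+y. f y \<partial>lint (r - 1) 1) + (\<integral>\<^sup>+y. f y \<partial>lint (-1) (r - 1)) = (\<integral>\<^sup>+y. f y \<partial>lint (-1) 1)"
    using r by (subst (3) nn_integral_lint_split[where b="r - 1"]) (auto simp: add.commute)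
  finally show ?thesis .
qed

lemma nn_integral_period_shift:
  assumes [measurable]: "f \<in> borel_measurable borel" and per: "\<And>x. f (x + 2) = f x"
  shows "(\<integral>\<^sup>+y. f (h + y) \<partial>lint s (s + 2)) = (\<integral>\<^sup>+y. f y \<partial>lint (-1) 1)"
  using nn_integral_period[OF assms, of "h + s"]
  by (simp add: nn_integral_lint_shift add.assoc)

lemma nn_integral_period_reflect:
  assumes [measurable]: "f \<in> borel_measurable borel" and per: "\<And>x. f (x + 2) = f x"
  shows "(\<integral>\<^sup>+y. f (h - y) \<partial>lint s (s + 2)) = (\<integral>\<^sup>+y. f y \<partial>lint (-1) 1)"
  using nn_integral_period[OF assms, of "h - s - 2"]
  by (simp add: nn_integral_lint_reflect algebra_simps)

text \<open>As a statement on measures this yields the period rule for Bochner integrals without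
  splitting into positive and negative parts.\<close>

lemma distr_wrap: "distr (lint s (s + 2)) borel wrap = lint (-1) 1"
proof (rule measure_eqI)
  fix A assume "A \<in> sets (distr (lint s (s + 2)) borel wrap)"
  then have [measurable]: "A \<in> sets borel" by simp
  have "emeasure (distr (lint s (s + 2)) borel wrap) A
      = (\<integral>\<^sup>+y. indicator A y \<partial>distr (lint s (s + 2)) borel wrap)"
    by simp
  also have "\<dots> = (\<integral>\<^sup>+y. indicator A (wrap y) \<partial>lint s (s + 2))"
    by (subst nn_integral_distr) auto
  also have "\<dots> = (\<integral>\<^sup>+y. indicator A (wrap y) \<partial>lint (-1) 1)"
    by (rule nn_integral_period) simp_all
  \<comment> \<open>The only point of [-1,1] moved by \<open>wrap\<close> is 1, a null set.\<close>
  also have "\<dots> = (\<integral>\<^sup>+y. indicator A y \<partial>lint (-1) 1)"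
    using AE_lborel_singleton[of "1::real"]
    by (intro nn_integral_cong_AE) (auto simp: AE_lint wrap_eq elim!: eventually_mono)
  finally show "emeasure (distr (lint s (s + 2)) borel wrap) A = emeasure (lint (-1) 1) A"
    by simp
qed simp

lemma integral_period:
  fixes f :: "real \<Rightarrow> real"
  assumes [measurable]: "f \<in> borel_measurable borel" and per: "\<And>x. f (x + 2) = f x"
  shows "(\<integral>y. f y \<partial>lint s (s + 2)) = (\<integral>y. f y \<partial>lint (-1) 1)"
proof -
  have "(\<integral>y. f y \<partial>lint s (s + 2)) = (\<integral>y. f (wrap y) \<partial>lint s (s + 2))"
    by (simp add: periodic_wrap[of f, OF per])
  also have "\<dots> = (\<integral>y. f y \<partial>distr (lint s (s + 2)) borel wrap)"
    by (subst integral_distr) auto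
  finally show ?thesis by (simp add: distr_wrap)
qed

lemma integral_period_reflect:
  fixes f :: "real \<Rightarrow> real"
  assumes [measurable]: "f \<in> borel_measurable borel" and per: "\<And>x. f (x + 2) = f x"
  shows "(\<integral>y. f (h - y) \<partial>lint (-1) 1) = (\<integral>y. f y \<partial>lint (-1) 1)"
  using integral_period[OF assms, of "h - 1"] by (simp add: integral_lint_reflect add.commute)

lemma nn_integral_symmetric:
  assumes [measurable]: "f \<in> borel_measurable borel"
  shows "(\<integral>\<^sup>+y. f y \<partial>lint (-1) 1) = (\<integral>\<^sup>+y. f y + f (- y) \<partial>lint 0 1)"
  using nn_integral_lint_split[OF assms, of "-1" 0 1] nn_integral_lint_reflect[OF assms, where h=0 and a=0 and b=1]
  by (simp add: nn_integral_add add.commute)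

text \<open>Jensen's inequality, by integrating the tangent inequality at the mean
  \<open>\<mu>\<close>. If the power is not integrable, the right side is infinite because the total
  mass is positive.\<close>

lemma (in finite_measure) powr_integral_le:
  fixes f :: "'a \<Rightarrow> real"
  assumes p: "1 < p" and f: "integrable M f" and m: "0 < measure M (space M)"
  shows "ennreal (\<bar>\<integral>x. f x \<partial>M\<bar> powr p)
    \<le> ennreal (measure M (space M) powr (p - 1)) * (\<integral>\<^sup>+x. ennreal (\<bar>f x\<bar> powr p) \<partial>M)"
proof (cases "integrable M (\<lambda>x. \<bar>f x\<bar> powr p)")
  case True
  define m where "m = measure M (space M)"
  define \<mu> where "\<mu> = (\<integral>x. f x \<partial>M) / m"
  have m0: "0 < m" using m by (simp add: m_def)
  have "(\<integral>x. \<bar>\<mu>\<bar> powr p + p * (spow p \<mu> * (f x - \<mu>)) \<partial>M) \<le> (\<integral>x. \<bar>f x\<bar> powr p \<partial>M)"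
    by (intro integral_mono True Bochner_Integration.integrable_add integrable_mult_right
        Bochner_Integration.integrable_diff f integrable_const powr_tangent p)
  also have "(\<integral>x. \<bar>\<mu>\<bar> powr p + p * (spow p \<mu> * (f x - \<mu>)) \<partial>M) =
      m * \<bar>\<mu>\<bar> powr p + p * (spow p \<mu> * ((\<integral>x. f x \<partial>M) - m * \<mu>))"
    using f by (simp add: m_def)
  also have "\<dots> = m * \<bar>\<mu>\<bar> powr p" using m0 by (simp add: \<mu>_def)
  finally have *: "m * \<bar>\<mu>\<bar> powr p \<le> (\<integral>x. \<bar>f x\<bar> powr p \<partial>M)" .
  have "\<bar>\<integral>x. f x \<partial>M\<bar> powr p = (m * \<bar>\<mu>\<bar>) powr p"
    using m0 by (simp add: \<mu>_def)
  also have "\<dots> = m powr (p - 1) * (m * \<bar>\<mu>\<bar> powr p)"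
    using m0 by (simp add: powr_mult powr_diff)
  also have "\<dots> \<le> m powr (p - 1) * (\<integral>x. \<bar>f x\<bar> powr p \<partial>M)"
    using * by (intro mult_left_mono) auto
  finally have "ennreal (\<bar>\<integral>x. f x \<partial>M\<bar> powr p) \<le> ennreal (m powr (p - 1) * (\<integral>x. \<bar>f x\<bar> powr p \<partial>M))"
    by (rule ennreal_leI)
  also have "\<dots> = ennreal (m powr (p - 1)) * (\<integral>\<^sup>+x. ennreal (\<bar>f x\<bar> powr p) \<partial>M)"
    using True by (simp add: ennreal_mult nn_integral_eq_integral)
  finally show ?thesis by (simp add: m_def)
next
  case False
  have "(\<integral>\<^sup>+x. ennreal (\<bar>f x\<bar> powr p) \<partial>M) = \<infinity>"
    using False f by (auto simp: integrable_iff_bounded less_top[symmetric])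
  then show ?thesis using m by (simp add: ennreal_mult_top)
qed

text \<open>The positive and negative parts of \<open>f\<close>, taken as densities, define measures
  that agree on all half-lines and are therefore equal; finite mass then makes the densities equal
  almost everywhere.\<close>

lemma AE_zero_if_integrals_zero:
  fixes f :: "real \<Rightarrow> real"
  assumes int: "set_integrable lborel {0..L} f"
    and meas [measurable]: "f \<in> borel_measurable borel"
    and zero: "\<And>t. 0 \<le> t \<Longrightarrow> t \<le> L \<Longrightarrow> (LINT x:{0..t}|lborel. f x) = 0"
  shows "AE x in lborel. x \<in> {0..L} \<longrightarrow> f x = 0"
proof (cases "0 \<le> L")
  case L: True
  define f1 where "f1 = (\<lambda>x. ennreal (max 0 (f x)))"
  define f2 where "f2 = (\<lambda>x. ennreal (max 0 (- f x)))"
  have [measurable]: "f1 \<in> borel_measurable borel" "f2 \<in> borel_measurable borel"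
    unfolding f1_def f2_def by measurable
  have i1: "integrable (lint 0 L) f" using int by (simp add: integrable_lint)
  have fin: "(\<integral>\<^sup>+x. f1 x \<partial>lint 0 L) \<noteq> \<infinity>" "(\<integral>\<^sup>+x. f2 x \<partial>lint 0 L) \<noteq> \<infinity>"
    using i1 by (auto simp: f1_def f2_def ennreal_max_0 real_integrable_def)
  let ?N1 = "density (lint 0 L) f1" and ?N2 = "density (lint 0 L) f2"
  have em: "emeasure (density (lint 0 L) g) A = (\<integral>\<^sup>+x. g x * indicator A x \<partial>lint 0 L)" 
    if [measurable]: "g \<in> borel_measurable borel" "A \<in> sets borel" for g and A
    by (subst emeasure_density) auto
  \<comment> \<open>The tail is the total integral minus an initial one, and both vanish; for
    \<open>t\<close> outside [0,L] it is the total integral or empty.\<close>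
  have tail: "(LINT x:{t<..}|lint 0 L. f x) = 0" for t
  proof -
    have tot: "(\<integral>x. f x \<partial>lint 0 L) = 0"
      using zero[of L] L by (simp add: integral_lint)
    show ?thesis
    proof (cases "0 \<le> t \<and> t \<le> L")
      case True
      have "(LINT x:{..t}|lint 0 L. f x) = (LINT x:{0..t}|lborel. f x)"
      proof -
        have "(LINT x:{..t}|lint 0 L. f x) = (\<integral>x. indicator {0..L} x * (indicator {..t} x * f x) \<partial>lborel)"
          unfolding set_lebesgue_integral_def
          by (subst integral_lint) (auto simp: set_lebesgue_integral_def)
        also have "\<dots> = (\<integral>x. indicator {0..t} x * f x \<partial>lborel)"
          by (intro Bochner_Integration.integral_cong) (use True in \<open>auto split: split_indicator\<close>)
        finally show ?thesis by (simp add: set_lebesgue_integral_def)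
      qed
      also have "\<dots> = 0" using zero True by simp
      finally have 1: "(LINT x:{..t}|lint 0 L. f x) = 0" .
      have si: "set_integrable (lint 0 L) A f" if "A \<in> sets borel" for A
        unfolding set_integrable_def using i1 that by (intro integrable_mult_indicator) auto
      have "(LINT x:UNIV|lint 0 L. f x) = (LINT x:{..t} \<union> {t<..}|lint 0 L. f x)"
        by (intro arg_cong[where f="\<lambda>A. set_lebesgue_integral (lint 0 L) A f"]) auto
      also have "\<dots> = (LINT x:{..t}|lint 0 L. f x) + (LINT x:{t<..}|lint 0 L. f x)"
        by (intro set_integral_Un si) auto
      finally show ?thesis using 1 tot by (simp add: set_lebesgue_integral_def)
    next
      case False
      then have cases: "t < 0 \<or> L < t" by auto
      then show ?thesis
      proof
        assume "t < 0"
        then have "(LINT x:{t<..}|lint 0 L. f x) = (\<integral>x. f x \<partial>lint 0 L)"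
          unfolding set_lebesgue_integral_def
          by (intro integral_cong_AE) (use \<open>t < 0\<close> in \<open>simp_all add: AE_lint\<close>)
        then show ?thesis using tot by simp
      next
        assume "L < t"
        then have "(LINT x:{t<..}|lint 0 L. f x) = (\<integral>x. 0 \<partial>lint 0 L)"
          unfolding set_lebesgue_integral_def
          by (intro integral_cong_AE) (use \<open>L < t\<close> in \<open>simp_all add: AE_lint\<close>)
        then show ?thesis by simp
      qed
    qed
  qed
  have "?N1 = ?N2"
  proof (rule measure_eqI_lessThan)
    fix t :: real
    let ?g = "\<lambda>x. indicator {t<..} x * f x"
    have gi: "integrable (lint 0 L) ?g"
      using i1 integrable_mult_indicator[of "{t<..}" "lint 0 L" f] by simp
    have e1: "emeasure ?N1 {t<..} = (\<integral>\<^sup>+x. ennreal (max 0 (?g x)) \<partial>lint 0 L)"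
      by (subst em) (auto intro!: nn_integral_cong simp: f1_def split: split_indicator)
    have e2: "emeasure ?N2 {t<..} = (\<integral>\<^sup>+x. ennreal (max 0 (- ?g x)) \<partial>lint 0 L)"
      by (subst em) (auto intro!: nn_integral_cong simp: f2_def split: split_indicator)
    have fin': "(\<integral>\<^sup>+x. ennreal (?g x) \<partial>lint 0 L) \<noteq> \<infinity>" "(\<integral>\<^sup>+x. ennreal (- ?g x) \<partial>lint 0 L) \<noteq> \<infinity>"
      using gi by (auto simp: real_integrable_def)
    show "emeasure ?N1 {t<..} < \<infinity>" using fin'(1) by (simp add: e1 ennreal_max_0 less_top)
    have "enn2real (\<integral>\<^sup>+x. ennreal (?g x) \<partial>lint 0 L) = enn2real (\<integral>\<^sup>+x. ennreal (- ?g x) \<partial>lint 0 L)"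
      using tail[of t] real_lebesgue_integral_def[OF gi]
      by (simp add: set_lebesgue_integral_def)
    then have "ennreal (enn2real (\<integral>\<^sup>+x. ennreal (?g x) \<partial>lint 0 L))
        = ennreal (enn2real (\<integral>\<^sup>+x. ennreal (- ?g x) \<partial>lint 0 L))"
      by (rule arg_cong)
    then have "(\<integral>\<^sup>+x. ennreal (?g x) \<partial>lint 0 L) = (\<integral>\<^sup>+x. ennreal (- ?g x) \<partial>lint 0 L)"
      using fin' by (subst (asm) (1 2) ennreal_enn2real) (simp_all only: less_top infinity_ennreal_def)
    then show "emeasure ?N1 {t<..} = emeasure ?N2 {t<..}"
      by (simp add: e1 e2 ennreal_max_0)
  qed simp_all
  then have "AE x in lint 0 L. f1 x = f2 x"
    using fin finite_density_unique[of f1 "lint 0 L" f2] by simp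
  then show ?thesis
    unfolding AE_lint
  proof eventually_elim
    case (elim x)
    show ?case
    proof
      assume "x \<in> {0..L}"
      with elim have "max 0 (f x) = max 0 (- f x)"
        by (simp add: f1_def f2_def)
      then show "f x = 0" by linarith
    qed
  qed
qed auto

section \<open>A chain rule inequality\<close>

lemma integrable_lint_subset:
  fixes f :: "real \<Rightarrow> real"
  assumes "integrable (lint a b) f" "a \<le> a'" "b' \<le> b"
  shows "integrable (lint a' b') f"
proof -
  have [measurable]: "f \<in> borel_measurable borel"
    using borel_measurable_integrable[OF assms(1)] by simp
  show ?thesis
    using assms by (auto simp: integrable_lint intro: set_integrable_subset)
qed

lemma integral_lint_split:
  fixes f :: "real \<Rightarrow> real"
  assumes int: "integrable (lint a c) f" and "a \<le> b" "b \<le> c"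
  shows "(\<integral>y. f y \<partial>lint a c) = (\<integral>y. f y \<partial>lint a b) + (\<integral>y. f y \<partial>lint b c)"
proof -
  have [measurable]: "f \<in> borel_measurable borel"
    using borel_measurable_integrable[OF assms(1)] by simp
  have "AE x in lborel. \<not> (x \<in> {a..b} \<and> x \<in> {b..c})"
    using AE_lborel_singleton[of b] by (auto elim!: eventually_mono)
  then have "(LINT x:{a..b} \<union> {b..c}|lborel. f x) = (LINT x:{a..b}|lborel. f x) + (LINT x:{b..c}|lborel. f x)"
    using assms integrable_lint_subset[OF int, of a b] integrable_lint_subset[OF int, of b c]
    by (intro set_integral_Un_AE) (auto simp: integrable_lint)
  moreover have "{a..b} \<union> {b..c} = {a..c}" using assms by auto
  ultimately show ?thesis by (simp add: integral_lint)
qed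

lemma continuous_on_integral_lint:
  fixes f :: "real \<Rightarrow> real"
  assumes int: "integrable (lint a b) f"
  shows "continuous_on {a..b} (\<lambda>t. \<integral>s. f s \<partial>lint a t)"
proof -
  have [measurable]: "f \<in> borel_measurable borel"
    using borel_measurable_integrable[OF assms(1)] by simp
  have si: "set_integrable lborel {a..t} f" if "t \<le> b" for t
    using integrable_lint_subset[OF int order_refl that] by (simp add: integrable_lint)
  have "continuous_on {a..b} (\<lambda>t. integral {a..t} f)"
    by (intro indefinite_integral_continuous_1 set_borel_integral_eq_integral si order_refl)
  then show ?thesis
    by (rule continuous_on_eq) (auto simp: integral_lint set_borel_integral_eq_integral(2)[OF si])
qed

text \<open>Stands in for an argument by the sign of a derivative, which may exist only almost
  everywhere: telescoping over equal pieces shorter than \<open>d\<close> gives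
  \<open>H b - H a \<le> e * (\<mu> b - \<mu> a)\<close> for every \<open>e > 0\<close>.\<close>

lemma le_of_small_increments:
  fixes H \<mu> :: "real \<Rightarrow> real"
  assumes ab: "a \<le> b"
    and inc: "\<And>e. 0 < e \<Longrightarrow> \<exists>d>0. \<forall>s t. a \<le> s \<longrightarrow> s \<le> t \<longrightarrow> t \<le> b \<longrightarrow> t - s < d \<longrightarrow> H t - H s \<le> e * (\<mu> t - \<mu> s)"
  shows "H b \<le> H a"
proof -
  have main: "H b - H a \<le> e * (\<mu> b - \<mu> a)" if e: "0 < e" for e
  proof -
    obtain d where d: "0 < d" "\<And>s t. a \<le> s \<Longrightarrow> s \<le> t \<Longrightarrow> t \<le> b \<Longrightarrow> t - s < d \<Longrightarrow> H t - H s \<le> e * (\<mu> t - \<mu> s)"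
      using inc[OF e] by blast
    obtain n :: nat where n: "(b - a) / d < real n" using reals_Archimedean2 by blast
    have n0: "0 < real n"
    proof -
      have "0 \<le> (b - a) / d" using ab d(1) by simp
      with n show ?thesis by linarith
    qed
    define x where "x i = a + real i * ((b - a) / n)" for i
    have step: "x (Suc i) - x i = (b - a) / n" for i by (simp add: x_def distrib_right add_divide_distrib)
    have small: "(b - a) / n < d" using n n0 d(1) by (simp add: field_simps)
    have x0: "x 0 = a" and xn: "x n = b" using n0 by (simp_all add: x_def)
    have nonneg: "0 \<le> (b - a) / n" using ab n0 by simp
    have "H (x k) - H a \<le> e * (\<mu> (x k) - \<mu> a)" if "k \<le> n" for k
      using that
    proof (induction k)
      case (Suc k)
      have "x (Suc k) \<le> b"
      proof -
        have "real (Suc k) * ((b - a) / n) \<le> real n * ((b - a) / n)"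
          using Suc.prems nonneg by (intro mult_right_mono) auto
        then show ?thesis using xn by (simp add: x_def)
      qed
      moreover have "a \<le> x k"
        unfolding x_def le_add_same_cancel1 by (rule mult_nonneg_nonneg[OF _ nonneg]) simp
      ultimately have "H (x (Suc k)) - H (x k) \<le> e * (\<mu> (x (Suc k)) - \<mu> (x k))"
        using step[of k] small nonneg by (intro d) auto
      moreover have "H (x k) - H a \<le> e * (\<mu> (x k) - \<mu> a)"
        using Suc by simp
      ultimately show ?case by (simp add: algebra_simps)
    qed (simp add: x0)
    from this[of n] show ?thesis by (simp add: xn)
  qed
  have "H b - H a \<le> 0"
  proof (rule field_le_epsilon)
    fix e :: real assume e: "0 < e"
    \<comment> \<open>The maximum with 1 allows the division and covers either sign of
      \<open>\<mu> b - \<mu> a\<close>.\<close>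
    define m where "m = max 1 (\<mu> b - \<mu> a)"
    have "H b - H a \<le> e / m * (\<mu> b - \<mu> a)"
      using e by (intro main) (auto simp: m_def)
    also have "\<dots> \<le> e / m * m"
      using e by (intro mult_left_mono) (auto simp: m_def)
    finally show "H b - H a \<le> 0 + e" by (simp add: m_def)
  qed
  then show ?thesis by simp
qed

text \<open>One half of the chain rule for the convex function \<open>\<bar>x\<bar>\<^sup>p\<close> along an absolutely
  continuous \<open>f\<close>: convexity bounds each increment by the derivative at its right endpoint.\<close>

lemma powr_chain_rule_le:
  fixes f h :: "real \<Rightarrow> real"
  assumes p: "1 < p" and ab: "a \<le> b" and h: "integrable (lint a b) h"
    and f_meas [measurable]: "f \<in> borel_measurable borel"
    and f: "\<And>t. a \<le> t \<Longrightarrow> t \<le> b \<Longrightarrow> f t = f a - (\<integral>s. h s \<partial>lint a t)"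
  shows "integrable (lint a b) (\<lambda>s. spow p (f s) * h s)"
    and "\<bar>f b\<bar> powr p \<le> \<bar>f a\<bar> powr p - p * (\<integral>s. spow p (f s) * h s \<partial>lint a b)"
proof -
  have [measurable]: "h \<in> borel_measurable borel"
    using borel_measurable_integrable[OF h] by simp
  have "continuous_on {a..b} (\<lambda>t. f a - (\<integral>s. h s \<partial>lint a t))"
    by (intro continuous_intros continuous_on_integral_lint h)
  then have "continuous_on {a..b} f"
    by (rule continuous_on_eq) (rule f[symmetric], simp_all)
  then have cont: "continuous_on {a..b} (\<lambda>t. spow p (f t))"
    using continuous_on_compose2[OF continuous_on_spow[OF p, of UNIV]] by blast
  then have "bounded ((\<lambda>t. spow p (f t)) ` {a..b})"
    by (intro compact_imp_bounded compact_continuous_image) auto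
  then obtain K where "\<forall>x\<in>(\<lambda>t. spow p (f t)) ` {a..b}. norm x \<le> K"
    unfolding bounded_iff by blast
  then have K: "\<bar>spow p (f t)\<bar> \<le> K" if "t \<in> {a..b}" for t
    using that by auto
  have int_abs: "integrable (lint a b) (\<lambda>s. K * \<bar>h s\<bar>)" using h by simp
  show int: "integrable (lint a b) (\<lambda>s. spow p (f s) * h s)"
  proof (rule Bochner_Integration.integrable_bound[OF int_abs])
    show "AE s in lint a b. norm (spow p (f s) * h s) \<le> norm (K * \<bar>h s\<bar>)"
      using AE_lint_mem
    proof eventually_elim
      case (elim s)
      have "\<bar>spow p (f s)\<bar> * \<bar>h s\<bar> \<le> \<bar>K\<bar> * \<bar>h s\<bar>"
        using K[OF elim] by (intro mult_right_mono) auto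
      then show ?case by (simp add: abs_mult)
    qed
  qed simp
  \<comment> \<open>\<open>H b \<le> H a\<close> is the claim. The function \<open>\<mu>\<close>
    bounds the variation of \<open>f\<close>: replacing \<open>spow p (f r)\<close> by its value at
    the right endpoint of a short interval costs at most \<open>e / p\<close> per unit of
    \<open>\<mu>\<close>, by uniform continuity.\<close>
  define H where "H t = \<bar>f t\<bar> powr p + p * (\<integral>s. spow p (f s) * h s \<partial>lint a t)" for t
  define \<mu> where "\<mu> t = (\<integral>s. \<bar>h s\<bar> \<partial>lint a t)" for t
  have "H b \<le> H a"
  proof (rule le_of_small_increments[OF ab, where \<mu>=\<mu>])
    fix e :: real assume e: "0 < e"
    have "uniformly_continuous_on {a..b} (\<lambda>t. spow p (f t))"
      by (intro compact_uniformly_continuous cont) auto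
    moreover have "0 < e / p" using e p by simp
    ultimately obtain d where d: "0 < d"
        "\<And>s t. s \<in> {a..b} \<Longrightarrow> t \<in> {a..b} \<Longrightarrow> dist s t < d \<Longrightarrow> dist (spow p (f s)) (spow p (f t)) < e / p"
      unfolding uniformly_continuous_on_def by blast
    have "H t - H s \<le> e * (\<mu> t - \<mu> s)" if st: "a \<le> s" "s \<le> t" "t \<le> b" "t - s < d" for s t
    proof -
      have hi: "integrable (lint a t) h" "integrable (lint s t) h"
        "integrable (lint a t) (\<lambda>s. \<bar>h s\<bar>)" "integrable (lint s t) (\<lambda>s. \<bar>h s\<bar>)"
        using integrable_lint_subset[OF h] st by auto
      have pi: "integrable (lint a t) (\<lambda>s. spow p (f s) * h s)" "integrable (lint s t) (\<lambda>s. spow p (f s) * h s)"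
        using integrable_lint_subset[OF int] st by auto
      have fst: "f s - f t = (\<integral>r. h r \<partial>lint s t)"
        using f[of s] f[of t] integral_lint_split[OF hi(1), of s] st by simp
      have \<mu>st: "\<mu> t - \<mu> s = (\<integral>r. \<bar>h r\<bar> \<partial>lint s t)"
        using integral_lint_split[OF hi(3), of s] st by (simp add: \<mu>_def)
      have "H t - H s = \<bar>f t\<bar> powr p - \<bar>f s\<bar> powr p + p * (\<integral>r. spow p (f r) * h r \<partial>lint s t)"
        using integral_lint_split[OF pi(1), of s] st by (simp add: H_def algebra_simps)
      also have "\<dots> \<le> - p * (spow p (f t) * (f s - f t)) + p * (\<integral>r. spow p (f r) * h r \<partial>lint s t)"
        using powr_tangent[OF p, of "f t" "f s"] by simp
      also have "\<dots> = p * (\<integral>r. spow p (f r) * h r - spow p (f t) * h r \<partial>lint s t)"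
        using pi hi by (simp add: fst algebra_simps)
      also have "\<dots> \<le> p * (\<integral>r. e / p * \<bar>h r\<bar> \<partial>lint s t)"
      proof (intro mult_left_mono integral_mono_AE)
        show "AE r in lint s t. spow p (f r) * h r - spow p (f t) * h r \<le> e / p * \<bar>h r\<bar>"
          using AE_lint_mem
        proof eventually_elim
          case (elim r)
          then have "\<bar>spow p (f r) - spow p (f t)\<bar> \<le> e / p"
            using d(2)[of r t] st by (auto simp: dist_real_def)
          then have "\<bar>spow p (f r) - spow p (f t)\<bar> * \<bar>h r\<bar> \<le> e / p * \<bar>h r\<bar>"
            by (intro mult_right_mono) auto
          moreover have "spow p (f r) * h r - spow p (f t) * h r \<le> \<bar>spow p (f r) - spow p (f t)\<bar> * \<bar>h r\<bar>"
            unfolding left_diff_distrib[symmetric] abs_mult[symmetric] by simp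
          ultimately show ?case by linarith
        qed
      qed (use pi hi p in auto)
      also have "\<dots> = e * (\<mu> t - \<mu> s)"
        using p by (simp add: \<mu>st)
      finally show ?thesis .
    qed
    with d(1) show "\<exists>d>0. \<forall>s t. a \<le> s \<longrightarrow> s \<le> t \<longrightarrow> t \<le> b \<longrightarrow> t - s < d \<longrightarrow> H t - H s \<le> e * (\<mu> t - \<mu> s)"
      by blast
  qed
  moreover have "(\<integral>s. spow p (f s) * h s \<partial>lint a a) = 0"
  proof (rule integral_eq_zero_AE)
    show "AE s in lint a a. spow p (f s) * h s = 0"
      unfolding AE_lint using AE_lborel_singleton[of a] by eventually_elim auto
  qed
  ultimately show "\<bar>f b\<bar> powr p \<le> \<bar>f a\<bar> powr p - p * (\<integral>s. spow p (f s) * h s \<partial>lint a b)"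
    by (simp add: H_def)
qed

section \<open>Energy dissipation for transport with reflection\<close>

abbreviation circ :: "real measure" where
  "circ \<equiv> lint (-1) 1"

text \<open>What is kept of the wave equation, with \<open>b\<close> for half the extended damping.
  In \<open>evol\<close> one null set of \<open>y\<close> serves all \<open>T\<close>.
  \<open>E_bdd\<close> is a qualitative a priori bound, which provides integrability before any
  energy inequality is available.\<close>

locale reflected_transport =
  fixes p B b0 c d :: real and b :: "real \<Rightarrow> real" and F :: "real \<Rightarrow> real \<Rightarrow> real"
  assumes p: "1 < p"
    and b_meas [measurable]: "b \<in> borel_measurable borel"
    and b_nonneg: "0 \<le> b x" and b_le: "b x \<le> B"
    and b_even: "b (- x) = b x" and b_per: "b (x + 2) = b x"
    and cd: "0 \<le> c" "c < d" "d \<le> 1" and b0: "0 < b0"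
    and b_ge: "x \<in> {c..d} \<Longrightarrow> b0 \<le> b x"
    and F_meas: "(\<lambda>(t, y). F t y) \<in> borel_measurable (borel \<Otimes>\<^sub>M borel)"
    and F_per: "F t (y + 2) = F t y"
    and E0_fin: "(\<integral>\<^sup>+y. ennreal (\<bar>F 0 y\<bar> powr p) \<partial>circ) < \<infinity>"
    and E_bdd: "\<exists>C. AE t in lborel. 0 \<le> t \<longrightarrow> (\<integral>\<^sup>+y. ennreal (\<bar>F t y\<bar> powr p) \<partial>circ) \<le> ennreal C"
    and evol: "AE y in circ. \<forall>T\<ge>0. integrable (lint 0 T) (\<lambda>s. b (y - s) * (F s y - F s (2 * s - y))) \<and>
        F T y = F 0 y - (\<integral>s. b (y - s) * (F s y - F s (2 * s - y)) \<partial>lint 0 T)"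
    and mean0: "0 \<le> t \<Longrightarrow> (\<integral>y. F t y \<partial>circ) = 0"
begin

lemma measurable_F [measurable (raw)]:
  assumes "f \<in> borel_measurable M" "g \<in> borel_measurable M"
  shows "(\<lambda>x. F (f x) (g x)) \<in> borel_measurable M"
  using measurable_compose[OF measurable_Pair[OF assms] F_meas] by simp

text \<open>Minus the time derivative of \<open>F\<close> at fixed \<open>y\<close>.\<close>

definition h :: "real \<Rightarrow> real \<Rightarrow> real" where
  "h s y = b (y - s) * (F s y - F s (2 * s - y))"

definition E :: "real \<Rightarrow> ennreal" where
  "E t = (\<integral>\<^sup>+y. ennreal (\<bar>F t y\<bar> powr p) \<partial>circ)"

text \<open>The dissipation density; evenness of \<open>b\<close> makes it invariant under
  \<open>y \<mapsto> 2 * s - y\<close>.\<close>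

definition \<psi> :: "real \<Rightarrow> real \<Rightarrow> real" where
  "\<psi> s y = b (y - s) * ((F s y - F s (2 * s - y)) * (spow p (F s y) - spow p (F s (2 * s - y))))"

definition D :: "real \<Rightarrow> real \<Rightarrow> ennreal" where
  "D t0 t = (\<integral>\<^sup>+s. \<integral>\<^sup>+y. ennreal (\<psi> s y) \<partial>circ \<partial>lint t0 t)"

lemma measurable_h [measurable (raw)]:
  assumes [measurable]: "f \<in> borel_measurable M" "g \<in> borel_measurable M"
  shows "(\<lambda>x. h (f x) (g x)) \<in> borel_measurable M"
  unfolding h_def by measurable

lemma measurable_\<psi> [measurable (raw)]:
  assumes [measurable]: "f \<in> borel_measurable M" "g \<in> borel_measurable M"
  shows "(\<lambda>x. \<psi> (f x) (g x)) \<in> borel_measurable M"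
  unfolding \<psi>_def by measurable

lemma B_pos: "0 < B"
  using b_ge[of c] b_le[of c] b0 cd by auto

lemma b_swap: "b (y - s) = b (s - y)"
  using b_even[of "y - s"] by simp

lemma F_per_diff: "F t (h' - (y + 2)) = F t (h' - y)"
  using F_per[of t "h' - (y + 2)"] by (simp add: algebra_simps)

lemma b_per_diff: "b (y + 2 - h') = b (y - h')"
  using b_per[of "y - h'"] by (simp add: algebra_simps)

lemma E_reflect: "(\<integral>\<^sup>+y. ennreal (\<bar>F t (2 * s - y)\<bar> powr p) \<partial>circ) = E t"
  using nn_integral_period_reflect[of "\<lambda>y. ennreal (\<bar>F t y\<bar> powr p)", where h="2 * s" and s="-1"]
  by (simp add: E_def F_per)

lemma flow:
  assumes "0 \<le> t0"
  shows "AE y in circ. \<forall>t\<ge>t0. integrable (lint t0 t) (\<lambda>s. h s y) \<and> F t y = F t0 y - (\<integral>s. h s y \<partial>lint t0 t)"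
  using evol
proof eventually_elim
  case (elim y)
  show ?case
  proof (intro allI impI)
    fix t assume t: "t0 \<le> t"
    have 1: "integrable (lint 0 t) (\<lambda>s. h s y)" "F t y = F 0 y - (\<integral>s. h s y \<partial>lint 0 t)"
      "F t0 y = F 0 y - (\<integral>s. h s y \<partial>lint 0 t0)"
      using elim[rule_format, of t] elim[rule_format, of t0] t assms
      unfolding h_def by (blast intro: order_trans)+
    show "integrable (lint t0 t) (\<lambda>s. h s y) \<and> F t y = F t0 y - (\<integral>s. h s y \<partial>lint t0 t)"
      using 1 integrable_lint_subset[OF 1(1), of t0 t] integral_lint_split[OF 1(1), of t0] t assms by simp
  qed
qed

lemma nn_E_bdd: obtains C where "0 \<le> C" "\<And>t0 t. 0 \<le> t0 \<Longrightarrow> t0 \<le> t \<Longrightarrow> (\<integral>\<^sup>+s. E s \<partial>lint t0 t) \<le> ennreal (C * (t - t0))"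
proof -
  obtain C where C: "AE t in lborel. 0 \<le> t \<longrightarrow> E t \<le> ennreal C"
    using E_bdd by (auto simp: E_def)
  show ?thesis
  proof (rule that[of "max 0 C"])
    fix t0 t :: real assume t: "0 \<le> t0" "t0 \<le> t"
    have "(\<integral>\<^sup>+s. E s \<partial>lint t0 t) \<le> (\<integral>\<^sup>+s. ennreal (max 0 C) \<partial>lint t0 t)"
    proof (rule nn_integral_mono_AE, unfold AE_lint)
      show "AE x in lborel. x \<in> {t0..t} \<longrightarrow> E x \<le> ennreal (max 0 C)"
        using C
      proof eventually_elim
        case (elim x)
        have "ennreal C \<le> ennreal (max 0 C)"
          by (intro ennreal_leI) simp
        then show ?case
          using elim t by (intro impI) (rule order_trans[of _ "ennreal C"], simp_all)
      qed
    qed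
    also have "\<dots> = ennreal (max 0 C * (t - t0))"
      using t by (simp add: emeasure_lint ennreal_mult)
    finally show "(\<integral>\<^sup>+s. E s \<partial>lint t0 t) \<le> ennreal (max 0 C * (t - t0))" .
  qed simp
qed

lemma spow_h_le: "\<bar>spow p (F s y) * h s y\<bar> \<le> B * (2 * \<bar>F s y\<bar> powr p + \<bar>F s (2 * s - y)\<bar> powr p)"
proof -
  let ?R = "F s (2 * s - y)"
  have "\<bar>spow p (F s y) * h s y\<bar> = b (y - s) * \<bar>spow p (F s y) * F s y - spow p (F s y) * ?R\<bar>"
    using b_nonneg[of "y - s"] by (simp add: h_def abs_mult right_diff_distrib[symmetric])
  also have "\<dots> \<le> b (y - s) * (\<bar>spow p (F s y) * F s y\<bar> + \<bar>spow p (F s y) * ?R\<bar>)"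
    using b_nonneg by (intro mult_left_mono abs_triangle_ineq4) auto
  also have "\<dots> \<le> B * (\<bar>F s y\<bar> powr p + (\<bar>F s y\<bar> powr p + \<bar>?R\<bar> powr p))"
    using b_nonneg b_le[of "y - s"] B_pos abs_spow_mult_le[OF p, of "F s y" ?R]
    by (intro mult_mono add_mono) (auto simp: spow_mult_self)
  finally show ?thesis by simp
qed

text \<open>Absolute integrability over the strip, which Fubini needs in \<open>D_eq\<close>; the
  mirrored integrand is covered by reflecting the circle.\<close>

lemma nn_spow_h:
  assumes "0 \<le> t0" "t0 \<le> t"
  shows "(\<integral>\<^sup>+s. \<integral>\<^sup>+y. ennreal \<bar>spow p (F s y) * h s y\<bar> \<partial>circ \<partial>lint t0 t) < \<infinity>"
    and "(\<integral>\<^sup>+s. \<integral>\<^sup>+y. ennreal \<bar>spow p (F s (2 * s - y)) * h s (2 * s - y)\<bar> \<partial>circ \<partial>lint t0 t) < \<infinity>"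
proof -
  obtain C where C: "0 \<le> C" "\<And>t0 t. 0 \<le> t0 \<Longrightarrow> t0 \<le> t \<Longrightarrow> (\<integral>\<^sup>+s. E s \<partial>lint t0 t) \<le> ennreal (C * (t - t0))"
    using nn_E_bdd by blast
  have meas: "E \<in> borel_measurable borel"
    unfolding E_def[abs_def] by measurable
  have fin: "(\<integral>\<^sup>+s. ennreal (3 * B) * E s \<partial>lint t0 t) < \<infinity>"
    using C(2)[OF assms] meas by (simp add: nn_integral_cmult ennreal_mult_less_top le_less_trans[OF _ ennreal_less_top])
  \<comment> \<open>Two parts come from \<open>F s y\<close> and one from the mirror value, whose
    energy is the same.\<close>
  have b1: "(\<integral>\<^sup>+y. ennreal (B * (2 * \<bar>F s y\<bar> powr p + \<bar>F s (2 * s - y)\<bar> powr p)) \<partial>circ) = ennreal (3 * B) * E s" for s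
  proof -
    have "(\<integral>\<^sup>+y. ennreal (B * (2 * \<bar>F s y\<bar> powr p + \<bar>F s (2 * s - y)\<bar> powr p)) \<partial>circ)
        = (\<integral>\<^sup>+y. ennreal B * (2 * ennreal (\<bar>F s y\<bar> powr p) + ennreal (\<bar>F s (2 * s - y)\<bar> powr p)) \<partial>circ)"
      using B_pos by (intro nn_integral_cong) (simp add: ennreal_mult ennreal_plus)
    also have "\<dots> = ennreal B * (2 * E s + E s)"
      by (simp add: nn_integral_cmult nn_integral_add E_reflect E_def[symmetric])
    also have "\<dots> = ennreal (3 * B) * E s"
    proof -
      have "2 * E s + E s = 3 * E s"
        using distrib_right[of 2 1 "E s"] by simp
      then show ?thesis
        using B_pos by (simp add: ennreal_mult mult_ac)
    qed
    finally show ?thesis .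
  qed
  show "(\<integral>\<^sup>+s. \<integral>\<^sup>+y. ennreal \<bar>spow p (F s y) * h s y\<bar> \<partial>circ \<partial>lint t0 t) < \<infinity>"
    by (rule le_less_trans[OF _ fin], intro nn_integral_mono, subst b1[symmetric], intro nn_integral_mono ennreal_leI spow_h_le)
  show "(\<integral>\<^sup>+s. \<integral>\<^sup>+y. ennreal \<bar>spow p (F s (2 * s - y)) * h s (2 * s - y)\<bar> \<partial>circ \<partial>lint t0 t) < \<infinity>"
  proof (rule le_less_trans[OF _ fin], intro nn_integral_mono)
    fix s
    have "(\<integral>\<^sup>+y. ennreal \<bar>spow p (F s (2 * s - y)) * h s (2 * s - y)\<bar> \<partial>circ)
      = (\<integral>\<^sup>+y. ennreal \<bar>spow p (F s y) * h s y\<bar> \<partial>circ)"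
      by (rule nn_integral_period_reflect[of "\<lambda>y. ennreal \<bar>spow p (F s y) * h s y\<bar>", where s="-1", simplified])
         (auto simp: h_def F_per F_per_diff b_per_diff)
    also have "\<dots> \<le> ennreal (3 * B) * E s"
      by (subst b1[symmetric], intro nn_integral_mono ennreal_leI spow_h_le)
    finally show "(\<integral>\<^sup>+y. ennreal \<bar>spow p (F s (2 * s - y)) * h s (2 * s - y)\<bar> \<partial>circ) \<le> ennreal (3 * B) * E s" .
  qed
qed

lemma integrable_spow_h:
  assumes "0 \<le> t0" "t0 \<le> t"
  shows "integrable (lint t0 t \<Otimes>\<^sub>M circ) (\<lambda>(s, y). spow p (F s y) * h s y)"
    and "integrable (lint t0 t \<Otimes>\<^sub>M circ) (\<lambda>(s, y). spow p (F s (2 * s - y)) * h s (2 * s - y))"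
  using nn_spow_h[OF assms]
  by (auto simp: integrable_iff_bounded lint.nn_integral_fst[symmetric] case_prod_beta)

lemma \<psi>_eq: "spow p (F s y) * h s y + spow p (F s (2 * s - y)) * h s (2 * s - y) = \<psi> s y"
  using b_swap[of y s] by (simp add: \<psi>_def h_def algebra_simps)

lemma \<psi>_nonneg: "0 \<le> \<psi> s y"
  unfolding \<psi>_def by (intro mult_nonneg_nonneg b_nonneg spow_diff_mult_nonneg p)

text \<open>The reflection \<open>y \<mapsto> 2 * s - y\<close> preserves integrals over the circle,
  so the integrand and its mirror have the same integral; their sum is \<open>\<psi>\<close>, hence
  the factor 2.\<close>

lemma D_eq:
  assumes "0 \<le> t0" "t0 \<le> t"
  shows "D t0 t = ennreal (2 * (\<integral>y. \<integral>s. spow p (F s y) * h s y \<partial>lint t0 t \<partial>circ))"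
    and "0 \<le> 2 * (\<integral>y. \<integral>s. spow p (F s y) * h s y \<partial>lint t0 t \<partial>circ)"
proof -
  let ?k = "\<lambda>s y. spow p (F s y) * h s y"
  note i = integrable_spow_h[OF assms]
  have "(\<integral>y. \<integral>s. ?k s y \<partial>lint t0 t \<partial>circ) = (\<integral>s. \<integral>y. ?k s y \<partial>circ \<partial>lint t0 t)"
    by (rule lint_pair.Fubini_integral[OF i(1)])
  also have "\<dots> = (\<integral>s. \<integral>y. ?k s (2 * s - y) \<partial>circ \<partial>lint t0 t)"
    by (subst integral_period_reflect) (auto simp: h_def F_per F_per_diff b_per_diff)
  finally have 1: "(\<integral>y. \<integral>s. ?k s y \<partial>lint t0 t \<partial>circ) = integral\<^sup>L (lint t0 t \<Otimes>\<^sub>M circ) (\<lambda>(s, y). ?k s (2 * s - y))"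
    by (simp add: lint_pair.integral_fst[OF i(2)])
  have 2: "(\<integral>y. \<integral>s. ?k s y \<partial>lint t0 t \<partial>circ) = integral\<^sup>L (lint t0 t \<Otimes>\<^sub>M circ) (\<lambda>(s, y). ?k s y)"
    by (rule lint_pair.integral_snd[OF i(1)])
  have "2 * (\<integral>y. \<integral>s. ?k s y \<partial>lint t0 t \<partial>circ) = integral\<^sup>L (lint t0 t \<Otimes>\<^sub>M circ) (\<lambda>z. (\<lambda>(s, y). ?k s y) z + (\<lambda>(s, y). ?k s (2 * s - y)) z)"
    using 1 2 by (subst Bochner_Integration.integral_add[OF i]) simp
  also have "\<dots> = integral\<^sup>L (lint t0 t \<Otimes>\<^sub>M circ) (\<lambda>(s, y). \<psi> s y)"
    by (intro Bochner_Integration.integral_cong) (auto simp: \<psi>_eq)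
  finally have 3: "2 * (\<integral>y. \<integral>s. ?k s y \<partial>lint t0 t \<partial>circ) = integral\<^sup>L (lint t0 t \<Otimes>\<^sub>M circ) (\<lambda>(s, y). \<psi> s y)" .
  have "integrable (lint t0 t \<Otimes>\<^sub>M circ) (\<lambda>z. (\<lambda>(s, y). ?k s y) z + (\<lambda>(s, y). ?k s (2 * s - y)) z)"
    by (intro Bochner_Integration.integrable_add i)
  moreover have "(\<lambda>z. (\<lambda>(s, y). ?k s y) z + (\<lambda>(s, y). ?k s (2 * s - y)) z) = (\<lambda>(s, y). \<psi> s y)"
    by (auto simp: fun_eq_iff \<psi>_eq)
  ultimately have int: "integrable (lint t0 t \<Otimes>\<^sub>M circ) (\<lambda>(s, y). \<psi> s y)"
    by (simp only:)
  have "D t0 t = (\<integral>\<^sup>+z. ennreal (case z of (s, y) \<Rightarrow> \<psi> s y) \<partial>(lint t0 t \<Otimes>\<^sub>M circ))"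
    unfolding D_def by (subst lint.nn_integral_fst[symmetric]) auto
  also have "\<dots> = ennreal (integral\<^sup>L (lint t0 t \<Otimes>\<^sub>M circ) (\<lambda>(s, y). \<psi> s y))"
    using int by (intro nn_integral_eq_integral) (auto simp: \<psi>_nonneg)
  finally show "D t0 t = ennreal (2 * (\<integral>y. \<integral>s. ?k s y \<partial>lint t0 t \<partial>circ))" by (simp only: 3)
  show "0 \<le> 2 * (\<integral>y. \<integral>s. ?k s y \<partial>lint t0 t \<partial>circ)"
    unfolding 3 by (intro Bochner_Integration.integral_nonneg) (auto simp: \<psi>_nonneg)
qed

lemma pointwise_energy:
  assumes "0 \<le> t0" "t0 \<le> t"
  shows "AE y in circ. \<bar>F t y\<bar> powr p \<le> \<bar>F t0 y\<bar> powr p - p * (\<integral>s. spow p (F s y) * h s y \<partial>lint t0 t)"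
  using flow[OF assms(1)]
proof eventually_elim
  case (elim y)
  show ?case
  proof (rule powr_chain_rule_le(2)[OF p assms(2)])
    show "integrable (lint t0 t) (\<lambda>s. h s y)" using elim assms(2) by blast
    show "F \<tau> y = F t0 y - (\<integral>s. h s y \<partial>lint t0 \<tau>)" if "t0 \<le> \<tau>" "\<tau> \<le> t" for \<tau>
      using elim that by blast
  qed simp
qed

text \<open>\<open>E_bdd\<close> leaves out a null set of times; the pointwise energy inequality,
  integrated from time 0, reaches every time.\<close>

lemma E_finite:
  assumes "0 \<le> t"
  shows "E t < \<infinity>"
proof -
  let ?k = "\<lambda>s y. spow p (F s y) * h s y"
  have "E t \<le> (\<integral>\<^sup>+y. ennreal (\<bar>F 0 y\<bar> powr p) + ennreal p * (\<integral>\<^sup>+s. ennreal \<bar>?k s y\<bar> \<partial>lint 0 t) \<partial>circ)"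
    unfolding E_def
  proof (rule nn_integral_mono_AE)
    have "AE y in circ. integrable (lint 0 t) (\<lambda>s. ?k s y)"
      by (rule lint_pair.AE_integrable_snd[OF integrable_spow_h(1)]) (use assms in auto)
    then show "AE y in circ. ennreal (\<bar>F t y\<bar> powr p) \<le> ennreal (\<bar>F 0 y\<bar> powr p) + ennreal p * (\<integral>\<^sup>+s. ennreal \<bar>?k s y\<bar> \<partial>lint 0 t)"
      using pointwise_energy[OF order_refl assms]
    proof eventually_elim
      case (elim y)
      have "\<bar>\<integral>s. ?k s y \<partial>lint 0 t\<bar> \<le> (\<integral>s. \<bar>?k s y\<bar> \<partial>lint 0 t)"
        using integral_abs_bound by blast
      then have "- (\<integral>s. ?k s y \<partial>lint 0 t) \<le> (\<integral>s. \<bar>?k s y\<bar> \<partial>lint 0 t)"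
        by linarith
      then have "p * - (\<integral>s. ?k s y \<partial>lint 0 t) \<le> p * (\<integral>s. \<bar>?k s y\<bar> \<partial>lint 0 t)"
        using p by (intro mult_left_mono) auto
      then have "\<bar>F t y\<bar> powr p \<le> \<bar>F 0 y\<bar> powr p + p * (\<integral>s. \<bar>?k s y\<bar> \<partial>lint 0 t)"
        using elim(2) by simp
      then have "ennreal (\<bar>F t y\<bar> powr p) \<le> ennreal (\<bar>F 0 y\<bar> powr p + p * (\<integral>s. \<bar>?k s y\<bar> \<partial>lint 0 t))"
        by (rule ennreal_leI)
      also have "\<dots> = ennreal (\<bar>F 0 y\<bar> powr p) + ennreal p * ennreal (\<integral>s. \<bar>?k s y\<bar> \<partial>lint 0 t)"
        using p by (simp add: ennreal_plus ennreal_mult)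
      also have "ennreal (\<integral>s. \<bar>?k s y\<bar> \<partial>lint 0 t) = (\<integral>\<^sup>+s. ennreal \<bar>?k s y\<bar> \<partial>lint 0 t)"
        using elim(1) by (intro nn_integral_eq_integral[symmetric]) auto
      finally show ?case .
    qed
  qed
  also have "\<dots> = E 0 + ennreal p * (\<integral>\<^sup>+y. \<integral>\<^sup>+s. ennreal \<bar>?k s y\<bar> \<partial>lint 0 t \<partial>circ)"
    unfolding E_def by (simp add: nn_integral_add nn_integral_cmult)
  also have "(\<integral>\<^sup>+y. \<integral>\<^sup>+s. ennreal \<bar>?k s y\<bar> \<partial>lint 0 t \<partial>circ) = (\<integral>\<^sup>+s. \<integral>\<^sup>+y. ennreal \<bar>?k s y\<bar> \<partial>circ \<partial>lint 0 t)"
    by (rule lint_pair.Fubini') measurable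
  also have "E 0 + ennreal p * \<dots> < \<infinity>"
    using E0_fin nn_spow_h(1)[OF order_refl assms] by (auto simp: E_def ennreal_mult_less_top)
  finally show ?thesis .
qed

lemma integrable_powr_F:
  assumes "0 \<le> t"
  shows "integrable circ (\<lambda>y. \<bar>F t y\<bar> powr p)"
  using E_finite[OF assms] by (auto simp: integrable_iff_bounded E_def)

text \<open>The pointwise inequality integrated over the circle: \<open>p\<close> comes from the
  chain rule and \<open>1 / 2\<close> from the symmetrisation in \<open>D_eq\<close>.\<close>

lemma energy_inequality:
  assumes "0 \<le> t0" "t0 \<le> t"
  shows "E t + ennreal (p / 2) * D t0 t \<le> E t0"
proof -
  let ?k = "\<lambda>s y. spow p (F s y) * h s y"
  have t: "0 \<le> t" using assms by simp
  let ?I = "\<integral>y. \<integral>s. ?k s y \<partial>lint t0 t \<partial>circ"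
  have int: "integrable circ (\<lambda>y. \<integral>s. ?k s y \<partial>lint t0 t)"
    by (rule lint_pair.integrable_snd[OF integrable_spow_h(1)[OF assms]])
  have "(\<integral>y. \<bar>F t y\<bar> powr p \<partial>circ) \<le> (\<integral>y. \<bar>F t0 y\<bar> powr p - p * (\<integral>s. ?k s y \<partial>lint t0 t) \<partial>circ)"
    by (intro integral_mono_AE pointwise_energy assms integrable_powr_F t Bochner_Integration.integrable_diff
        integrable_mult_right int)
  also have "\<dots> = (\<integral>y. \<bar>F t0 y\<bar> powr p \<partial>circ) - p * ?I"
    using int integrable_powr_F[OF assms(1)] by simp
  finally have 1: "(\<integral>y. \<bar>F t y\<bar> powr p \<partial>circ) + p / 2 * (2 * ?I) \<le> (\<integral>y. \<bar>F t0 y\<bar> powr p \<partial>circ)"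
    by simp
  have eqE: "E s = ennreal (\<integral>y. \<bar>F s y\<bar> powr p \<partial>circ)" if "0 \<le> s" for s
    unfolding E_def using integrable_powr_F[OF that] by (intro nn_integral_eq_integral) auto
  have "E t + ennreal (p / 2) * D t0 t = ennreal (\<integral>y. \<bar>F t y\<bar> powr p \<partial>circ) + ennreal (p / 2) * ennreal (2 * ?I)"
    by (simp only: eqE[OF t] D_eq(1)[OF assms])
  also have "\<dots> = ennreal (\<integral>y. \<bar>F t y\<bar> powr p \<partial>circ) + ennreal (p / 2 * (2 * ?I))"
    using p D_eq(2)[OF assms] by (subst ennreal_mult[symmetric]) auto
  also have "\<dots> = ennreal ((\<integral>y. \<bar>F t y\<bar> powr p \<partial>circ) + p / 2 * (2 * ?I))"
    using p D_eq(2)[OF assms] by (intro ennreal_plus[symmetric] mult_nonneg_nonneg) auto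
  also have "\<dots> \<le> ennreal (\<integral>y. \<bar>F t0 y\<bar> powr p \<partial>circ)"
    by (intro ennreal_leI 1)
  finally show ?thesis by (simp add: eqE[OF assms(1)])
qed

lemma E_antimono: "0 \<le> t0 \<Longrightarrow> t0 \<le> t \<Longrightarrow> E t \<le> E t0"
  by (rule order_trans[OF _ energy_inequality[of t0 t]]) simp_all

end

section \<open>Increments of periodic functions\<close>

lemma ennreal_le_mult_inverse:
  assumes "ennreal a * X \<le> Y" "0 < a"
  shows "X \<le> ennreal (1 / a) * Y"
proof -
  have "X = ennreal (1 / a) * (ennreal a * X)"
    using assms(2) by (simp add: mult.assoc[symmetric] ennreal_mult[symmetric])
  also have "\<dots> \<le> ennreal (1 / a) * Y"
    by (intro mult_left_mono assms) simp
  finally show ?thesis .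
qed

text \<open>Increments with steps \<open>2u\<close>, \<open>c \<le> u \<le> d\<close>, control all increments: differences of two such
  steps fill a neighbourhood of \<open>0\<close>, multiples of which reach every \<open>x\<close>.\<close>

lemma periodic_increment_bound:
  fixes p c d :: real
  assumes p: "1 < p" and cd: "c < d"
  obtains \<kappa> where "0 \<le> \<kappa>"
    "\<And>f. f \<in> borel_measurable borel \<Longrightarrow> (\<And>y. f (y + 2) = f y) \<Longrightarrow> integrable circ f \<Longrightarrow> (\<integral>y. f y \<partial>circ) = 0 \<Longrightarrow>
      (\<integral>\<^sup>+y. ennreal (\<bar>f y\<bar> powr p) \<partial>circ)
        \<le> ennreal \<kappa> * (\<integral>\<^sup>+u. \<integral>\<^sup>+y. ennreal (\<bar>f y - f (y + 2 * u)\<bar> powr p) \<partial>circ \<partial>lint c d)"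
proof -
  \<comment> \<open>A step \<open>2 * w\<close> is compared with two steps of the family (factor
    \<open>2 powr p * 2\<close>), averaged over an interval of length
    \<open>(d - c) / 2\<close>.\<close>
  define \<alpha> where "\<alpha> = 2 powr p * 2 * (1 / ((d - c) / 2))"
  \<comment> \<open>Modulo the period, \<open>x\<close> is reached as \<open>x + 2\<close>, which is
    at most 3, in \<open>n\<close> equal steps; each has to be at most \<open>d - c\<close>.\<close>
  obtain n :: nat where n: "3 / (d - c) < real n" using reals_Archimedean2 by blast
  have n0: "0 < real n"
  proof -
    have "0 < 3 / (d - c)" using cd by simp
    with n show ?thesis by linarith
  qed
  have n3: "3 / real n \<le> d - c" using n n0 cd by (simp add: field_simps)
  define \<kappa> where "\<kappa> = (2 * 2 powr p) ^ n * \<alpha>"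
  have \<alpha>0: "0 \<le> \<alpha>" using cd by (simp add: \<alpha>_def)
  show ?thesis
  proof (rule that[of \<kappa>])
    show "0 \<le> \<kappa>" using \<alpha>0 by (simp add: \<kappa>_def)
  next
    fix f :: "real \<Rightarrow> real"
    assume f_meas [measurable]: "f \<in> borel_measurable borel" and per: "\<And>y. f (y + 2) = f y"
      and int: "integrable circ f" and mean: "(\<integral>y. f y \<partial>circ) = 0"
    define N where "N x = (\<integral>\<^sup>+y. ennreal (\<bar>f y - f (y + x)\<bar> powr p) \<partial>circ)" for x
    have [measurable]: "N \<in> borel_measurable borel"
      unfolding N_def[abs_def] by measurable
    define P where "P = (\<integral>\<^sup>+u. N (2 * u) \<partial>lint c d)"
    have shift: "(\<integral>\<^sup>+y. ennreal (\<bar>f (y + k) - f (y + k + x)\<bar> powr p) \<partial>circ) = N x" for k x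
    proof -
      have per2: "f (y + 2 + x) = f (y + x)" for y
        using per[of "y + x"] by (simp add: algebra_simps)
      have "(\<integral>\<^sup>+y. (\<lambda>y. ennreal (\<bar>f y - f (y + x)\<bar> powr p)) (k + y) \<partial>lint (-1) (-1 + 2)) = N x"
        unfolding N_def by (rule nn_integral_period_shift) (simp_all add: per per2)
      then show ?thesis by (simp add: add.commute[of k])
    qed
    have add_le: "ennreal (\<bar>u + v\<bar> powr p) \<le> ennreal (2 powr p) * (ennreal (\<bar>u\<bar> powr p) + ennreal (\<bar>v\<bar> powr p))" for u v
      using powr_add2_le[of p u v] p
      by (subst ennreal_plus[symmetric], simp, simp, subst ennreal_mult[symmetric]) (auto intro!: ennreal_leI)
    have tri1: "N x \<le> ennreal (2 powr p) * (N (x + k) + N k)" for x k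
    proof -
      have "N x \<le> (\<integral>\<^sup>+y. ennreal (2 powr p) * (ennreal (\<bar>f y - f (y + (x + k))\<bar> powr p) + ennreal (\<bar>f (y + x) - f (y + x + k)\<bar> powr p)) \<partial>circ)"
        unfolding N_def
      proof (intro nn_integral_mono)
        fix y
        have "\<bar>f y - f (y + x)\<bar> = \<bar>(f y - f (y + (x + k))) + (f (y + x + k) - f (y + x))\<bar>"
          by (simp add: add.assoc)
        then show "ennreal (\<bar>f y - f (y + x)\<bar> powr p) \<le> ennreal (2 powr p) * (ennreal (\<bar>f y - f (y + (x + k))\<bar> powr p) + ennreal (\<bar>f (y + x) - f (y + x + k)\<bar> powr p))"
          using add_le[of "f y - f (y + (x + k))" "f (y + x + k) - f (y + x)"] by (simp add: abs_minus_commute)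
      qed
      also have "\<dots> = ennreal (2 powr p) * (N (x + k) + N k)"
        by (simp add: nn_integral_cmult nn_integral_add shift) (simp add: N_def)
      finally show ?thesis .
    qed
    have tri2: "N (x + k) \<le> ennreal (2 powr p) * (N x + N k)" for x k
    proof -
      have "N (x + k) \<le> (\<integral>\<^sup>+y. ennreal (2 powr p) * (ennreal (\<bar>f y - f (y + x)\<bar> powr p) + ennreal (\<bar>f (y + x) - f (y + x + k)\<bar> powr p)) \<partial>circ)"
        unfolding N_def
      proof (intro nn_integral_mono)
        fix y
        show "ennreal (\<bar>f y - f (y + (x + k))\<bar> powr p) \<le> ennreal (2 powr p) * (ennreal (\<bar>f y - f (y + x)\<bar> powr p) + ennreal (\<bar>f (y + x) - f (y + x + k)\<bar> powr p))"
          using add_le[of "f y - f (y + x)" "f (y + x) - f (y + x + k)"] by (simp add: add.assoc)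
      qed
      also have "\<dots> = ennreal (2 powr p) * (N x + N k)"
        by (simp add: nn_integral_cmult nn_integral_add shift) (simp add: N_def)
      finally show ?thesis .
    qed
    \<comment> \<open>\<open>2 * w\<close> is the difference of \<open>2 * (w + u)\<close> and
      \<open>2 * u\<close>; for \<open>u\<close> in the left half of the interval both
      \<open>u\<close> and \<open>w + u\<close> stay in \<open>{c..d}\<close>.\<close>
    have small: "N (2 * w) \<le> ennreal \<alpha> * P" if w: "0 \<le> w" "w \<le> (d - c) / 2" for w
    proof -
      define m where "m = (c + d) / 2"
      have m: "c \<le> m" "w + m \<le> d" "m \<le> d" using w cd by (auto simp: m_def field_simps)
      have "ennreal (m - c) * N (2 * w) = (\<integral>\<^sup>+u. N (2 * w) \<partial>lint c m)"
        using m by (simp add: emeasure_lint mult.commute)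
      also have "\<dots> \<le> (\<integral>\<^sup>+u. ennreal (2 powr p) * (N (2 * (w + u)) + N (2 * u)) \<partial>lint c m)"
        using tri1[of "2 * w"] by (intro nn_integral_mono) (simp add: distrib_left)
      also have "\<dots> = ennreal (2 powr p) * ((\<integral>\<^sup>+u. N (2 * (w + u)) \<partial>lint c m) + (\<integral>\<^sup>+u. N (2 * u) \<partial>lint c m))"
        by (simp add: nn_integral_cmult nn_integral_add)
      also have "(\<integral>\<^sup>+u. N (2 * (w + u)) \<partial>lint c m) = (\<integral>\<^sup>+u. N (2 * u) \<partial>lint (w + c) (w + m))"
        by (rule nn_integral_lint_shift[of "\<lambda>u. N (2 * u)"]) measurable
      also have "ennreal (2 powr p) * ((\<integral>\<^sup>+u. N (2 * u) \<partial>lint (w + c) (w + m)) + (\<integral>\<^sup>+u. N (2 * u) \<partial>lint c m)) \<le> ennreal (2 powr p) * (P + P)"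
        unfolding P_def using w m by (intro mult_left_mono add_mono nn_integral_lint_mono_set) auto
      also have "\<dots> = ennreal (2 powr p * 2) * P"
        by (simp add: ennreal_mult mult_2[symmetric] mult_ac)
      finally have "N (2 * w) \<le> ennreal (1 / (m - c)) * (ennreal (2 powr p * 2) * P)"
        by (rule ennreal_le_mult_inverse) (use cd in \<open>simp add: m_def field_simps\<close>)
      also have "\<dots> = ennreal \<alpha> * P"
        using cd by (simp add: \<alpha>_def m_def mult.assoc[symmetric] ennreal_mult[symmetric])
      finally show ?thesis .
    qed
    \<comment> \<open>One more step costs \<open>2 powr p\<close> from the triangle inequality and 2
      from adding two terms, because the previous power also dominates the single
      \<open>N x\<close>.\<close>
    have mult: "N (real k * x) \<le> ennreal ((2 * 2 powr p) ^ k) * N x" for k x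
    proof (induction k)
      case 0
      have "N 0 = 0" by (simp add: N_def)
      then show ?case by simp
    next
      case (Suc k)
      have "N (real (Suc k) * x) = N (real k * x + x)" by (simp add: algebra_simps)
      also have "\<dots> \<le> ennreal (2 powr p) * (N (real k * x) + N x)" by (rule tri2)
      also have "\<dots> \<le> ennreal (2 powr p) * (ennreal ((2 * 2 powr p) ^ k) * N x + ennreal ((2 * 2 powr p) ^ k) * N x)"
      proof (intro mult_left_mono add_mono Suc.IH)
        have "1 \<le> 2 * (2::real) powr p" using ge_one_powr_ge_zero[of 2 p] p by simp
        then have "1 \<le> (2 * (2::real) powr p) ^ k" by (rule one_le_power)
        then have "1 \<le> ennreal ((2 * 2 powr p) ^ k)" by simp
        from mult_right_mono[OF this, of "N x"] show "N x \<le> ennreal ((2 * 2 powr p) ^ k) * N x" by simp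
      qed simp
      also have "\<dots> = ennreal ((2 * 2 powr p) ^ Suc k) * N x"
        by (simp add: ennreal_mult mult_2[symmetric] mult_ac)
      finally show ?case .
    qed
    have N_le: "N x \<le> ennreal \<kappa> * P" if x: "x \<in> {-1..1}" for x
    proof -
      define w where "w = (x + 2) / real n / 2"
      have "N x = N (x + 2)"
        unfolding N_def by (simp add: add.assoc[symmetric] per)
      also have "x + 2 = real n * (2 * w)" using n0 by (simp add: w_def)
      also have "N (real n * (2 * w)) \<le> ennreal ((2 * 2 powr p) ^ n) * N (2 * w)" by (rule mult)
      also have "\<dots> \<le> ennreal ((2 * 2 powr p) ^ n) * (ennreal \<alpha> * P)"
      proof (intro mult_left_mono small)
        have "(x + 2) / real n \<le> 3 / real n" using x n0 by (intro divide_right_mono) auto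
        with n3 have "(x + 2) / real n \<le> d - c" by linarith
        then show "w \<le> (d - c) / 2"
          unfolding w_def by (rule divide_right_mono) simp
        show "0 \<le> w" using x by (simp add: w_def)
      qed simp
      also have "\<dots> = ennreal \<kappa> * P"
        using \<alpha>0 by (simp add: \<kappa>_def ennreal_mult mult.assoc)
      finally show ?thesis .
    qed
    \<comment> \<open>A translation is a composition of two reflections, which reduces this to the
      reflection rule.\<close>
    have mean_shift: "(\<integral>x. f (y + x) \<partial>circ) = 0" for y
    proof -
      have "(\<integral>x. f (y + x) \<partial>circ) = (\<integral>x. (\<lambda>z. f (- z)) (- y - x) \<partial>circ)"
        by (simp add: add.commute)
      also have "\<dots> = (\<integral>x. f (- x) \<partial>circ)"
        using per[of "- (_ + 2)"] by (intro integral_period_reflect) auto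
      also have "\<dots> = (\<integral>x. f (0 - x) \<partial>circ)" by simp
      also have "\<dots> = (\<integral>x. f x \<partial>circ)"
        using per by (intro integral_period_reflect) auto
      finally show ?thesis by (simp add: mean)
    qed
    have int_shift: "integrable circ (\<lambda>x. f (y + x))" for y
      using int nn_integral_period_shift[of "\<lambda>x. ennreal \<bar>f x\<bar>", where h=y and s="-1"]
      by (simp add: integrable_iff_bounded per)
    \<comment> \<open>As \<open>f\<close> has mean zero, \<open>2 * f y\<close> is the integral of
      \<open>f y - f (y + x)\<close> over the circle; Jensen on a space of mass 2 leaves
      \<open>2 powr (p - 1) / 2 powr p = 1 / 2\<close>.\<close>
    have pt: "ennreal (\<bar>f y\<bar> powr p) \<le> ennreal (1/2) * (\<integral>\<^sup>+x. ennreal (\<bar>f y - f (y + x)\<bar> powr p) \<partial>circ)" for y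
    proof -
      have "(\<integral>x. f y - f (y + x) \<partial>circ) = 2 * f y"
        using int_shift[of y] by (simp add: mean_shift measure_lint_UNIV)
      then have "ennreal (\<bar>2 * f y\<bar> powr p) \<le> ennreal (2 powr (p - 1)) * (\<integral>\<^sup>+x. ennreal (\<bar>f y - f (y + x)\<bar> powr p) \<partial>circ)"
        using lint.powr_integral_le[OF p, of "-1" 1 "\<lambda>x. f y - f (y + x)"] int_shift[of y] by (simp add: measure_lint_UNIV)
      then have "ennreal (2 powr p) * ennreal (\<bar>f y\<bar> powr p) \<le> ennreal (2 powr (p - 1)) * (\<integral>\<^sup>+x. ennreal (\<bar>f y - f (y + x)\<bar> powr p) \<partial>circ)"
        by (simp add: abs_mult powr_mult ennreal_mult)
      then have "ennreal (\<bar>f y\<bar> powr p) \<le> ennreal (1 / 2 powr p) * (ennreal (2 powr (p - 1)) * (\<integral>\<^sup>+x. ennreal (\<bar>f y - f (y + x)\<bar> powr p) \<partial>circ))"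
        by (rule ennreal_le_mult_inverse) simp
      also have "\<dots> = ennreal (1/2) * (\<integral>\<^sup>+x. ennreal (\<bar>f y - f (y + x)\<bar> powr p) \<partial>circ)"
        unfolding mult.assoc[symmetric] by (subst ennreal_mult[symmetric]) (simp_all add: powr_diff)
      finally show ?thesis .
    qed
    have "(\<integral>\<^sup>+y. ennreal (\<bar>f y\<bar> powr p) \<partial>circ) \<le> (\<integral>\<^sup>+y. ennreal (1/2) * (\<integral>\<^sup>+x. ennreal (\<bar>f y - f (y + x)\<bar> powr p) \<partial>circ) \<partial>circ)"
      by (intro nn_integral_mono pt)
    also have "\<dots> = ennreal (1/2) * (\<integral>\<^sup>+y. \<integral>\<^sup>+x. ennreal (\<bar>f y - f (y + x)\<bar> powr p) \<partial>circ \<partial>circ)"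
      by (rule nn_integral_cmult) measurable
    also have "(\<integral>\<^sup>+y. \<integral>\<^sup>+x. ennreal (\<bar>f y - f (y + x)\<bar> powr p) \<partial>circ \<partial>circ) = (\<integral>\<^sup>+x. N x \<partial>circ)"
      unfolding N_def by (rule lint_pair.Fubini') measurable
    also have "(\<integral>\<^sup>+x. N x \<partial>circ) \<le> (\<integral>\<^sup>+x. ennreal \<kappa> * P \<partial>circ)"
      by (rule nn_integral_mono_AE, use AE_lint_mem in eventually_elim) (rule N_le)
    also have "ennreal (1/2) * (\<integral>\<^sup>+x. ennreal \<kappa> * P \<partial>circ) = ennreal \<kappa> * P"
    proof -
      have half: "ennreal (1/2) * ennreal 2 = 1"
        by (subst ennreal_mult[symmetric]) auto
      have "(\<integral>\<^sup>+x. ennreal \<kappa> * P \<partial>circ) = ennreal 2 * (ennreal \<kappa> * P)"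
        by (simp add: emeasure_lint mult_ac)
      then show ?thesis
        by (simp only: mult.assoc[of "ennreal (1/2)" "ennreal 2", symmetric] half mult_1)
    qed
    finally have "(\<integral>\<^sup>+y. ennreal (\<bar>f y\<bar> powr p) \<partial>circ) \<le> ennreal \<kappa> * P"
      by (simp add: mult_left_mono)
    then show "(\<integral>\<^sup>+y. ennreal (\<bar>f y\<bar> powr p) \<partial>circ)
        \<le> ennreal \<kappa> * (\<integral>\<^sup>+u. \<integral>\<^sup>+y. ennreal (\<bar>f y - f (y + 2 * u)\<bar> powr p) \<partial>circ \<partial>lint c d)"
      by (simp add: P_def N_def)
  qed
qed

section \<open>Contraction over one period\<close>

context reflected_transport
begin

text \<open>The counterpart of \<open>D\<close> over one period with the monotonicity product
  replaced by a p-th power: what the damping exchanges, measured in L^p.\<close>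

definition J :: "real \<Rightarrow> ennreal" where
  "J t0 = (\<integral>\<^sup>+s. \<integral>\<^sup>+y. ennreal (b (y - s) * \<bar>F s y - F s (2 * s - y)\<bar> powr p) \<partial>circ \<partial>lint t0 (t0 + 2))"

text \<open>The constant \<open>4 * B * e\<close> collects the bound of \<open>b\<close>, the two
  equal energies of \<open>F\<close> and its mirror, and the length 2 of the time interval.\<close>

lemma J_le:
  assumes t0: "0 \<le> t0" and e: "0 \<le> e" and C: "0 \<le> C"
    and eC: "\<And>x y. \<bar>x - y\<bar> powr p \<le> e * (\<bar>x\<bar> powr p + \<bar>y\<bar> powr p) + C * ((x - y) * (spow p x - spow p y))"
  shows "J t0 \<le> ennreal (4 * B * e) * E t0 + ennreal C * D t0 (t0 + 2)"
proof -
  have pt: "ennreal (b (y - s) * \<bar>F s y - F s (2 * s - y)\<bar> powr p)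
      \<le> ennreal (B * e) * (ennreal (\<bar>F s y\<bar> powr p) + ennreal (\<bar>F s (2 * s - y)\<bar> powr p)) + ennreal C * ennreal (\<psi> s y)" for s y
  proof -
    let ?S = "\<bar>F s y\<bar> powr p + \<bar>F s (2 * s - y)\<bar> powr p"
    have "b (y - s) * \<bar>F s y - F s (2 * s - y)\<bar> powr p \<le> b (y - s) * (e * ?S) + C * \<psi> s y"
      using mult_left_mono[OF eC b_nonneg[of "y - s"], of "F s y" "F s (2 * s - y)"]
      by (simp add: \<psi>_def algebra_simps)
    also have "\<dots> \<le> B * (e * ?S) + C * \<psi> s y"
      using b_le[of "y - s"] e by (intro add_right_mono mult_right_mono mult_nonneg_nonneg) auto
    finally have "ennreal (b (y - s) * \<bar>F s y - F s (2 * s - y)\<bar> powr p) \<le> ennreal (B * e * ?S + C * \<psi> s y)"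
      by (intro ennreal_leI) (simp add: mult.assoc)
    then show ?thesis
      using B_pos e C \<psi>_nonneg[of s y] by (simp add: ennreal_plus ennreal_mult)
  qed
  have "J t0 \<le> (\<integral>\<^sup>+s. ennreal (2 * B * e) * E t0 + ennreal C * (\<integral>\<^sup>+y. ennreal (\<psi> s y) \<partial>circ) \<partial>lint t0 (t0 + 2))"
    unfolding J_def
  proof (rule nn_integral_mono_AE, use AE_lint_mem in eventually_elim)
    case (elim s)
    have "(\<integral>\<^sup>+y. ennreal (b (y - s) * \<bar>F s y - F s (2 * s - y)\<bar> powr p) \<partial>circ)
      \<le> (\<integral>\<^sup>+y. ennreal (B * e) * (ennreal (\<bar>F s y\<bar> powr p) + ennreal (\<bar>F s (2 * s - y)\<bar> powr p)) + ennreal C * ennreal (\<psi> s y) \<partial>circ)"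
      by (intro nn_integral_mono pt)
    also have "\<dots> = ennreal (B * e) * (E s + E s) + ennreal C * (\<integral>\<^sup>+y. ennreal (\<psi> s y) \<partial>circ)"
      by (simp add: nn_integral_add nn_integral_cmult E_reflect E_def[symmetric])
    also have "\<dots> \<le> ennreal (B * e) * (E t0 + E t0) + ennreal C * (\<integral>\<^sup>+y. ennreal (\<psi> s y) \<partial>circ)"
      using elim t0 by (intro add_mono mult_left_mono E_antimono order_refl) auto
    also have "ennreal (B * e) * (E t0 + E t0) = ennreal (2 * B * e) * E t0"
      using B_pos e by (simp add: ennreal_mult mult_2[symmetric] mult_ac)
    finally show ?case .
  qed
  also have "\<dots> = 2 * ennreal (2 * B * e) * E t0 + ennreal C * D t0 (t0 + 2)"
    unfolding D_def by (simp add: nn_integral_add nn_integral_cmult emeasure_lint mult_ac)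
  also have "2 * ennreal (2 * B * e) = ennreal (4 * B * e)"
    using ennreal_mult[of 2 "2 * B * e"] B_pos e by (simp add: mult.assoc)
  finally show ?thesis .
qed

text \<open>Jensen in time over a length at most 2, then
  \<open>b powr p \<le> B powr (p - 1) * b\<close>: one factor \<open>b\<close> is kept because
  \<open>J\<close> carries exactly one.\<close>

lemma displacement_le:
  assumes t0: "0 \<le> t0" and s: "t0 \<le> s" "s \<le> t0 + 2"
  shows "(\<integral>\<^sup>+y. ennreal (\<bar>F s y - F t0 y\<bar> powr p) \<partial>circ) \<le> ennreal ((2 * B) powr (p - 1)) * J t0"
proof -
  have pt: "AE y in circ. ennreal (\<bar>F s y - F t0 y\<bar> powr p)
      \<le> ennreal (2 powr (p - 1)) * (\<integral>\<^sup>+\<sigma>. ennreal (\<bar>h \<sigma> y\<bar> powr p) \<partial>lint t0 (t0 + 2))"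
    using flow[OF t0]
  proof eventually_elim
    case (elim y)
    show ?case
    proof (cases "s = t0")
      case False
      have i: "integrable (lint t0 s) (\<lambda>\<sigma>. h \<sigma> y)" and eq: "F s y = F t0 y - (\<integral>\<sigma>. h \<sigma> y \<partial>lint t0 s)"
        using elim s by blast+
      have m: "measure (lint t0 s) (space (lint t0 s)) = s - t0"
        using s by (simp add: measure_lint_UNIV)
      have "ennreal (\<bar>F s y - F t0 y\<bar> powr p) = ennreal (\<bar>\<integral>\<sigma>. h \<sigma> y \<partial>lint t0 s\<bar> powr p)"
        unfolding eq by simp
      also have "\<dots> \<le> ennreal ((s - t0) powr (p - 1)) * (\<integral>\<^sup>+\<sigma>. ennreal (\<bar>h \<sigma> y\<bar> powr p) \<partial>lint t0 s)"
        using lint.powr_integral_le[OF p i] s False by (simp only: m)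
      also have "\<dots> \<le> ennreal (2 powr (p - 1)) * (\<integral>\<^sup>+\<sigma>. ennreal (\<bar>h \<sigma> y\<bar> powr p) \<partial>lint t0 (t0 + 2))"
        using s p by (intro mult_mono nn_integral_lint_mono_set ennreal_leI powr_mono2) auto
      finally show ?thesis .
    qed simp
  qed
  have h_le: "ennreal (\<bar>h \<sigma> y\<bar> powr p) \<le> ennreal (B powr (p - 1)) * ennreal (b (y - \<sigma>) * \<bar>F \<sigma> y - F \<sigma> (2 * \<sigma> - y)\<bar> powr p)" for \<sigma> y
  proof -
    let ?b = "b (y - \<sigma>)" and ?d = "\<bar>F \<sigma> y - F \<sigma> (2 * \<sigma> - y)\<bar> powr p"
    have "\<bar>h \<sigma> y\<bar> powr p = (?b * ?b powr (p - 1)) * ?d"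
      using b_nonneg[of "y - \<sigma>"] by (simp add: h_def abs_mult powr_mult powr_mult_base)
    also have "\<dots> \<le> (?b * B powr (p - 1)) * ?d"
      using b_nonneg[of "y - \<sigma>"] b_le[of "y - \<sigma>"] p by (intro mult_right_mono mult_left_mono powr_mono2) auto
    finally have "\<bar>h \<sigma> y\<bar> powr p \<le> B powr (p - 1) * (?b * ?d)" by (simp add: mult_ac)
    then show ?thesis
      using b_nonneg[of "y - \<sigma>"] by (subst ennreal_mult[symmetric]) (auto intro!: ennreal_leI)
  qed
  have "(\<integral>\<^sup>+y. ennreal (\<bar>F s y - F t0 y\<bar> powr p) \<partial>circ)
      \<le> (\<integral>\<^sup>+y. ennreal (2 powr (p - 1)) * (\<integral>\<^sup>+\<sigma>. ennreal (\<bar>h \<sigma> y\<bar> powr p) \<partial>lint t0 (t0 + 2)) \<partial>circ)"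
    by (rule nn_integral_mono_AE[OF pt])
  also have "\<dots> = ennreal (2 powr (p - 1)) * (\<integral>\<^sup>+y. \<integral>\<^sup>+\<sigma>. ennreal (\<bar>h \<sigma> y\<bar> powr p) \<partial>lint t0 (t0 + 2) \<partial>circ)"
    by (rule nn_integral_cmult) measurable
  also have "(\<integral>\<^sup>+y. \<integral>\<^sup>+\<sigma>. ennreal (\<bar>h \<sigma> y\<bar> powr p) \<partial>lint t0 (t0 + 2) \<partial>circ) = (\<integral>\<^sup>+\<sigma>. \<integral>\<^sup>+y. ennreal (\<bar>h \<sigma> y\<bar> powr p) \<partial>circ \<partial>lint t0 (t0 + 2))"
    by (rule lint_pair.Fubini') measurable
  also have "\<dots> \<le> (\<integral>\<^sup>+\<sigma>. \<integral>\<^sup>+y. ennreal (B powr (p - 1)) * ennreal (b (y - \<sigma>) * \<bar>F \<sigma> y - F \<sigma> (2 * \<sigma> - y)\<bar> powr p) \<partial>circ \<partial>lint t0 (t0 + 2))"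
    by (intro nn_integral_mono h_le)
  also have "\<dots> = ennreal (B powr (p - 1)) * J t0"
    unfolding J_def by (simp add: nn_integral_cmult)
  also have "ennreal (2 powr (p - 1)) * (ennreal (B powr (p - 1)) * J t0) = ennreal ((2 * B) powr (p - 1)) * J t0"
    using B_pos by (simp add: powr_mult ennreal_mult mult.assoc)
  finally show ?thesis by (simp add: mult_left_mono)
qed

text \<open>The increment at time \<open>t0\<close> is routed through time \<open>s\<close>: two
  displacements, where \<open>b\<close> is replaced by \<open>B\<close>, around the term of
  \<open>J\<close>. The 4 is two displacements times the time length 2.\<close>

lemma frozen_le:
  assumes t0: "0 \<le> t0"
  shows "(\<integral>\<^sup>+s. \<integral>\<^sup>+y. ennreal (b (y - s) * \<bar>F t0 y - F t0 (2 * s - y)\<bar> powr p) \<partial>circ \<partial>lint t0 (t0 + 2))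
    \<le> ennreal (3 powr p * (1 + 4 * B * (2 * B) powr (p - 1))) * J t0"
proof -
  let ?G = "\<lambda>s y. \<bar>F s y - F t0 y\<bar> powr p"
  let ?j = "\<lambda>s y. b (y - s) * \<bar>F s y - F s (2 * s - y)\<bar> powr p"
  have pt: "ennreal (b (y - s) * \<bar>F t0 y - F t0 (2 * s - y)\<bar> powr p)
     \<le> ennreal (3 powr p) * (ennreal B * ennreal (?G s y) + ennreal (?j s y) + ennreal B * ennreal (?G s (2 * s - y)))" for s y
  proof -
    have "\<bar>F t0 y - F t0 (2 * s - y)\<bar> powr p
      = \<bar>(F t0 y - F s y) + (F s y - F s (2 * s - y)) + (F s (2 * s - y) - F t0 (2 * s - y))\<bar> powr p"
      by simp
    also have "\<dots> \<le> 3 powr p * (\<bar>F t0 y - F s y\<bar> powr p + \<bar>F s y - F s (2 * s - y)\<bar> powr p + ?G s (2 * s - y))"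
      by (rule powr_add3_le) (use p in simp)
    also have "\<bar>F t0 y - F s y\<bar> = \<bar>F s y - F t0 y\<bar>"
      by (rule abs_minus_commute)
    finally have "b (y - s) * \<bar>F t0 y - F t0 (2 * s - y)\<bar> powr p
      \<le> b (y - s) * (3 powr p * (?G s y + \<bar>F s y - F s (2 * s - y)\<bar> powr p + ?G s (2 * s - y)))"
      by (rule mult_left_mono[OF _ b_nonneg])
    also have "\<dots> = 3 powr p * (b (y - s) * ?G s y + ?j s y + b (y - s) * ?G s (2 * s - y))"
      by (simp add: algebra_simps)
    also have "\<dots> \<le> 3 powr p * (B * ?G s y + ?j s y + B * ?G s (2 * s - y))"
      using b_le[of "y - s"] by (intro mult_left_mono add_mono mult_right_mono) auto
    finally have "ennreal (b (y - s) * \<bar>F t0 y - F t0 (2 * s - y)\<bar> powr p)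
      \<le> ennreal (3 powr p * (B * ?G s y + ?j s y + B * ?G s (2 * s - y)))"
      by (rule ennreal_leI)
    then show ?thesis
      using B_pos b_nonneg[of "y - s"] by (simp add: ennreal_plus ennreal_mult)
  qed
  have G_reflect: "(\<integral>\<^sup>+y. ennreal (?G s (2 * s - y)) \<partial>circ) = (\<integral>\<^sup>+y. ennreal (?G s y) \<partial>circ)" for s
    using nn_integral_period_reflect[of "\<lambda>y. ennreal (?G s y)", where h="2 * s" and s="-1"]
    by (simp add: F_per)
  let ?\<kappa> = "(2 * B) powr (p - 1)"
  have "(\<integral>\<^sup>+s. \<integral>\<^sup>+y. ennreal (b (y - s) * \<bar>F t0 y - F t0 (2 * s - y)\<bar> powr p) \<partial>circ \<partial>lint t0 (t0 + 2))
    \<le> (\<integral>\<^sup>+s. ennreal (3 powr p) * (2 * (ennreal B * (ennreal ?\<kappa> * J t0)) + (\<integral>\<^sup>+y. ennreal (?j s y) \<partial>circ)) \<partial>lint t0 (t0 + 2))"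
  proof (rule nn_integral_mono_AE, use AE_lint_mem in eventually_elim)
    case (elim s)
    have "(\<integral>\<^sup>+y. ennreal (b (y - s) * \<bar>F t0 y - F t0 (2 * s - y)\<bar> powr p) \<partial>circ)
      \<le> (\<integral>\<^sup>+y. ennreal (3 powr p) * (ennreal B * ennreal (?G s y) + ennreal (?j s y) + ennreal B * ennreal (?G s (2 * s - y))) \<partial>circ)"
      by (intro nn_integral_mono pt)
    also have "\<dots> = ennreal (3 powr p) * (ennreal B * (\<integral>\<^sup>+y. ennreal (?G s y) \<partial>circ) + (\<integral>\<^sup>+y. ennreal (?j s y) \<partial>circ)
        + ennreal B * (\<integral>\<^sup>+y. ennreal (?G s y) \<partial>circ))"
      by (simp add: nn_integral_add nn_integral_cmult G_reflect)
    also have "\<dots> = ennreal (3 powr p) * (2 * (ennreal B * (\<integral>\<^sup>+y. ennreal (?G s y) \<partial>circ)) + (\<integral>\<^sup>+y. ennreal (?j s y) \<partial>circ))"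
      by (simp only: mult_2 add_ac)
    also have "\<dots> \<le> ennreal (3 powr p) * (2 * (ennreal B * (ennreal ?\<kappa> * J t0)) + (\<integral>\<^sup>+y. ennreal (?j s y) \<partial>circ))"
      using elim by (intro mult_left_mono add_mono displacement_le t0) auto
    finally show ?case .
  qed
  also have "\<dots> = ennreal (3 powr p) * (2 * (ennreal B * (ennreal ?\<kappa> * J t0)) * 2 + J t0)"
    unfolding J_def by (simp add: nn_integral_cmult nn_integral_add emeasure_lint)
  also have "\<dots> = ennreal (3 powr p * (1 + 4 * B * ?\<kappa>)) * J t0"
  proof -
    have "2 * (ennreal B * (ennreal ?\<kappa> * J t0)) * 2 = ennreal (4 * B * ?\<kappa>) * J t0"
      using B_pos by (simp add: ennreal_mult mult_ac)
    then show ?thesis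
      using B_pos by (simp add: ennreal_mult ennreal_plus distrib_right mult.assoc add.commute)
  qed
  finally show ?thesis .
qed

text \<open>With \<open>u = s - y\<close> the mirror pair becomes \<open>(s - u, s + u)\<close> and
  the weight becomes \<open>b u\<close>. After exchanging the integrals, \<open>s\<close> runs over
  a full period and may be shifted by \<open>u\<close>; then \<open>u\<close> is restricted to the
  damped interval.\<close>

lemma increments_le_frozen:
  "ennreal b0 * (\<integral>\<^sup>+u. \<integral>\<^sup>+y. ennreal (\<bar>F t0 y - F t0 (y + 2 * u)\<bar> powr p) \<partial>circ \<partial>lint c d)
    \<le> (\<integral>\<^sup>+s. \<integral>\<^sup>+y. ennreal (b (y - s) * \<bar>F t0 y - F t0 (2 * s - y)\<bar> powr p) \<partial>circ \<partial>lint t0 (t0 + 2))"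
proof -
  let ?N = "\<lambda>u. \<integral>\<^sup>+y. ennreal (\<bar>F t0 y - F t0 (y + 2 * u)\<bar> powr p) \<partial>circ"
  have Fp: "F t0 (y + 2 + x) = F t0 (y + x)" "F t0 (y + 2 - x) = F t0 (y - x)" for x y
    using F_per[of t0 "y + x"] F_per[of t0 "y - x"] by (simp_all add: algebra_simps)
  have 1: "(\<integral>\<^sup>+y. ennreal (b (y - s) * \<bar>F t0 y - F t0 (2 * s - y)\<bar> powr p) \<partial>circ)
    = (\<integral>\<^sup>+u. ennreal (b u * \<bar>F t0 (s - u) - F t0 (s + u)\<bar> powr p) \<partial>circ)" for s
  proof -
    have "(\<integral>\<^sup>+u. (\<lambda>y. ennreal (b (y - s) * \<bar>F t0 y - F t0 (2 * s - y)\<bar> powr p)) (s - u) \<partial>lint (-1) (-1 + 2))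
      = (\<integral>\<^sup>+y. ennreal (b (y - s) * \<bar>F t0 y - F t0 (2 * s - y)\<bar> powr p) \<partial>circ)"
      by (rule nn_integral_period_reflect) (simp_all add: F_per F_per_diff b_per_diff)
    then show ?thesis by (simp add: b_even algebra_simps)
  qed
  have 2: "(\<integral>\<^sup>+s. ennreal (b u * \<bar>F t0 (s - u) - F t0 (s + u)\<bar> powr p) \<partial>lint t0 (t0 + 2)) = ennreal (b u) * ?N u" for u
  proof -
    have "(\<integral>\<^sup>+s. ennreal (\<bar>F t0 (s - u) - F t0 (s + u)\<bar> powr p) \<partial>lint t0 (t0 + 2))
      = (\<integral>\<^sup>+s. ennreal (\<bar>F t0 (s - u) - F t0 (s + u)\<bar> powr p) \<partial>circ)"
      by (rule nn_integral_period) (simp_all add: Fp)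
    also have "\<dots> = ?N u"
    proof -
      have "(\<integral>\<^sup>+y. (\<lambda>s. ennreal (\<bar>F t0 (s - u) - F t0 (s + u)\<bar> powr p)) (u + y) \<partial>lint (-1) (-1 + 2))
        = (\<integral>\<^sup>+s. ennreal (\<bar>F t0 (s - u) - F t0 (s + u)\<bar> powr p) \<partial>circ)"
        by (rule nn_integral_period_shift) (simp_all add: Fp)
      then show ?thesis by (simp add: algebra_simps)
    qed
    finally show ?thesis
      using b_nonneg by (simp add: ennreal_mult nn_integral_cmult)
  qed
  have "ennreal b0 * (\<integral>\<^sup>+u. ?N u \<partial>lint c d) = (\<integral>\<^sup>+u. ennreal b0 * ?N u \<partial>lint c d)"
    by (rule nn_integral_cmult[symmetric]) measurable
  also have "\<dots> \<le> (\<integral>\<^sup>+u. ennreal (b u) * ?N u \<partial>lint c d)"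
    by (rule nn_integral_mono_AE, use AE_lint_mem in eventually_elim)
       (intro mult_right_mono ennreal_leI b_ge, simp_all)
  also have "\<dots> \<le> (\<integral>\<^sup>+u. ennreal (b u) * ?N u \<partial>circ)"
    using cd by (intro nn_integral_lint_mono_set) auto
  also have "\<dots> = (\<integral>\<^sup>+u. \<integral>\<^sup>+s. ennreal (b u * \<bar>F t0 (s - u) - F t0 (s + u)\<bar> powr p) \<partial>lint t0 (t0 + 2) \<partial>circ)"
    by (simp only: 2)
  also have "\<dots> = (\<integral>\<^sup>+s. \<integral>\<^sup>+u. ennreal (b u * \<bar>F t0 (s - u) - F t0 (s + u)\<bar> powr p) \<partial>circ \<partial>lint t0 (t0 + 2))"
    by (rule lint_pair.Fubini') measurable
  also have "\<dots> = (\<integral>\<^sup>+s. \<integral>\<^sup>+y. ennreal (b (y - s) * \<bar>F t0 y - F t0 (2 * s - y)\<bar> powr p) \<partial>circ \<partial>lint t0 (t0 + 2))"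
    by (simp only: 1)
  finally show ?thesis .
qed

lemma integrable_F:
  assumes "0 \<le> t"
  shows "integrable circ (F t)"
proof (rule Bochner_Integration.integrable_bound[where f="\<lambda>y. 1 + \<bar>F t y\<bar> powr p"])
  show "integrable circ (\<lambda>y. 1 + \<bar>F t y\<bar> powr p)"
    using integrable_powr_F[OF assms] by simp
  show "F t \<in> borel_measurable circ" by measurable
  show "AE y in circ. norm (F t y) \<le> norm (1 + \<bar>F t y\<bar> powr p)"
    using powr_ge_self[of p] p by (intro AE_I2) simp
qed

text \<open>The estimates combine to: \<open>E t0\<close> is at most \<open>\<kappa>'\<close> times
  \<open>J t0\<close>, which is at most half of \<open>E t0\<close> plus
  \<open>\<kappa>' * C\<close> times the dissipation. Absorbing the half bounds \<open>E t0\<close>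
  by \<open>2 * \<kappa>' * C\<close> times the dissipation, and the energy inequality turns this
  into a fixed gain.\<close>

lemma energy_contraction:
  assumes t0: "0 \<le> t0" and e: "0 \<le> e" and C: "0 < C" and \<kappa>: "0 < \<kappa>"
    and eC: "\<And>x y. \<bar>x - y\<bar> powr p \<le> e * (\<bar>x\<bar> powr p + \<bar>y\<bar> powr p) + C * ((x - y) * (spow p x - spow p y))"
    and incr: "(\<integral>\<^sup>+y. ennreal (\<bar>F t0 y\<bar> powr p) \<partial>circ)
        \<le> ennreal \<kappa> * (\<integral>\<^sup>+u. \<integral>\<^sup>+y. ennreal (\<bar>F t0 y - F t0 (y + 2 * u)\<bar> powr p) \<partial>circ \<partial>lint c d)"
    and \<kappa>': "\<kappa>' = \<kappa> * (1 / b0 * (3 powr p * (1 + 4 * B * (2 * B) powr (p - 1))))"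
    and small: "\<kappa>' * (4 * B * e) \<le> 1 / 2"
  shows "ennreal (1 + p / (4 * \<kappa>' * C)) * E (t0 + 2) \<le> E t0"
proof -
  let ?P = "\<integral>\<^sup>+u. \<integral>\<^sup>+y. ennreal (\<bar>F t0 y - F t0 (y + 2 * u)\<bar> powr p) \<partial>circ \<partial>lint c d"
  let ?k = "3 powr p * (1 + 4 * B * (2 * B) powr (p - 1))"
  have k0: "0 < ?k" using B_pos by (simp add: add_pos_nonneg)
  have \<kappa>0: "0 < \<kappa>'" unfolding \<kappa>' using k0 \<kappa> b0 by simp
  have "ennreal b0 * ?P \<le> ennreal ?k * J t0"
    by (rule order_trans[OF increments_le_frozen frozen_le[OF t0]])
  then have "?P \<le> ennreal (1 / b0) * (ennreal ?k * J t0)"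
    by (rule ennreal_le_mult_inverse[OF _ b0])
  then have "E t0 \<le> ennreal \<kappa> * (ennreal (1 / b0) * (ennreal ?k * J t0))"
    unfolding E_def by (intro order_trans[OF incr] mult_left_mono) auto
  also have "\<dots> = ennreal \<kappa>' * J t0"
    using \<kappa> b0 k0 by (simp add: \<kappa>' ennreal_mult[symmetric] mult.assoc[symmetric])
  also have "\<dots> \<le> ennreal \<kappa>' * (ennreal (4 * B * e) * E t0 + ennreal C * D t0 (t0 + 2))"
    using C by (intro mult_left_mono J_le t0 e eC) auto
  also have "\<dots> = ennreal (\<kappa>' * (4 * B * e)) * E t0 + ennreal (\<kappa>' * C) * D t0 (t0 + 2)"
    using \<kappa>0 B_pos e C by (simp add: ennreal_mult distrib_left mult.assoc)
  also have "\<dots> \<le> ennreal (1 / 2) * E t0 + ennreal (\<kappa>' * C) * D t0 (t0 + 2)"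
    using small by (intro add_right_mono mult_right_mono ennreal_leI) auto
  finally have 1: "E t0 \<le> ennreal (1 / 2) * E t0 + ennreal (\<kappa>' * C) * D t0 (t0 + 2)" .
  have en: "E (t0 + 2) + ennreal (p / 2) * D t0 (t0 + 2) \<le> E t0"
    using energy_inequality[OF t0, of "t0 + 2"] by simp
  \<comment> \<open>Absorption is a subtraction, so finiteness is settled before the inequalities
    are moved to the reals.\<close>
  have finE: "E t0 < \<infinity>" "E (t0 + 2) < \<infinity>" using E_finite t0 by auto
  have "ennreal (p / 2) * D t0 (t0 + 2) < \<infinity>"
    using en finE by (meson le_less_trans add_increasing order_refl zero_le)
  then have finD: "D t0 (t0 + 2) < \<infinity>"
    using p by (auto simp: ennreal_mult_less_top)
  define x x' z where "x = enn2real (E t0)" and "x' = enn2real (E (t0 + 2))" and "z = enn2real (D t0 (t0 + 2))"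
  have eqs: "E t0 = ennreal x" "E (t0 + 2) = ennreal x'" "D t0 (t0 + 2) = ennreal z"
    and nn: "0 \<le> x" "0 \<le> x'" "0 \<le> z"
    using finE finD by (simp_all add: x_def x'_def z_def)
  have "x \<le> 1 / 2 * x + \<kappa>' * C * z"
  proof -
    have "ennreal (1 / 2 * x + \<kappa>' * C * z) = ennreal (1 / 2 * x) + ennreal (\<kappa>' * C * z)"
      using nn \<kappa>0 C by (intro ennreal_plus) auto
    moreover have "ennreal (1 / 2 * x) = ennreal (1 / 2) * ennreal x"
      using nn by (intro ennreal_mult) auto
    moreover have "ennreal (\<kappa>' * C * z) = ennreal (\<kappa>' * C) * ennreal z"
      using nn \<kappa>0 C by (intro ennreal_mult) auto
    ultimately have "ennreal x \<le> ennreal (1 / 2 * x + \<kappa>' * C * z)"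
      using 1 unfolding eqs by (simp only:)
    then show ?thesis using nn \<kappa>0 C by (subst (asm) ennreal_le_iff) auto
  qed
  then have z: "x \<le> 2 * \<kappa>' * C * z" by simp
  have "x' + p / 2 * z \<le> x"
  proof -
    have "ennreal (x' + p / 2 * z) = ennreal x' + ennreal (p / 2 * z)"
      using nn p by (intro ennreal_plus) auto
    moreover have "ennreal (p / 2 * z) = ennreal (p / 2) * ennreal z"
      using nn p by (intro ennreal_mult) auto
    ultimately have "ennreal (x' + p / 2 * z) \<le> ennreal x"
      using en unfolding eqs by (simp only:)
    then show ?thesis using nn by (subst (asm) ennreal_le_iff) auto
  qed
  \<comment> \<open>\<open>p / 2 * z\<close> is at least this fraction of \<open>x\<close>, hence of
    the smaller \<open>x'\<close>.\<close>
  moreover have "p / (4 * \<kappa>' * C) * x' \<le> p / 2 * z"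
  proof -
    have "0 \<le> p / 2 * z" using nn p by simp
    with \<open>x' + p / 2 * z \<le> x\<close> have "x' \<le> x" by linarith
    then have "x' \<le> 2 * \<kappa>' * C * z" using z by simp
    then have "p / (4 * \<kappa>' * C) * x' \<le> p / (4 * \<kappa>' * C) * (2 * \<kappa>' * C * z)"
      using p \<kappa>0 C by (intro mult_left_mono) auto
    also have "\<dots> = p / 2 * z" using \<kappa>0 C by (simp add: field_simps)
    finally show ?thesis .
  qed
  ultimately have "(1 + p / (4 * \<kappa>' * C)) * x' \<le> x" by (simp add: algebra_simps)
  then have "ennreal ((1 + p / (4 * \<kappa>' * C)) * x') \<le> ennreal x" by (rule ennreal_leI)
  then show ?thesis using nn p \<kappa>0 C unfolding eqs by (subst ennreal_mult[symmetric]) auto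
qed

end

text \<open>All constants are fixed before \<open>b\<close>, \<open>F\<close> and \<open>t0\<close>
  appear, so \<open>q\<close> depends on the numerical parameters only.\<close>

lemma reflected_transport_decay:
  fixes p B b0 c d :: real
  assumes p: "1 < p" and cd: "c < d" and b0: "0 < b0" and B: "0 < B"
  obtains q where "1 < q"
    "\<And>b F t0. reflected_transport p B b0 c d b F \<Longrightarrow> 0 \<le> t0 \<Longrightarrow>
      ennreal q * (\<integral>\<^sup>+y. ennreal (\<bar>F (t0 + 2) y\<bar> powr p) \<partial>circ) \<le> (\<integral>\<^sup>+y. ennreal (\<bar>F t0 y\<bar> powr p) \<partial>circ)"
proof -
  obtain \<kappa>0 where \<kappa>0: "0 \<le> \<kappa>0"
    "\<And>f. f \<in> borel_measurable borel \<Longrightarrow> (\<And>y. f (y + 2) = f y) \<Longrightarrow> integrable circ f \<Longrightarrow> (\<integral>y. f y \<partial>circ) = 0 \<Longrightarrow>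
      (\<integral>\<^sup>+y. ennreal (\<bar>f y\<bar> powr p) \<partial>circ)
        \<le> ennreal \<kappa>0 * (\<integral>\<^sup>+u. \<integral>\<^sup>+y. ennreal (\<bar>f y - f (y + 2 * u)\<bar> powr p) \<partial>circ \<partial>lint c d)"
    by (rule periodic_increment_bound[OF p cd]) blast
  \<comment> \<open>The added 1 makes the constant strictly positive for later divisions;
    \<open>C\<close> is treated likewise.\<close>
  define \<kappa> where "\<kappa> = \<kappa>0 + 1"
  have \<kappa>: "0 < \<kappa>" using \<kappa>0 by (simp add: \<kappa>_def)
  define \<kappa>' where "\<kappa>' = \<kappa> * (1 / b0 * (3 powr p * (1 + 4 * B * (2 * B) powr (p - 1))))"
  have \<kappa>': "0 < \<kappa>'" using \<kappa> b0 B by (simp add: \<kappa>'_def add_pos_nonneg)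
  \<comment> \<open>Chosen so that \<open>\<kappa>' * (4 * B * e)\<close> is exactly
    \<open>1 / 2\<close>.\<close>
  define e where "e = 1 / (8 * B * \<kappa>')"
  have e: "0 < e" using B \<kappa>' by (simp add: e_def)
  obtain C0 where C0: "0 \<le> C0"
    "\<And>x y. \<bar>x - y\<bar> powr p \<le> e * (\<bar>x\<bar> powr p + \<bar>y\<bar> powr p) + C0 * ((x - y) * (spow p x - spow p y))"
    by (rule diff_powr_le_spow[OF p e]) blast
  define C where "C = C0 + 1"
  have C: "0 < C" using C0 by (simp add: C_def)
  have eC: "\<bar>x - y\<bar> powr p \<le> e * (\<bar>x\<bar> powr p + \<bar>y\<bar> powr p) + C * ((x - y) * (spow p x - spow p y))" for x y
    using C0(2)[of x y] spow_diff_mult_nonneg[OF p, of x y] unfolding C_def distrib_right[of C0] by linarith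
  show ?thesis
  proof (rule that)
    show "1 < 1 + p / (4 * \<kappa>' * C)" using p \<kappa>' C by simp
  next
    fix b F t0 assume "reflected_transport p B b0 c d b F" and t0: "0 \<le> (t0::real)"
    then interpret reflected_transport p B b0 c d b F by simp
    have "(\<integral>\<^sup>+y. ennreal (\<bar>F t0 y\<bar> powr p) \<partial>circ)
        \<le> ennreal \<kappa>0 * (\<integral>\<^sup>+u. \<integral>\<^sup>+y. ennreal (\<bar>F t0 y - F t0 (y + 2 * u)\<bar> powr p) \<partial>circ \<partial>lint c d)"
      using t0 by (intro \<kappa>0(2) integrable_F mean0 F_per) measurable
    also have "\<dots> \<le> ennreal \<kappa> * (\<integral>\<^sup>+u. \<integral>\<^sup>+y. ennreal (\<bar>F t0 y - F t0 (y + 2 * u)\<bar> powr p) \<partial>circ \<partial>lint c d)"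
      by (intro mult_right_mono ennreal_leI) (auto simp: \<kappa>_def)
    finally have incr: "(\<integral>\<^sup>+y. ennreal (\<bar>F t0 y\<bar> powr p) \<partial>circ)
        \<le> ennreal \<kappa> * (\<integral>\<^sup>+u. \<integral>\<^sup>+y. ennreal (\<bar>F t0 y - F t0 (y + 2 * u)\<bar> powr p) \<partial>circ \<partial>lint c d)" .
    have small: "\<kappa>' * (4 * B * e) \<le> 1 / 2"
      using B \<kappa>' by (simp add: e_def)
    have "ennreal (1 + p / (4 * \<kappa>' * C)) * E (t0 + 2) \<le> E t0"
      by (rule energy_contraction[OF t0 less_imp_le[OF e] C \<kappa> eC incr \<kappa>'_def small])
    then show "ennreal (1 + p / (4 * \<kappa>' * C)) * (\<integral>\<^sup>+y. ennreal (\<bar>F (t0 + 2) y\<bar> powr p) \<partial>circ)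
        \<le> (\<integral>\<^sup>+y. ennreal (\<bar>F t0 y\<bar> powr p) \<partial>circ)"
      by (simp add: E_def)
  qed
qed

text \<open>Whole periods give powers of \<open>1 / q\<close>, a rate of \<open>ln q / 2\<close> per
  unit of time; the prefactor \<open>q\<close> pays for the incomplete last period.\<close>

lemma reflected_transport_exp_decay:
  fixes p B b0 c d :: real
  assumes "1 < p" and "c < d" and "0 < b0" and "0 < B"
  obtains K \<gamma> where "0 < K" "0 < \<gamma>"
    "\<And>b F t. reflected_transport p B b0 c d b F \<Longrightarrow> 0 \<le> t \<Longrightarrow>
      (\<integral>\<^sup>+y. ennreal (\<bar>F t y\<bar> powr p) \<partial>circ) \<le> ennreal (K * exp (- \<gamma> * t)) * (\<integral>\<^sup>+y. ennreal (\<bar>F 0 y\<bar> powr p) \<partial>circ)"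
proof -
  obtain q where q: "1 < q"
    "\<And>b F t0. reflected_transport p B b0 c d b F \<Longrightarrow> 0 \<le> t0 \<Longrightarrow>
      ennreal q * (\<integral>\<^sup>+y. ennreal (\<bar>F (t0 + 2) y\<bar> powr p) \<partial>circ) \<le> (\<integral>\<^sup>+y. ennreal (\<bar>F t0 y\<bar> powr p) \<partial>circ)"
    by (rule reflected_transport_decay[OF assms]) blast
  show ?thesis
  proof (rule that[of q "ln q / 2"])
    fix b F and t :: real
    assume rt: "reflected_transport p B b0 c d b F" and t: "0 \<le> t"
    then interpret reflected_transport p B b0 c d b F by simp
    have step: "E (t0 + 2) \<le> ennreal (1 / q) * E t0" if "0 \<le> t0" for t0
      using ennreal_le_mult_inverse[OF q(2)[OF rt that]] q(1) by (simp add: E_def)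
    have iter: "E (2 * real n) \<le> ennreal ((1 / q) ^ n) * E 0" for n
    proof (induction n)
      case (Suc n)
      have "E (2 * real (Suc n)) = E (2 * real n + 2)" by (simp add: algebra_simps)
      also have "\<dots> \<le> ennreal (1 / q) * E (2 * real n)" by (rule step) simp
      also have "\<dots> \<le> ennreal (1 / q) * (ennreal ((1 / q) ^ n) * E 0)"
        by (intro mult_left_mono Suc.IH) simp
      also have "\<dots> = ennreal ((1 / q) ^ Suc n) * E 0"
        using q(1) unfolding mult.assoc[symmetric] by (subst ennreal_mult[symmetric]) auto
      finally show ?case .
    qed simp
    define n where "n = nat \<lfloor>t / 2\<rfloor>"
    have n: "2 * real n \<le> t" "t \<le> 2 * real n + 2"
    proof -
      have "real n = of_int \<lfloor>t / 2\<rfloor>" using t by (simp add: n_def of_nat_nat)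
      moreover have "of_int \<lfloor>t / 2\<rfloor> \<le> t / 2" "t / 2 < of_int \<lfloor>t / 2\<rfloor> + 1"
        using floor_correct[of "t / 2"] by simp_all
      ultimately show "2 * real n \<le> t" "t \<le> 2 * real n + 2" by linarith+
    qed
    have "E t \<le> E (2 * real n)" using n by (intro E_antimono) auto
    also have "\<dots> \<le> ennreal ((1 / q) ^ n) * E 0" by (rule iter)
    also have "\<dots> \<le> ennreal (q * exp (- (ln q / 2) * t)) * E 0"
    proof (intro mult_right_mono ennreal_leI)
      have "(1 / q) ^ n = exp (- ln q * real n)"
        using q(1) exp_of_nat_mult[of n "ln q"] by (simp add: exp_minus inverse_eq_divide mult.commute power_one_over)
      also have "\<dots> \<le> exp (ln q + - (ln q / 2) * t)"
      proof -
        have "ln q * (t / 2) \<le> ln q * (real n + 1)"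
          using n q(1) by (intro mult_left_mono) auto
        then show ?thesis by (simp add: algebra_simps)
      qed
      also have "\<dots> = q * exp (- (ln q / 2) * t)"
        using q(1) by (subst exp_add) simp
      finally show "(1 / q) ^ n \<le> q * exp (- (ln q / 2) * t)" .
    qed simp
    finally show "(\<integral>\<^sup>+y. ennreal (\<bar>F t y\<bar> powr p) \<partial>circ) \<le> ennreal (q * exp (- (ln q / 2) * t)) * (\<integral>\<^sup>+y. ennreal (\<bar>F 0 y\<bar> powr p) \<partial>circ)"
      by (simp add: E_def)
  qed (use q(1) in auto)
qed

section \<open>Primitives and periodic extensions\<close>

lemma nn_integral_periods:
  assumes [measurable]: "f \<in> borel_measurable borel" and per: "\<And>x. f (x + 2) = f x"
  shows "(\<integral>\<^sup>+y. f y \<partial>lint s (s + 2 * real n)) = of_nat n * (\<integral>\<^sup>+y. f y \<partial>circ)"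
proof (induction n)
  case 0
  have "(\<integral>\<^sup>+y. f y \<partial>lint s s) = (\<integral>\<^sup>+y. 0 \<partial>lint s s)"
    by (rule nn_integral_cong_AE, unfold AE_lint, use AE_lborel_singleton[of s] in eventually_elim) simp
  then show ?case by simp
next
  case (Suc n)
  have "(\<integral>\<^sup>+y. f y \<partial>lint s (s + 2 * real (Suc n)))
      = (\<integral>\<^sup>+y. f y \<partial>lint s (s + 2 * real n)) + (\<integral>\<^sup>+y. f y \<partial>lint (s + 2 * real n) (s + 2 * real n + 2))"
    by (subst nn_integral_lint_split[where b="s + 2 * real n"]) (auto simp: algebra_simps)
  also have "(\<integral>\<^sup>+y. f y \<partial>lint (s + 2 * real n) (s + 2 * real n + 2)) = (\<integral>\<^sup>+y. f y \<partial>circ)"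
    by (rule nn_integral_period[OF assms])
  finally show ?case by (simp add: Suc.IH distrib_right add.commute)
qed

lemma nn_integral_periodic_le:
  assumes [measurable]: "f \<in> borel_measurable borel" and per: "\<And>x. f (x + 2) = f x"
    and "b - a \<le> 2 * real n"
  shows "(\<integral>\<^sup>+y. f y \<partial>lint a b) \<le> of_nat n * (\<integral>\<^sup>+y. f y \<partial>circ)"
  unfolding nn_integral_periods[OF assms(1,2), symmetric, where s=a]
  using assms(3) by (intro nn_integral_lint_mono_set) auto

lemma integrable_periodic:
  fixes f :: "real \<Rightarrow> real"
  assumes per: "\<And>x. f (x + 2) = f x" and int: "integrable circ f"
  shows "integrable (lint a b) f"
proof -
  have [measurable]: "f \<in> borel_measurable borel"
    using borel_measurable_integrable[OF int] by simp
  obtain n :: nat where "(b - a) / 2 < real n" using reals_Archimedean2 by blast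
  then have "(\<integral>\<^sup>+y. ennreal \<bar>f y\<bar> \<partial>lint a b) \<le> of_nat n * (\<integral>\<^sup>+y. ennreal \<bar>f y\<bar> \<partial>circ)"
    by (intro nn_integral_periodic_le) (auto simp: per)
  also have "\<dots> < \<infinity>"
    using int by (auto simp: integrable_iff_bounded ennreal_mult_less_top of_nat_less_top)
  finally show ?thesis by (simp add: integrable_iff_bounded)
qed

text \<open>Parity of \<open>f\<close> becomes parity of its primitive, which is how an integral
  over [x-t,x+t] is later traded for one over [t-x,t+x].\<close>

definition prim :: "(real \<Rightarrow> real) \<Rightarrow> real \<Rightarrow> real" where
  "prim f y = (if 0 \<le> y then (\<integral>x. f x \<partial>lint 0 y) else - (\<integral>x. f x \<partial>lint y 0))"

lemma integral_lint_eq_prim: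
  assumes int: "\<And>a b. integrable (lint a b) f" and "a \<le> b"
  shows "(\<integral>x. f x \<partial>lint a b) = prim f b - prim f a"
  using integral_lint_split[OF int, of a 0 b] integral_lint_split[OF int, of 0 a b] integral_lint_split[OF int, of a b 0] assms(2)
  by (auto simp: prim_def not_le)

lemma LBINT_eq_lint:
  fixes f :: "real \<Rightarrow> real"
  assumes "f \<in> borel_measurable borel" "a \<le> b"
  shows "(LBINT x=ereal a..ereal b. f x) = (\<integral>x. f x \<partial>lint a b)"
  using assms by (simp add: interval_integral_Icc integral_lint)

lemma LBINT_eq_prim:
  assumes int: "\<And>a b. integrable (lint a b) f"
  shows "(LBINT x=ereal a..ereal b. f x) = prim f b - prim f a"
proof -
  have f: "f \<in> borel_measurable borel"
    using borel_measurable_integrable[OF int] by simp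
  show ?thesis
  proof (cases "a \<le> b")
    case True
    then show ?thesis using f by (simp add: LBINT_eq_lint integral_lint_eq_prim[OF int])
  next
    case False
    then have "(LBINT x=ereal a..ereal b. f x) = - (LBINT x=ereal b..ereal a. f x)"
      by (subst interval_integral_endpoints_reverse) simp
    also have "(LBINT x=ereal b..ereal a. f x) = prim f a - prim f b"
      using False f by (simp add: LBINT_eq_lint integral_lint_eq_prim[OF int])
    finally show ?thesis by simp
  qed
qed

text \<open>Both parities at once, with \<open>\<sigma>\<close> equal to 1 or -1.\<close>

lemma prim_minus_aux:
  fixes f :: "real \<Rightarrow> real"
  assumes [measurable]: "f \<in> borel_measurable borel"
    and par: "AE x in lborel. f (- x) = \<sigma> * f x" and y: "0 \<le> y"
  shows "prim f (- y) = - \<sigma> * prim f y"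
proof -
  have "(\<integral>x. f x \<partial>lint (- y) 0) = (\<integral>x. f (- x) \<partial>lint 0 y)"
    using integral_lint_reflect[of f, where h=0 and a=0 and b=y] by simp
  also have "\<dots> = (\<integral>x. \<sigma> * f x \<partial>lint 0 y)"
    using par by (intro integral_cong_AE) (auto simp: AE_lint elim!: eventually_mono)
  finally have "(\<integral>x. f x \<partial>lint (- y) 0) = \<sigma> * (\<integral>x. f x \<partial>lint 0 y)" by simp
  moreover have "(\<integral>x. f x \<partial>lint 0 0) = 0"
    by (rule integral_eq_zero_AE, unfold AE_lint, use AE_lborel_singleton[of 0] in eventually_elim) simp
  ultimately show ?thesis using y by (cases "y = 0") (auto simp: prim_def)
qed

lemma
  fixes f :: "real \<Rightarrow> real"
  assumes f: "f \<in> borel_measurable borel"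
  shows prim_of_odd: "(AE x in lborel. f (- x) = - f x) \<Longrightarrow> prim f (- y) = prim f y"
    and prim_of_even: "(AE x in lborel. f (- x) = f x) \<Longrightarrow> prim f (- y) = - prim f y"
proof -
  show "prim f (- y) = prim f y" if "AE x in lborel. f (- x) = - f x"
    using prim_minus_aux[OF f, of "-1" y] prim_minus_aux[OF f, of "-1" "- y"] that
    by (cases "0 \<le> y") auto
  show "prim f (- y) = - prim f y" if "AE x in lborel. f (- x) = f x"
    using prim_minus_aux[OF f, of 1 y] prim_minus_aux[OF f, of 1 "- y"] that
    by (cases "0 \<le> y") auto
qed

section \<open>Odd and even periodic extensions\<close>

lemma oddext_wrap: "oddext f x = (if 0 \<le> wrap x then f (wrap x) else - f (- wrap x))"
  by (simp add: oddext_def wrap_def Let_def)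

lemma evenext_wrap: "evenext f x = f \<bar>wrap x\<bar>"
  by (simp add: evenext_def wrap_def Let_def)

lemma oddext_periodic [simp]: "oddext f (x + 2) = oddext f x"
  by (simp add: oddext_wrap)

lemma evenext_periodic [simp]: "evenext f (x + 2) = evenext f x"
  by (simp add: evenext_wrap)

lemma wrap_minus: "wrap x \<noteq> -1 \<Longrightarrow> wrap (- x) = - wrap x"
  and wrap_minus': "wrap x = -1 \<Longrightarrow> wrap (- x) = -1"
proof -
  have *: "wrap (- x) = wrap (- wrap x)"
    using periodic_of_int[of wrap "- x" "\<lfloor>(x + 1) / 2\<rfloor>"] by (simp add: wrap_def[of x])
  show "wrap (- x) = - wrap x" if "wrap x \<noteq> -1"
    unfolding * using wrap_bounds[of x] that by (intro wrap_eq) auto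
  show "wrap (- x) = -1" if "wrap x = -1"
    unfolding * that using wrap_add2[of "-1"] wrap_eq[of "-1"] by simp
qed

lemma evenext_minus [simp]: "evenext f (- x) = evenext f x"
  using wrap_minus[of x] wrap_minus'[of x] by (cases "wrap x = -1") (auto simp: evenext_wrap)

lemma oddext_minus: "wrap x \<noteq> -1 \<Longrightarrow> wrap x \<noteq> 0 \<Longrightarrow> oddext f (- x) = - oddext f x"
  using wrap_minus[of x] by (auto simp: oddext_wrap)

lemma AE_wrap_nonint: "AE x in lborel. wrap x \<noteq> -1 \<and> wrap x \<noteq> 0"
proof -
  have "AE x in lborel. x \<notin> (\<int> :: real set)"
    by (rule AE_not_in) (simp add: countable_imp_null_set_lborel countable_int)
  then show ?thesis
  proof eventually_elim
    case (elim x)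
    have x: "x = wrap x + of_int (2 * \<lfloor>(x + 1) / 2\<rfloor>)" by (simp add: wrap_def)
    have "wrap x \<notin> \<int>"
    proof
      assume "wrap x \<in> \<int>"
      then have "wrap x + of_int (2 * \<lfloor>(x + 1) / 2\<rfloor>) \<in> \<int>" by (intro Ints_add Ints_of_int)
      with x elim show False by simp
    qed
    then show ?case by auto
  qed
qed

text \<open>At integers oddness may fail, since nothing is assumed on \<open>f 0\<close> and
  \<open>f 1\<close>; this is why parity is handled almost everywhere.\<close>

lemma oddext_minus_AE: "AE x in lborel. oddext f (- x) = - oddext f x"
  using AE_wrap_nonint by eventually_elim (simp add: oddext_minus)

lemma evenext_01: "0 \<le> x \<Longrightarrow> x < 1 \<Longrightarrow> evenext f x = f x"
  and oddext_01: "0 \<le> x \<Longrightarrow> x < 1 \<Longrightarrow> oddext f x = f x"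
  and oddext_minus_01: "0 < x \<Longrightarrow> x < 1 \<Longrightarrow> oddext f (- x) = - f x"
  using wrap_eq[of x] wrap_eq[of "- x"] by (auto simp: evenext_wrap oddext_wrap)

lemma borel_measurable_evenext [measurable]:
  assumes [measurable]: "f \<in> borel_measurable borel"
  shows "evenext f \<in> borel_measurable borel"
  unfolding evenext_wrap[abs_def] by measurable

lemma borel_measurable_oddext [measurable]:
  assumes [measurable]: "f \<in> borel_measurable borel"
  shows "oddext f \<in> borel_measurable borel"
  unfolding oddext_wrap[abs_def] by measurable

lemma AE_lint_open: "AE x in lint a b. a < x \<and> x < b"
  unfolding AE_lint using AE_lborel_singleton[of a] AE_lborel_singleton[of b] by eventually_elim auto

lemma nn_integral_evenext:
  assumes [measurable]: "f \<in> borel_measurable borel"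
  shows "(\<integral>\<^sup>+x. ennreal \<bar>evenext f x\<bar> \<partial>circ) = 2 * (\<integral>\<^sup>+x. ennreal \<bar>f x\<bar> \<partial>lint 0 1)"
proof -
  have "(\<integral>\<^sup>+x. ennreal \<bar>evenext f x\<bar> \<partial>circ) = (\<integral>\<^sup>+x. ennreal \<bar>evenext f x\<bar> + ennreal \<bar>evenext f (- x)\<bar> \<partial>lint 0 1)"
    by (rule nn_integral_symmetric) measurable
  also have "\<dots> = (\<integral>\<^sup>+x. 2 * ennreal \<bar>f x\<bar> \<partial>lint 0 1)"
    by (rule nn_integral_cong_AE, use AE_lint_open in eventually_elim) (simp add: evenext_01 mult_2)
  finally show ?thesis by (simp add: nn_integral_cmult)
qed

lemma nn_integral_oddext:
  assumes [measurable]: "f \<in> borel_measurable borel" "k \<in> borel_measurable borel"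
    and k: "\<And>x. k (- x) = k x"
  shows "(\<integral>\<^sup>+x. k (oddext f x) \<partial>circ) = 2 * (\<integral>\<^sup>+x. k (f x) \<partial>lint 0 1)"
proof -
  have "(\<integral>\<^sup>+x. k (oddext f x) \<partial>circ) = (\<integral>\<^sup>+x. k (oddext f x) + k (oddext f (- x)) \<partial>lint 0 1)"
    by (rule nn_integral_symmetric) measurable
  also have "\<dots> = (\<integral>\<^sup>+x. 2 * k (f x) \<partial>lint 0 1)"
    by (rule nn_integral_cong_AE, use AE_lint_open in eventually_elim) (simp add: oddext_01 oddext_minus_01 k mult_2)
  finally show ?thesis by (simp add: nn_integral_cmult)
qed

text \<open>The primitive of an even function is odd, and it is 2-periodic because its increment
  over a period is twice \<open>f 1 = 0\<close>. So it agrees with \<open>oddext f\<close> at every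
  point, integers included.\<close>

lemma oddext_eq_prim:
  assumes w [measurable]: "w \<in> borel_measurable borel" and int: "integrable (lint 0 1) w"
    and f: "\<And>x. 0 \<le> x \<Longrightarrow> x \<le> 1 \<Longrightarrow> f x = (\<integral>s. w s \<partial>lint 0 x)" and f1: "f 1 = 0"
  shows "oddext f y = prim (evenext w) y"
proof -
  have "integrable circ (evenext w)"
    using int by (simp add: integrable_iff_bounded nn_integral_evenext ennreal_mult_less_top)
  then have int': "integrable (lint a b) (evenext w)" for a b
    by (rule integrable_periodic[rotated]) simp
  have prim01: "prim (evenext w) x = f x" if "0 \<le> x" "x \<le> 1" for x
  proof -
    have "(\<integral>s. evenext w s \<partial>lint 0 x) = (\<integral>s. w s \<partial>lint 0 x)"
      by (rule integral_cong_AE, simp, simp, use AE_lint_open in eventually_elim) (use that in \<open>auto simp: evenext_01\<close>)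
    then show ?thesis using that f by (simp add: prim_def)
  qed
  have odd: "prim (evenext w) (- x) = - prim (evenext w) x" for x
    by (rule prim_of_even) auto
  have per: "prim (evenext w) (x + 2) = prim (evenext w) x" for x
  proof -
    have "prim (evenext w) (x + 2) - prim (evenext w) x = (\<integral>s. evenext w s \<partial>lint x (x + 2))"
      by (rule integral_lint_eq_prim[symmetric]) (auto simp: int')
    also have "\<dots> = (\<integral>s. evenext w s \<partial>circ)"
      by (rule integral_period) auto
    also have "\<dots> = prim (evenext w) 1 - prim (evenext w) (- 1)"
      by (rule integral_lint_eq_prim) (auto simp: int')
    also have "\<dots> = 0" using prim01[of 1] odd[of 1] f1 by simp
    finally show ?thesis by simp
  qed
  have "prim (evenext w) y = prim (evenext w) (wrap y)"
    using periodic_wrap[of "prim (evenext w)", OF per] by simp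
  also have "\<dots> = oddext f y"
    using wrap_bounds[of y] prim01[of "wrap y"] prim01[of "- wrap y"] odd[of "wrap y"]
    by (auto simp: oddext_wrap)
  finally show ?thesis ..
qed

section \<open>The wave equation in characteristic coordinates\<close>

lemma Lp_integrable:
  assumes "1 < p" and "Lp p v"
  shows "v \<in> borel_measurable borel" "integrable (lint 0 1) (\<lambda>x. \<bar>v x\<bar> powr p)" "integrable (lint 0 1) v"
proof -
  show [measurable]: "v \<in> borel_measurable borel"
    using assms(2) by (simp add: Lp_def)
  show int: "integrable (lint 0 1) (\<lambda>x. \<bar>v x\<bar> powr p)"
    using assms(2) by (subst integrable_lint) (auto simp: Lp_def)
  show "integrable (lint 0 1) v"
  proof (rule Bochner_Integration.integrable_bound[where f="\<lambda>x. 1 + \<bar>v x\<bar> powr p"])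
    show "integrable (lint 0 1) (\<lambda>x. 1 + \<bar>v x\<bar> powr p)" using int by simp
    show "AE x in lint 0 1. norm (v x) \<le> norm (1 + \<bar>v x\<bar> powr p)"
      using powr_ge_self[of p] assms(1) by (intro AE_I2) simp
  qed simp
qed

lemma LBINT_01:
  fixes f :: "real \<Rightarrow> real"
  assumes "f \<in> borel_measurable borel"
  shows "(LBINT x=0..1. f x) = (\<integral>x. f x \<partial>lint 0 1)"
  using LBINT_eq_lint[OF assms, of 0 1] by (simp add: zero_ereal_def one_ereal_def)

lemma LBINT_0:
  fixes f :: "real \<Rightarrow> real"
  assumes "f \<in> borel_measurable borel" "0 \<le> t"
  shows "(LBINT x=0..ereal t. f x) = (\<integral>x. f x \<partial>lint 0 t)"
  using LBINT_eq_lint[OF assms] by (simp add: zero_ereal_def)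

text \<open>\<open>a\<close> is arbitrary outside [0,1], but \<open>evenext\<close> reads only
  values in [0,1], so a truncation of \<open>a\<close> has the same extension.\<close>

lemma borel_measurable_evenext_continuous:
  assumes "continuous_on {0..1} a"
  shows "evenext a \<in> borel_measurable borel"
proof -
  have [measurable]: "(\<lambda>x. indicator {0..1} x *\<^sub>R a x) \<in> borel_measurable borel"
    by (rule borel_measurable_continuous_on_indicator) (use assms in auto)
  have eq: "evenext a = evenext (\<lambda>x. indicator {0..1} x *\<^sub>R a x)"
  proof
    fix x
    have "\<bar>wrap x\<bar> \<in> {0..1}" using wrap_bounds[of x] by auto
    then show "evenext a x = evenext (\<lambda>x. indicator {0..1} x *\<^sub>R a x) x" by (simp add: evenext_wrap)
  qed
  show ?thesis unfolding eq by measurable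
qed

locale damped_wave =
  fixes p B :: real and a z0 z0' z1 :: "real \<Rightarrow> real" and z zx zt :: "real \<Rightarrow> real \<Rightarrow> real"
  assumes p: "1 < p"
    and a_meas [measurable]: "evenext a \<in> borel_measurable borel"
    and a_nonneg: "0 \<le> evenext a x" and a_le: "evenext a x / 2 \<le> B"
    and z0: "W1p0 p z0 z0'" and z1: "Lp p z1"
    and sol: "weak_sol p a z0 z1 z zx zt"
begin

lemma W1p0_z: "0 \<le> t \<Longrightarrow> W1p0 p (z t) (zx t)" and Lp_zt: "0 \<le> t \<Longrightarrow> Lp p (zt t)"
  using sol by (auto simp: weak_sol_def)

lemma Lp_zx: "0 \<le> t \<Longrightarrow> Lp p (zx t)"
  using W1p0_z by (simp add: W1p0_def)

lemma Lp_z0': "Lp p z0'"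
  using z0 by (simp add: W1p0_def)

lemmas z0'_meas [measurable] = Lp_integrable(1)[OF p Lp_z0']
lemmas z1_meas [measurable] = Lp_integrable(1)[OF p z1]

lemma measurable_zt [measurable (raw)]:
  assumes "f \<in> borel_measurable M" "k \<in> borel_measurable M"
  shows "(\<lambda>x. zt (f x) (k x)) \<in> borel_measurable M"
proof -
  have "(\<lambda>(s, x). zt s x) \<in> borel_measurable (borel \<Otimes>\<^sub>M borel)"
    using sol by (simp add: weak_sol_def borel_prod)
  from measurable_compose[OF measurable_Pair[OF assms] this] show ?thesis by simp
qed

definition V :: "real \<Rightarrow> real \<Rightarrow> real" where "V s x = oddext (zt s) x"
definition g :: "real \<Rightarrow> real \<Rightarrow> real" where "g s x = evenext a x * V s x"
text \<open>z_x + z_t at time 0 on the whole line: the derivative of an odd extension is the even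
  extension of the derivative.\<close>

definition \<rho>0 :: "real \<Rightarrow> real" where "\<rho>0 y = evenext z0' y + oddext z1 y"

text \<open>The Riemann invariant \<open>z\<^sub>x + z\<^sub>t\<close> of the extended solution along the characteristic
  \<open>x = y - t\<close>; since \<open>z\<close> is odd, \<open>z\<^sub>x - z\<^sub>t\<close> is its reflection.\<close>

definition F :: "real \<Rightarrow> real \<Rightarrow> real" where
  "F t y = \<rho>0 y - (\<integral>s. (if 0 \<le> s \<and> s \<le> t then g s (y - s) else 0) \<partial>lborel)"

lemma measurable_V [measurable (raw)]:
  assumes [measurable]: "f \<in> borel_measurable M" "k \<in> borel_measurable M"
  shows "(\<lambda>x. V (f x) (k x)) \<in> borel_measurable M"
  unfolding V_def oddext_wrap by measurable

lemma measurable_g [measurable (raw)]: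
  assumes [measurable]: "f \<in> borel_measurable M" "k \<in> borel_measurable M"
  shows "(\<lambda>x. g (f x) (k x)) \<in> borel_measurable M"
  unfolding g_def by measurable

lemma \<rho>0_meas [measurable]: "\<rho>0 \<in> borel_measurable borel"
  unfolding \<rho>0_def[abs_def] by measurable

lemma F_meas: "(\<lambda>(t, y). F t y) \<in> borel_measurable (borel \<Otimes>\<^sub>M borel)"
  unfolding F_def by measurable

lemma measurable_F [measurable (raw)]:
  assumes "f \<in> borel_measurable M" "k \<in> borel_measurable M"
  shows "(\<lambda>x. F (f x) (k x)) \<in> borel_measurable M"
  using measurable_compose[OF measurable_Pair[OF assms] F_meas] by simp

text \<open>The cut-off integral in the definition makes joint measurability in
  \<open>(t, y)\<close> automatic; this is the form used for computing.\<close>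

lemma F_eq: "F t y = \<rho>0 y - (\<integral>s. g s (y - s) \<partial>lint 0 t)"
proof -
  have "(\<integral>s. (if 0 \<le> s \<and> s \<le> t then g s (y - s) else 0) \<partial>lborel) = (\<integral>s. indicator {0..t} s * g s (y - s) \<partial>lborel)"
    by (intro Bochner_Integration.integral_cong) (auto simp: indicator_def)
  then show ?thesis
    by (simp add: F_def integral_lint set_lebesgue_integral_def)
qed

lemma V_per: "V s (x + 2) = V s x"
  by (simp add: V_def)

lemma g_per: "g s (x + 2) = g s x"
  by (simp add: g_def V_per)

lemma g_per_diff: "g s (x + 2 - s') = g s (x - s')"
  using g_per[of s "x - s'"] by (simp add: algebra_simps)

lemma F_per: "F t (y + 2) = F t y"
  by (simp add: F_eq \<rho>0_def g_per_diff)

lemma Lp_bounds: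
  obtains C where "0 \<le> C"
    "\<And>s. 0 \<le> s \<Longrightarrow> (\<integral>\<^sup>+x. ennreal (\<bar>zt s x\<bar> powr p) \<partial>lint 0 1) \<le> ennreal C"
    "\<And>s. 0 \<le> s \<Longrightarrow> (\<integral>\<^sup>+x. ennreal (\<bar>zx s x\<bar> powr p) \<partial>lint 0 1) \<le> ennreal C"
proof -
  obtain C where C: "\<forall>t\<ge>0. (LBINT x=0..1. \<bar>zx t x\<bar> powr p) \<le> C \<and> (LBINT x=0..1. \<bar>zt t x\<bar> powr p) \<le> C"
    using sol by (auto simp: weak_sol_def)
  have le: "(\<integral>\<^sup>+x. ennreal (\<bar>v x\<bar> powr p) \<partial>lint 0 1) \<le> ennreal (max 0 C)"
    if "Lp p v" "(LBINT x=0..1. \<bar>v x\<bar> powr p) \<le> C" for v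
  proof -
    note [measurable] = Lp_integrable(1)[OF p that(1)]
    have "(\<integral>\<^sup>+x. ennreal (\<bar>v x\<bar> powr p) \<partial>lint 0 1) = ennreal (\<integral>x. \<bar>v x\<bar> powr p \<partial>lint 0 1)"
      by (intro nn_integral_eq_integral Lp_integrable(2)[OF p that(1)]) simp
    also have "\<dots> \<le> ennreal (max 0 C)"
      using that(2) by (intro ennreal_leI) (simp add: LBINT_01)
    finally show ?thesis .
  qed
  show ?thesis
    by (rule that[of "max 0 C"]) (use C Lp_zx Lp_zt in \<open>auto intro!: le\<close>)
qed

lemma B_nonneg: "0 \<le> B"
  using a_nonneg[of 0] a_le[of 0] by linarith

lemma zt_bound:
  obtains C where "0 \<le> C" "\<And>s. 0 \<le> s \<Longrightarrow> (\<integral>\<^sup>+x. ennreal \<bar>zt s x\<bar> \<partial>lint 0 1) \<le> ennreal C"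
proof -
  obtain C where C: "0 \<le> C"
    "\<And>s. 0 \<le> s \<Longrightarrow> (\<integral>\<^sup>+x. ennreal (\<bar>zt s x\<bar> powr p) \<partial>lint 0 1) \<le> ennreal C"
    by (rule Lp_bounds) blast
  show ?thesis
  proof (rule that[of "1 + C"])
    show "0 \<le> 1 + C" using C by simp
    fix s :: real assume s: "0 \<le> s"
    have "(\<integral>\<^sup>+x. ennreal \<bar>zt s x\<bar> \<partial>lint 0 1) \<le> (\<integral>\<^sup>+x. 1 + ennreal (\<bar>zt s x\<bar> powr p) \<partial>lint 0 1)"
      using powr_ge_self[of p] p
      by (intro nn_integral_mono) (simp add: ennreal_1[symmetric] ennreal_plus[symmetric] ennreal_leI del: ennreal_1 ennreal_plus)
    also have "\<dots> = 1 + (\<integral>\<^sup>+x. ennreal (\<bar>zt s x\<bar> powr p) \<partial>lint 0 1)"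
      by (subst nn_integral_add) (auto simp: emeasure_lint)
    also have "\<dots> \<le> 1 + ennreal C"
      using C(2)[OF s] by (intro add_left_mono)
    also have "\<dots> = ennreal (1 + C)"
      using C(1) by (simp add: ennreal_plus)
    finally show "(\<integral>\<^sup>+x. ennreal \<bar>zt s x\<bar> \<partial>lint 0 1) \<le> ennreal (1 + C)" .
  qed
qed

lemma g_bound:
  obtains K where "0 \<le> K" "\<And>s. 0 \<le> s \<Longrightarrow> (\<integral>\<^sup>+x. ennreal \<bar>g s x\<bar> \<partial>circ) \<le> ennreal K"
proof -
  obtain C where C: "0 \<le> C" "\<And>s. 0 \<le> s \<Longrightarrow> (\<integral>\<^sup>+x. ennreal \<bar>zt s x\<bar> \<partial>lint 0 1) \<le> ennreal C"
    by (rule zt_bound) blast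
  show ?thesis
  proof (rule that[of "2 * B * (2 * C)"])
    show "0 \<le> 2 * B * (2 * C)" using B_nonneg C by simp
    fix s :: real assume s: "0 \<le> s"
    have "(\<integral>\<^sup>+x. ennreal \<bar>g s x\<bar> \<partial>circ) \<le> (\<integral>\<^sup>+x. ennreal (2 * B) * ennreal \<bar>oddext (zt s) x\<bar> \<partial>circ)"
    proof (intro nn_integral_mono)
      fix x
      have "\<bar>g s x\<bar> \<le> 2 * B * \<bar>oddext (zt s) x\<bar>"
        using a_nonneg[of x] a_le[of x] by (auto simp: g_def V_def abs_mult intro!: mult_right_mono)
      then show "ennreal \<bar>g s x\<bar> \<le> ennreal (2 * B) * ennreal \<bar>oddext (zt s) x\<bar>"
        using B_nonneg by (subst ennreal_mult[symmetric]) (auto intro!: ennreal_leI)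
    qed
    also have "\<dots> = ennreal (2 * B) * (\<integral>\<^sup>+x. ennreal \<bar>oddext (zt s) x\<bar> \<partial>circ)"
      by (rule nn_integral_cmult) measurable
    also have "(\<integral>\<^sup>+x. ennreal \<bar>oddext (zt s) x\<bar> \<partial>circ) = 2 * (\<integral>\<^sup>+x. ennreal \<bar>zt s x\<bar> \<partial>lint 0 1)"
      by (rule nn_integral_oddext) auto
    also have "(\<integral>\<^sup>+x. ennreal \<bar>zt s x\<bar> \<partial>lint 0 1) \<le> ennreal C"
      by (rule C(2)[OF s])
    also have "ennreal (2 * B) * (2 * ennreal C) = ennreal (2 * B * (2 * C))"
      using B_nonneg C(1) by (simp add: ennreal_mult mult.assoc mult.left_commute)
    finally show "(\<integral>\<^sup>+x. ennreal \<bar>g s x\<bar> \<partial>circ) \<le> ennreal (2 * B * (2 * C))"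
      by (simp add: mult_left_mono)
  qed
qed

text \<open>Uniform in time and in the position of the window, since the windows met later move with
  \<open>s\<close>.\<close>

lemma g_local_bound:
  obtains K where "0 \<le> K" "\<And>s \<alpha> \<beta>. 0 \<le> s \<Longrightarrow> \<beta> - \<alpha> \<le> L \<Longrightarrow> (\<integral>\<^sup>+x. ennreal \<bar>g s x\<bar> \<partial>lint \<alpha> \<beta>) \<le> ennreal K"
proof -
  obtain K where K: "0 \<le> K" "\<And>s. 0 \<le> s \<Longrightarrow> (\<integral>\<^sup>+x. ennreal \<bar>g s x\<bar> \<partial>circ) \<le> ennreal K"
    by (rule g_bound) blast
  obtain n :: nat where n: "L / 2 < real n" using reals_Archimedean2 by blast
  show ?thesis
  proof (rule that[of "real n * K"])
    show "0 \<le> real n * K" using K by simp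
    fix s \<alpha> \<beta> :: real assume s: "0 \<le> s" and "\<beta> - \<alpha> \<le> L"
    then have "(\<integral>\<^sup>+x. ennreal \<bar>g s x\<bar> \<partial>lint \<alpha> \<beta>) \<le> of_nat n * (\<integral>\<^sup>+x. ennreal \<bar>g s x\<bar> \<partial>circ)"
      using n by (intro nn_integral_periodic_le) (auto simp: g_per)
    also have "\<dots> \<le> of_nat n * ennreal K"
      by (intro mult_left_mono K s) simp
    also have "\<dots> = ennreal (real n * K)"
      using K by (simp add: ennreal_mult ennreal_of_nat_eq_real_of_nat)
    finally show "(\<integral>\<^sup>+x. ennreal \<bar>g s x\<bar> \<partial>lint \<alpha> \<beta>) \<le> ennreal (real n * K)" .
  qed
qed

lemma integrable_g:
  assumes "0 \<le> s"
  shows "integrable (lint \<alpha> \<beta>) (g s)"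
proof -
  obtain K where K: "0 \<le> K" "\<And>s \<alpha>' \<beta>'. 0 \<le> s \<Longrightarrow> \<beta>' - \<alpha>' \<le> \<beta> - \<alpha> \<Longrightarrow> (\<integral>\<^sup>+x. ennreal \<bar>g s x\<bar> \<partial>lint \<alpha>' \<beta>') \<le> ennreal K"
    by (rule g_local_bound) blast
  have "(\<integral>\<^sup>+x. ennreal \<bar>g s x\<bar> \<partial>lint \<alpha> \<beta>) < \<infinity>"
    by (rule le_less_trans[OF K(2)[OF assms order_refl]]) simp
  then show ?thesis by (simp add: integrable_iff_bounded)
qed

lemma integrable_evenext_z0': "integrable (lint \<alpha> \<beta>) (evenext z0')"
proof (rule integrable_periodic)
  show "integrable circ (evenext z0')"
    using Lp_integrable(3)[OF p Lp_z0'] by (simp add: integrable_iff_bounded nn_integral_evenext ennreal_mult_less_top)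
qed simp

lemma integrable_oddext_z1: "integrable (lint \<alpha> \<beta>) (oddext z1)"
proof (rule integrable_periodic)
  have "(\<integral>\<^sup>+x. ennreal \<bar>oddext z1 x\<bar> \<partial>circ) = 2 * (\<integral>\<^sup>+x. ennreal \<bar>z1 x\<bar> \<partial>lint 0 1)"
    by (rule nn_integral_oddext) auto
  then show "integrable circ (oddext z1)"
    using Lp_integrable(3)[OF p z1] by (simp add: integrable_iff_bounded ennreal_mult_less_top)
qed simp

lemma integrable_\<rho>0: "integrable (lint \<alpha> \<beta>) \<rho>0"
  unfolding \<rho>0_def[abs_def] by (intro Bochner_Integration.integrable_add integrable_evenext_z0' integrable_oddext_z1)

text \<open>Two Fubini domains: the strip for integrating \<open>F\<close> in space at a fixed time,
  and the triangle \<open>\<sigma> \<le> s\<close> that arises when \<open>F\<close> is integrated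
  in time at a fixed \<open>x\<close>.\<close>

lemma integrable_g_strip:
  assumes "0 \<le> t"
  shows "integrable (lint 0 t \<Otimes>\<^sub>M lint \<alpha> \<beta>) (\<lambda>(s, y). g s (y - s))"
    and "integrable (lint 0 t \<Otimes>\<^sub>M lint \<alpha> \<beta>) (\<lambda>(\<sigma>, s). if \<sigma> \<le> s then g \<sigma> (x + s - \<sigma>) else 0)"
proof -
  obtain K where K: "0 \<le> K" "\<And>s \<alpha>' \<beta>'. 0 \<le> s \<Longrightarrow> \<beta>' - \<alpha>' \<le> \<beta> - \<alpha> \<Longrightarrow> (\<integral>\<^sup>+x. ennreal \<bar>g s x\<bar> \<partial>lint \<alpha>' \<beta>') \<le> ennreal K"
    by (rule g_local_bound) blast
  have le: "(\<integral>\<^sup>+y. ennreal \<bar>g s (h + y)\<bar> \<partial>lint \<alpha> \<beta>) \<le> ennreal K" if "0 \<le> s" for s h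
  proof -
    have "(\<integral>\<^sup>+y. ennreal \<bar>g s (h + y)\<bar> \<partial>lint \<alpha> \<beta>) = (\<integral>\<^sup>+y. ennreal \<bar>g s y\<bar> \<partial>lint (h + \<alpha>) (h + \<beta>))"
      by (rule nn_integral_lint_shift[of "\<lambda>y. ennreal \<bar>g s y\<bar>"]) measurable
    also have "\<dots> \<le> ennreal K" by (rule K(2)) (use that in auto)
    finally show ?thesis .
  qed
  have fin: "(\<integral>\<^sup>+s. ennreal K \<partial>lint 0 t) < \<infinity>"
    by (simp add: ennreal_mult_less_top emeasure_lint emeasure_lborel_Icc_eq)
  have "(\<integral>\<^sup>+s. \<integral>\<^sup>+y. ennreal \<bar>g s (y - s)\<bar> \<partial>lint \<alpha> \<beta> \<partial>lint 0 t) \<le> (\<integral>\<^sup>+s. ennreal K \<partial>lint 0 t)"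
    by (rule nn_integral_mono_AE, use AE_lint_mem in eventually_elim) (use le[of _ "- _"] in auto)
  with fin show "integrable (lint 0 t \<Otimes>\<^sub>M lint \<alpha> \<beta>) (\<lambda>(s, y). g s (y - s))"
    by (auto simp: integrable_iff_bounded lint.nn_integral_fst[symmetric] case_prod_beta elim: le_less_trans)
  have "(\<integral>\<^sup>+\<sigma>. \<integral>\<^sup>+s. ennreal \<bar>if \<sigma> \<le> s then g \<sigma> (x + s - \<sigma>) else 0\<bar> \<partial>lint \<alpha> \<beta> \<partial>lint 0 t) \<le> (\<integral>\<^sup>+s. ennreal K \<partial>lint 0 t)"
  proof (rule nn_integral_mono_AE, use AE_lint_mem in eventually_elim)
    case (elim \<sigma>)
    have "(\<integral>\<^sup>+s. ennreal \<bar>if \<sigma> \<le> s then g \<sigma> (x + s - \<sigma>) else 0\<bar> \<partial>lint \<alpha> \<beta>) \<le> (\<integral>\<^sup>+s. ennreal \<bar>g \<sigma> ((x - \<sigma>) + s)\<bar> \<partial>lint \<alpha> \<beta>)"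
      by (intro nn_integral_mono) (auto simp: algebra_simps)
    also have "\<dots> \<le> ennreal K" by (rule le) (use elim in auto)
    finally show ?case .
  qed
  with fin show "integrable (lint 0 t \<Otimes>\<^sub>M lint \<alpha> \<beta>) (\<lambda>(\<sigma>, s). if \<sigma> \<le> s then g \<sigma> (x + s - \<sigma>) else 0)"
    by (auto simp: integrable_iff_bounded lint.nn_integral_fst[symmetric] case_prod_beta cong: if_cong elim: le_less_trans)
qed

lemma g_odd: "AE x in lborel. g s (- x) = - g s x"
  using oddext_minus_AE[of "zt s"] by eventually_elim (simp add: g_def V_def)

text \<open>Fubini: at time \<open>s\<close> the characteristics through the window fill the same
  window translated by \<open>- s\<close>.\<close>

lemma F_window:
  assumes t: "0 \<le> t" and x: "0 \<le> x"
  shows "(\<integral>y. F t y \<partial>lint (t - x) (t + x)) =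
    (\<integral>y. \<rho>0 y \<partial>lint (t - x) (t + x)) - (\<integral>s. \<integral>r. g s r \<partial>lint (t - s - x) (t - s + x) \<partial>lint 0 t)"
    and "integrable (lint (t - x) (t + x)) (F t)"
proof -
  note int = integrable_g_strip(1)[OF t, of "t - x" "t + x"]
  have i2: "integrable (lint (t - x) (t + x)) (\<lambda>y. \<integral>s. g s (y - s) \<partial>lint 0 t)"
    by (rule lint_pair.integrable_snd[OF int])
  have "(\<integral>y. F t y \<partial>lint (t - x) (t + x)) = (\<integral>y. \<rho>0 y \<partial>lint (t - x) (t + x)) - (\<integral>y. \<integral>s. g s (y - s) \<partial>lint 0 t \<partial>lint (t - x) (t + x))"
    unfolding F_eq by (intro Bochner_Integration.integral_diff integrable_\<rho>0 i2)
  also have "(\<integral>y. \<integral>s. g s (y - s) \<partial>lint 0 t \<partial>lint (t - x) (t + x)) = (\<integral>s. \<integral>y. g s (y - s) \<partial>lint (t - x) (t + x) \<partial>lint 0 t)"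
    by (rule lint_pair.Fubini_integral[OF int])
  also have "\<dots> = (\<integral>s. \<integral>r. g s r \<partial>lint (t - s - x) (t - s + x) \<partial>lint 0 t)"
  proof (rule Bochner_Integration.integral_cong[OF refl])
    fix s
    have "(\<integral>y. g s (- s + y) \<partial>lint (t - x) (t + x)) = (\<integral>r. g s r \<partial>lint (- s + (t - x)) (- s + (t + x)))"
      by (rule integral_lint_shift) measurable
    then show "(\<integral>y. g s (y - s) \<partial>lint (t - x) (t + x)) = (\<integral>r. g s r \<partial>lint (t - s - x) (t - s + x))"
      by (simp add: algebra_simps)
  qed
  finally show "(\<integral>y. F t y \<partial>lint (t - x) (t + x)) =
    (\<integral>y. \<rho>0 y \<partial>lint (t - x) (t + x)) - (\<integral>s. \<integral>r. g s r \<partial>lint (t - s - x) (t - s + x) \<partial>lint 0 t)" .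
  show "integrable (lint (t - x) (t + x)) (F t)"
    unfolding F_eq[abs_def] by (intro Bochner_Integration.integrable_diff integrable_\<rho>0 i2)
qed

text \<open>Parity turns the domain [x-t,x+t] of the d'Alembert formula into the window [t-x,t+x] of
  the moving frame, where the data and the Duhamel term add up to \<open>F\<close>. This is the only
  access of \<open>F\<close> to the solution; z_x and z_t are recovered from it.\<close>

lemma dAlembert_window:
  assumes t: "0 \<le> t" and x: "0 \<le> x" "x \<le> 1"
  shows "(\<integral>y. F t y \<partial>lint (t - x) (t + x)) = 2 * z t x"
proof -
  have "z t x = (oddext z0 (x + t) + oddext z0 (x - t)) / 2
                + (1/2) * (LBINT s=x-t..x+t. oddext z1 s)
                - (1/2) * (LBINT s=0..t. (LBINT r=x-(t-s)..x+(t-s). evenext a r * oddext (zt s) r))"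
    using sol t x by (simp add: weak_sol_def)
  \<comment> \<open>\<open>oddext z0\<close> is the primitive of an even function, so its value at
    \<open>x - t\<close> is minus that at \<open>t - x\<close>.\<close>
  moreover have "oddext z0 (x + t) + oddext z0 (x - t) = (\<integral>y. evenext z0' y \<partial>lint (t - x) (t + x))"
  proof -
    have eq: "oddext z0 y = prim (evenext z0') y" for y
    proof (rule oddext_eq_prim)
      show "z0' \<in> borel_measurable borel" by measurable
      show "integrable (lint 0 1) z0'" by (rule Lp_integrable(3)[OF p Lp_z0'])
      show "z0 x = (\<integral>s. z0' s \<partial>lint 0 x)" if "0 \<le> x" "x \<le> 1" for x
        using z0 that LBINT_0[of z0' x] by (auto simp: W1p0_def)
      show "z0 1 = 0" using z0 by (simp add: W1p0_def)
    qed
    have "prim (evenext z0') (x - t) = - prim (evenext z0') (t - x)"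
      using prim_of_even[of "evenext z0'" "t - x"] by simp
    then show ?thesis
      using x by (simp add: eq integral_lint_eq_prim integrable_evenext_z0' add.commute)
  qed
  \<comment> \<open>The two intervals differ by one symmetric about 0, on which an odd function
    integrates to 0.\<close>
  moreover have "(LBINT s=x-t..x+t. oddext z1 s) = (\<integral>y. oddext z1 y \<partial>lint (t - x) (t + x))"
  proof -
    have "prim (oddext z1) (x - t) = prim (oddext z1) (t - x)"
      using prim_of_odd[of "oddext z1" "t - x"] oddext_minus_AE by simp
    then show ?thesis
      using x by (simp add: LBINT_eq_prim integral_lint_eq_prim integrable_oddext_z1 add.commute)
  qed
  moreover have "(LBINT s=0..t. (LBINT r=x-(t-s)..x+(t-s). evenext a r * oddext (zt s) r)) =
      (\<integral>s. \<integral>r. g s r \<partial>lint (t - s - x) (t - s + x) \<partial>lint 0 t)"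
  proof -
    \<comment> \<open>\<open>\<phi>\<close> writes the inner integral with limits independent of
      \<open>s\<close>, which makes its measurability in \<open>s\<close> immediate.\<close>
    define \<phi> where "\<phi> s = (\<integral>y. g s (y - s) \<partial>lint (t - x) (t + x))" for s
    have [measurable]: "\<phi> \<in> borel_measurable borel"
      unfolding \<phi>_def[abs_def] by measurable
    have \<phi>: "\<phi> s = (\<integral>r. g s r \<partial>lint (t - s - x) (t - s + x))" for s
    proof -
      have "(\<integral>y. g s (- s + y) \<partial>lint (t - x) (t + x)) = (\<integral>r. g s r \<partial>lint (- s + (t - x)) (- s + (t + x)))"
        by (rule integral_lint_shift) measurable
      then show ?thesis by (simp add: \<phi>_def algebra_simps)
    qed
    have inner: "(LBINT r=x-(t-s)..x+(t-s). evenext a r * oddext (zt s) r) = \<phi> s" if "0 \<le> s" for s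
    proof -
      have "(LBINT r=x-(t-s)..x+(t-s). evenext a r * oddext (zt s) r) = (LBINT r=x-(t-s)..x+(t-s). g s r)"
        by (simp add: g_def V_def)
      also have "\<dots> = prim (g s) (x + (t - s)) - prim (g s) (x - (t - s))"
        by (rule LBINT_eq_prim) (rule integrable_g[OF that])
      also have "prim (g s) (x - (t - s)) = prim (g s) (t - s - x)"
        using prim_of_odd[of "g s" "t - s - x"] g_odd by simp
      also have "prim (g s) (x + (t - s)) - prim (g s) (t - s - x) = \<phi> s"
        unfolding \<phi> using x by (subst integral_lint_eq_prim) (auto simp: integrable_g[OF that] algebra_simps)
      finally show ?thesis .
    qed
    have "(LBINT s=0..t. (LBINT r=x-(t-s)..x+(t-s). evenext a r * oddext (zt s) r)) = (LBINT s=0..t. \<phi> s)"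
      using t by (intro interval_lebesgue_integral_cong inner) (auto simp: einterval_iff zero_ereal_def)
    also have "\<dots> = (\<integral>s. \<phi> s \<partial>lint 0 t)"
      using t by (intro LBINT_0) auto
    finally show ?thesis by (simp only: \<phi>)
  qed
  moreover have "(\<integral>y. \<rho>0 y \<partial>lint (t - x) (t + x)) = (\<integral>y. evenext z0' y \<partial>lint (t - x) (t + x)) + (\<integral>y. oddext z1 y \<partial>lint (t - x) (t + x))"
    unfolding \<rho>0_def by (intro Bochner_Integration.integral_add integrable_evenext_z0' integrable_oddext_z1)
  ultimately show ?thesis
    using F_window(1)[OF t x(1)] by simp
qed

text \<open>The window with \<open>x = 1\<close> is a whole period, so the mean vanishes by the
  boundary condition \<open>z t 1 = 0\<close>.\<close>

lemma F_mean_zero: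
  assumes "0 \<le> t"
  shows "(\<integral>y. F t y \<partial>circ) = 0"
proof -
  have "(\<integral>y. F t y \<partial>lint (t - 1) (t - 1 + 2)) = (\<integral>y. F t y \<partial>circ)"
    by (rule integral_period) (auto simp: F_per)
  moreover have "t - 1 + 2 = t + 1" by simp
  ultimately have "(\<integral>y. F t y \<partial>lint (t - 1) (t + 1)) = (\<integral>y. F t y \<partial>circ)" by metis
  then show ?thesis
    using dAlembert_window[OF assms, of 1] W1p0_z[OF assms] by (simp add: W1p0_def)
qed

end

section \<open>Recovering z_x, z_t and the evolution equation from F\<close>

lemma integrable_lint_shift:
  fixes f :: "real \<Rightarrow> real"
  assumes "f \<in> borel_measurable borel"
  shows "integrable (lint a b) (\<lambda>y. f (h + y)) \<longleftrightarrow> integrable (lint (h + a) (h + b)) f"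
  unfolding distr_lint_shift[symmetric] using assms by (subst integrable_distr_eq) auto

lemma integrable_lint_reflect:
  fixes f :: "real \<Rightarrow> real"
  assumes "f \<in> borel_measurable borel"
  shows "integrable (lint a b) (\<lambda>y. f (h - y)) \<longleftrightarrow> integrable (lint (h - b) (h - a)) f"
  unfolding distr_lint_reflect[symmetric] using assms by (subst integrable_distr_eq) auto

lemma integral_lint_same [simp]:
  fixes f :: "real \<Rightarrow> real"
  shows "(\<integral>x. f x \<partial>lint a a) = 0"
  by (rule integral_eq_zero_AE, use AE_lint_open in eventually_elim) simp

lemma integral_lint_cut:
  fixes f :: "real \<Rightarrow> real"
  assumes [measurable]: "f \<in> borel_measurable borel" and s: "0 \<le> s" "s \<le> t"
  shows "(\<integral>\<sigma>. (if \<sigma> \<le> s then f \<sigma> else 0) \<partial>lint 0 t) = (\<integral>\<sigma>. f \<sigma> \<partial>lint 0 s)"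
    and "(\<integral>\<sigma>. (if s \<le> \<sigma> then f \<sigma> else 0) \<partial>lint 0 t) = (\<integral>\<sigma>. f \<sigma> \<partial>lint s t)"
  using s by (auto simp: integral_lint set_lebesgue_integral_def indicator_def intro!: Bochner_Integration.integral_cong)

text \<open>Continuity of the primitive extends the hypothesis from rational to all
  \<open>t\<close>. Countably many \<open>t\<close> are what a union of null sets can provide when
  each time has its own exceptional set.\<close>

lemma AE_zero_if_integrals_zero_Rats:
  fixes f :: "real \<Rightarrow> real"
  assumes int: "integrable (lint 0 L) f"
    and zero: "\<And>t. t \<in> \<rat> \<Longrightarrow> 0 \<le> t \<Longrightarrow> t \<le> L \<Longrightarrow> (\<integral>x. f x \<partial>lint 0 t) = 0"
  shows "AE x in lint 0 L. f x = 0"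
proof -
  have f [measurable]: "f \<in> borel_measurable borel"
    using borel_measurable_integrable[OF int] by simp
  have cont: "continuous_on {0..L} (\<lambda>t. \<integral>x. f x \<partial>lint 0 t)"
    by (rule continuous_on_integral_lint[OF int])
  have all: "(\<integral>x. f x \<partial>lint 0 t) = 0" if t: "0 \<le> t" "t \<le> L" for t
  proof (rule ccontr)
    assume nz: "(\<integral>x. f x \<partial>lint 0 t) \<noteq> 0"
    then have "t \<noteq> 0" by auto
    with t have t0: "0 < t" by simp
    obtain \<delta> where \<delta>: "0 < \<delta>" "\<And>r. r \<in> {0..L} \<Longrightarrow> dist r t < \<delta> \<Longrightarrow>
        dist (\<integral>x. f x \<partial>lint 0 r) (\<integral>x. f x \<partial>lint 0 t) < \<bar>\<integral>x. f x \<partial>lint 0 t\<bar>"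
      using cont t nz unfolding continuous_on_iff by (metis atLeastAtMost_iff zero_less_abs_iff)
    obtain r where r: "r \<in> \<rat>" "max 0 (t - \<delta>) < r" "r < t"
      using Rats_dense_in_real[of "max 0 (t - \<delta>)" t] t0 \<delta>(1) by auto
    then have "r \<in> {0..L}" "dist r t < \<delta>" using t by (auto simp: dist_real_def)
    from \<delta>(2)[OF this] zero[of r] r t show False by (simp add: dist_real_def)
  qed
  show ?thesis
    unfolding AE_lint
  proof (rule AE_zero_if_integrals_zero)
    show "set_integrable lborel {0..L} f" using int by (simp add: integrable_lint)
    show "(LINT x:{0..t}|lborel. f x) = 0" if "0 \<le> t" "t \<le> L" for t
      using all[OF that] by (simp add: integral_lint)
  qed simp
qed

lemma AE_circ_shift:
  assumes [measurable]: "Measurable.pred borel P" and per: "\<And>x. P (x + 2) = P x" and ae: "AE x in circ. P x"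
  shows "AE y in circ. P (h + y)"
proof -
  have "(\<integral>\<^sup>+y. indicator {x. \<not> P x} (h + y) \<partial>lint (-1) (-1 + 2)) = (\<integral>\<^sup>+y. indicator {x. \<not> P x} y \<partial>circ)"
    by (rule nn_integral_period_shift) (auto simp: indicator_def per)
  also have "\<dots> = 0"
    using ae by (subst (asm) AE_iff_nn_integral) auto
  finally have "(\<integral>\<^sup>+y. indicator {y. \<not> P (h + y)} y \<partial>circ) = 0"
    by (simp add: indicator_def)
  then show ?thesis by (subst AE_iff_nn_integral) auto
qed

lemma AE_circ_of_AE_01:
  assumes [measurable]: "Measurable.pred borel P"
    and ae: "AE x in lint 0 1. P x \<and> P (- x)"
  shows "AE x in circ. P x"
proof -
  have a1: "AE x in lborel. x \<in> {0..1} \<longrightarrow> P x \<and> P (- x)"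
    using ae unfolding AE_lint .
  have "AE x in lborel. 0 + (-1) * x \<in> {0..1} \<longrightarrow> P (0 + (-1) * x) \<and> P (- (0 + (-1) * x))"
    by (rule AE_borel_affine[of "-1" "\<lambda>x. x \<in> {0..1} \<longrightarrow> P x \<and> P (- x)", OF _ _ a1]) auto
  then show ?thesis
    using a1 unfolding AE_lint by eventually_elim auto
qed

context damped_wave
begin

text \<open>The derivative of \<open>dAlembert_window\<close> in \<open>x\<close>, in integrated
  form: both sides have equal integrals over every [0,\<tau>]. It holds at every time.\<close>

lemma zx_eq:
  assumes t: "0 \<le> t"
  shows "AE x in lint 0 1. zx t x = (F t (t + x) + F t (t - x)) / 2"
proof -
  note [measurable] = Lp_integrable(1)[OF p Lp_zx[OF t]]
  define f where "f x = zx t x - (F t (t + x) + F t (t - x)) / 2" for x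
  have Fi: "integrable (lint (t - 1) (t + 1)) (F t)"
    using F_window(2)[OF t, of 1] by simp
  have i: "integrable (lint 0 \<tau>) (\<lambda>x. F t (t + x))" "integrable (lint 0 \<tau>) (\<lambda>x. F t (t - x))" "integrable (lint 0 \<tau>) (zx t)"
    if "\<tau> \<le> 1" for \<tau>
    using integrable_lint_subset[OF Fi, of t "t + \<tau>"] integrable_lint_subset[OF Fi, of "t - \<tau>" t]
      integrable_lint_subset[OF Lp_integrable(3)[OF p Lp_zx[OF t]], of 0 \<tau>] that
    by (simp_all add: integrable_lint_shift integrable_lint_reflect)
  have "AE x in lint 0 1. f x = 0"
  proof (rule AE_zero_if_integrals_zero_Rats)
    show "integrable (lint 0 1) f"
      unfolding f_def[abs_def] using i[of 1] by simp
    fix \<tau> :: real assume \<tau>: "0 \<le> \<tau>" "\<tau> \<le> 1"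
    have "(\<integral>x. f x \<partial>lint 0 \<tau>) = (\<integral>x. zx t x \<partial>lint 0 \<tau>) - ((\<integral>x. F t (t + x) \<partial>lint 0 \<tau>) + (\<integral>x. F t (t - x) \<partial>lint 0 \<tau>)) / 2"
      unfolding f_def using i[OF \<tau>(2)] by simp
    also have "(\<integral>x. F t (t + x) \<partial>lint 0 \<tau>) = (\<integral>x. F t x \<partial>lint t (t + \<tau>))"
      by (subst integral_lint_shift) auto
    also have "(\<integral>x. F t (t - x) \<partial>lint 0 \<tau>) = (\<integral>x. F t x \<partial>lint (t - \<tau>) t)"
      by (subst integral_lint_reflect) auto
    also have "(\<integral>x. F t x \<partial>lint t (t + \<tau>)) + (\<integral>x. F t x \<partial>lint (t - \<tau>) t) = 2 * z t \<tau>"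
      using integral_lint_split[of "t - \<tau>" "t + \<tau>" "F t" t] F_window(2)[OF t \<tau>(1)] dAlembert_window[OF t \<tau>] \<tau> by simp
    also have "(\<integral>x. zx t x \<partial>lint 0 \<tau>) = z t \<tau>"
      using W1p0_z[OF t] \<tau> LBINT_0[of "zx t" \<tau>] by (simp add: W1p0_def)
    finally show "(\<integral>x. f x \<partial>lint 0 \<tau>) = 0" by simp
  qed
  then show ?thesis by eventually_elim (simp add: f_def)
qed

text \<open>Following a fixed \<open>x\<close> means integrating \<open>F\<close> on the diagonal
  \<open>y = x + s\<close>. The damping integral then lives on the triangle
  \<open>\<sigma> \<le> s \<le> t\<close>, and exchanging the order leaves a one-sided window of
  length \<open>t - \<sigma>\<close>.\<close>

lemma F_diagonal:
  assumes t: "0 \<le> t"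
  shows "integrable (lint 0 t) (\<lambda>s. F s (x + s))"
    and "integrable (lint 0 t) (\<lambda>\<sigma>. \<integral>r. g \<sigma> r \<partial>lint x (x + t - \<sigma>))"
    and "(\<integral>s. F s (x + s) \<partial>lint 0 t) = (\<integral>y. \<rho>0 y \<partial>lint x (x + t)) - (\<integral>\<sigma>. \<integral>r. g \<sigma> r \<partial>lint x (x + t - \<sigma>) \<partial>lint 0 t)"
proof -
  define k where "k \<sigma> s = (if \<sigma> \<le> s then g \<sigma> (x + s - \<sigma>) else 0)" for \<sigma> s
  have int: "integrable (lint 0 t \<Otimes>\<^sub>M lint 0 t) (\<lambda>(\<sigma>, s). k \<sigma> s)"
    unfolding k_def using integrable_g_strip(2)[OF t] .
  have k_meas [measurable]: "(\<lambda>\<sigma>. k \<sigma> s) \<in> borel_measurable borel" "(\<lambda>s. k \<sigma> s) \<in> borel_measurable borel" for s \<sigma>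
    unfolding k_def by measurable
  \<comment> \<open>Integrating the triangle over \<open>\<sigma>\<close> gives the damping term of
    \<open>F s\<close>; integrating it over \<open>s\<close>, in \<open>row\<close>, sweeps the
    window.\<close>
  have col: "(\<integral>\<sigma>. k \<sigma> s \<partial>lint 0 t) = \<rho>0 (x + s) - F s (x + s)" if "0 \<le> s" "s \<le> t" for s
    unfolding k_def using that by (subst integral_lint_cut(1)) (auto simp: F_eq)
  have row: "(\<integral>s. k \<sigma> s \<partial>lint 0 t) = (\<integral>r. g \<sigma> r \<partial>lint x (x + t - \<sigma>))" if \<sigma>: "0 \<le> \<sigma>" "\<sigma> \<le> t" for \<sigma>
  proof -
    have "(\<integral>s. k \<sigma> s \<partial>lint 0 t) = (\<integral>s. g \<sigma> ((x - \<sigma>) + s) \<partial>lint \<sigma> t)"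
      unfolding k_def using \<sigma> by (subst integral_lint_cut(2)) (auto simp: algebra_simps)
    also have "\<dots> = (\<integral>r. g \<sigma> r \<partial>lint ((x - \<sigma>) + \<sigma>) ((x - \<sigma>) + t))"
      by (rule integral_lint_shift) measurable
    finally show ?thesis by (simp add: algebra_simps)
  qed
  have meas_row [measurable]: "(\<lambda>\<sigma>. \<integral>r. g \<sigma> r \<partial>lint x (x + t - \<sigma>)) \<in> borel_measurable borel"
  proof -
    have "(\<integral>r. g \<sigma> r \<partial>lint x (x + t - \<sigma>)) = (\<integral>r. (if x \<le> r \<and> r \<le> x + t - \<sigma> then g \<sigma> r else 0) \<partial>lborel)" for \<sigma>
      by (auto simp: integral_lint set_lebesgue_integral_def indicator_def intro!: Bochner_Integration.integral_cong)
    then show ?thesis by simp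
  qed
  have \<rho>i: "integrable (lint 0 t) (\<lambda>s. \<rho>0 (x + s))"
    by (subst integrable_lint_shift) (auto simp: integrable_\<rho>0)
  have "integrable (lint 0 t) (\<lambda>s. \<rho>0 (x + s) - (\<integral>\<sigma>. k \<sigma> s \<partial>lint 0 t))"
    by (intro Bochner_Integration.integrable_diff \<rho>i lint_pair.integrable_snd[OF int])
  moreover have eqF: "AE s in lint 0 t. \<rho>0 (x + s) - (\<integral>\<sigma>. k \<sigma> s \<partial>lint 0 t) = F s (x + s)"
    by (use AE_lint_mem in eventually_elim) (simp add: col)
  moreover have km: "(\<lambda>s. \<integral>\<sigma>. k \<sigma> s \<partial>lint 0 t) \<in> borel_measurable borel"
    using borel_measurable_integrable[OF lint_pair.integrable_snd[OF int]] by simp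
  ultimately show "integrable (lint 0 t) (\<lambda>s. F s (x + s))"
    by (subst (asm) integrable_cong_AE[OF _ _ eqF]) auto
  have eqG: "AE \<sigma> in lint 0 t. (\<integral>s. k \<sigma> s \<partial>lint 0 t) = (\<integral>r. g \<sigma> r \<partial>lint x (x + t - \<sigma>))"
    by (use AE_lint_mem in eventually_elim) (simp add: row)
  have kr: "integrable (lint 0 t) (\<lambda>\<sigma>. \<integral>s. k \<sigma> s \<partial>lint 0 t)"
    by (rule lint_pair.integrable_fst[OF int])
  have krm: "(\<lambda>\<sigma>. \<integral>s. k \<sigma> s \<partial>lint 0 t) \<in> borel_measurable borel"
    using borel_measurable_integrable[OF kr] by simp
  show "integrable (lint 0 t) (\<lambda>\<sigma>. \<integral>r. g \<sigma> r \<partial>lint x (x + t - \<sigma>))"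
    using kr krm by (subst (asm) integrable_cong_AE[OF _ _ eqG]) auto
  have "(\<integral>s. F s (x + s) \<partial>lint 0 t) = (\<integral>s. \<rho>0 (x + s) - (\<integral>\<sigma>. k \<sigma> s \<partial>lint 0 t) \<partial>lint 0 t)"
    using eqF km by (intro integral_cong_AE) (auto elim: eventually_mono)
  also have "\<dots> = (\<integral>s. \<rho>0 (x + s) \<partial>lint 0 t) - (\<integral>s. \<integral>\<sigma>. k \<sigma> s \<partial>lint 0 t \<partial>lint 0 t)"
    by (intro Bochner_Integration.integral_diff \<rho>i lint_pair.integrable_snd[OF int])
  also have "(\<integral>s. \<rho>0 (x + s) \<partial>lint 0 t) = (\<integral>y. \<rho>0 y \<partial>lint x (x + t))"
    by (subst integral_lint_shift) auto
  also have "(\<integral>s. \<integral>\<sigma>. k \<sigma> s \<partial>lint 0 t \<partial>lint 0 t) = (\<integral>\<sigma>. \<integral>s. k \<sigma> s \<partial>lint 0 t \<partial>lint 0 t)"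
    by (rule lint_pair.Fubini_integral[OF int])
  also have "\<dots> = (\<integral>\<sigma>. \<integral>r. g \<sigma> r \<partial>lint x (x + t - \<sigma>) \<partial>lint 0 t)"
    using krm eqG by (intro integral_cong_AE) auto
  finally show "(\<integral>s. F s (x + s) \<partial>lint 0 t) = (\<integral>y. \<rho>0 y \<partial>lint x (x + t)) - (\<integral>\<sigma>. \<integral>r. g \<sigma> r \<partial>lint x (x + t - \<sigma>) \<partial>lint 0 t)" .
qed

text \<open>The integrated version of z_t = (F s (s + x) - F s (s - x)) / 2. As \<open>g s\<close>
  is odd, the one-sided windows at \<open>x\<close> and \<open>- x\<close> recombine into the
  symmetric windows of the d'Alembert formula.\<close>

lemma time_integral:
  assumes t: "0 \<le> t" and x: "0 \<le> x" "x \<le> 1"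
  shows "(\<integral>s. (F s (s + x) - F s (s - x)) / 2 \<partial>lint 0 t) = z t x - z 0 x"
proof -
  note d1 = F_diagonal[OF t, of x] and d2 = F_diagonal[OF t, of "- x"]
  let ?G = "\<lambda>x \<sigma>. \<integral>r. g \<sigma> r \<partial>lint x (x + t - \<sigma>)"
  have "(\<integral>s. (F s (s + x) - F s (s - x)) / 2 \<partial>lint 0 t) = ((\<integral>s. F s (x + s) \<partial>lint 0 t) - (\<integral>s. F s (- x + s) \<partial>lint 0 t)) / 2"
    using d1(1) d2(1) by (simp add: add.commute)
  also have "\<dots> = ((\<integral>y. \<rho>0 y \<partial>lint x (x + t)) - (\<integral>y. \<rho>0 y \<partial>lint (- x) (- x + t)) - (\<integral>\<sigma>. ?G x \<sigma> - ?G (- x) \<sigma> \<partial>lint 0 t)) / 2"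
    unfolding d1(3) d2(3) using d1(2) d2(2) by simp
  also have "(\<integral>y. \<rho>0 y \<partial>lint x (x + t)) - (\<integral>y. \<rho>0 y \<partial>lint (- x) (- x + t)) =
      (\<integral>y. \<rho>0 y \<partial>lint (t - x) (t + x)) - (\<integral>y. \<rho>0 y \<partial>lint (0 - x) (0 + x))"
    using t x by (simp add: integral_lint_eq_prim integrable_\<rho>0 add.commute)
  also have "(\<integral>\<sigma>. ?G x \<sigma> - ?G (- x) \<sigma> \<partial>lint 0 t) = (\<integral>s. \<integral>r. g s r \<partial>lint (t - s - x) (t - s + x) \<partial>lint 0 t)"
  proof (rule integral_cong_AE)
    show "AE s in lint 0 t. ?G x s - ?G (- x) s = (\<integral>r. g s r \<partial>lint (t - s - x) (t - s + x))"
      using AE_lint_mem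
    proof eventually_elim
      case (elim s)
      have "prim (g s) (- x) = prim (g s) x"
        using prim_of_odd[of "g s" x] g_odd by simp
      then show ?case
        using elim x by (simp add: integral_lint_eq_prim integrable_g algebra_simps)
    qed
    show "(\<lambda>\<sigma>. ?G x \<sigma> - ?G (- x) \<sigma>) \<in> borel_measurable (lint 0 t)"
      using d1(2) d2(2) by auto
    have "(\<integral>r. g s r \<partial>lint (t - s - x) (t - s + x)) = (\<integral>r. (if t - s - x \<le> r \<and> r \<le> t - s + x then g s r else 0) \<partial>lborel)" for s
      by (auto simp: integral_lint set_lebesgue_integral_def indicator_def intro!: Bochner_Integration.integral_cong)
    then show "(\<lambda>s. \<integral>r. g s r \<partial>lint (t - s - x) (t - s + x)) \<in> borel_measurable (lint 0 t)"
      by simp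
  qed
  finally show ?thesis
    using F_window(1)[OF t x(1)] F_window(1)[OF order_refl x(1)] dAlembert_window[OF t x] dAlembert_window[OF order_refl x]
    by simp
qed

lemma AE_integrable_zt: "AE x in lint 0 1. \<forall>n::nat. integrable (lint 0 (real n)) (\<lambda>s. zt s x)"
proof (subst AE_all_countable, rule allI)
  fix n :: nat
  obtain C where C: "0 \<le> C" "\<And>s. 0 \<le> s \<Longrightarrow> (\<integral>\<^sup>+x. ennreal \<bar>zt s x\<bar> \<partial>lint 0 1) \<le> ennreal C"
    by (rule zt_bound) blast
  have "(\<integral>\<^sup>+s. \<integral>\<^sup>+x. ennreal \<bar>zt s x\<bar> \<partial>lint 0 1 \<partial>lint 0 (real n)) \<le> (\<integral>\<^sup>+s. ennreal C \<partial>lint 0 (real n))"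
    by (rule nn_integral_mono_AE, use AE_lint_mem in eventually_elim) (use C(2) in auto)
  also have "\<dots> < \<infinity>"
    by (simp add: ennreal_mult_less_top emeasure_lint)
  finally have "integrable (lint 0 (real n) \<Otimes>\<^sub>M lint 0 1) (\<lambda>(s, x). zt s x)"
    by (auto simp: integrable_iff_bounded lint.nn_integral_fst[symmetric] case_prod_beta)
  then show "AE x in lint 0 1. integrable (lint 0 (real n)) (\<lambda>s. zt s x)"
    by (rule lint_pair.AE_integrable_snd)
qed

text \<open>At fixed \<open>x\<close> both sides have the same integrals over [0,t] for rational
  \<open>t\<close>, by the time regularity of \<open>z\<close> and by
  \<open>time_integral\<close>.\<close>

lemma zt_eq_x: "AE x in lint 0 1. AE s in lborel. 0 \<le> s \<longrightarrow> zt s x = (F s (s + x) - F s (s - x)) / 2"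
proof -
  \<comment> \<open>The null set in the definition of a weak solution depends on \<open>t\<close>;
    over rational times one null set remains.\<close>
  have "AE x in lint 0 1. \<forall>t\<in>\<rat>. 0 \<le> t \<longrightarrow> z t x = z 0 x + (LBINT s=0..t. zt s x)"
  proof (subst AE_ball_countable[OF countable_rat], rule ballI)
    fix t :: real
    show "AE x in lint 0 1. 0 \<le> t \<longrightarrow> z t x = z 0 x + (LBINT s=0..t. zt s x)"
      using sol unfolding AE_lint weak_sol_def by (cases "0 \<le> t") auto
  qed
  then show ?thesis
    using AE_integrable_zt AE_lint_mem
  proof eventually_elim
    case (elim x)
    define f where "f s = zt s x - (F s (s + x) - F s (s - x)) / 2" for s
    have i: "integrable (lint 0 t) (\<lambda>s. zt s x)" "integrable (lint 0 t) (\<lambda>s. (F s (s + x) - F s (s - x)) / 2)"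
      if t: "0 \<le> t" for t
    proof -
      obtain n :: nat where "t < real n" using reals_Archimedean2 by blast
      then show "integrable (lint 0 t) (\<lambda>s. zt s x)"
        using elim(2) integrable_lint_subset[of 0 "real n" "\<lambda>s. zt s x" 0 t] by auto
      show "integrable (lint 0 t) (\<lambda>s. (F s (s + x) - F s (s - x)) / 2)"
        using F_diagonal(1)[OF t, of x] F_diagonal(1)[OF t, of "- x"] by (simp add: add.commute)
    qed
    have "AE s in lint 0 (real n). f s = 0" for n :: nat
    proof (rule AE_zero_if_integrals_zero_Rats)
      show "integrable (lint 0 (real n)) f"
        unfolding f_def[abs_def] using i[of "real n"] by simp
      fix t :: real assume t: "t \<in> \<rat>" "0 \<le> t"
      have "(\<integral>s. f s \<partial>lint 0 t) = (\<integral>s. zt s x \<partial>lint 0 t) - (\<integral>s. (F s (s + x) - F s (s - x)) / 2 \<partial>lint 0 t)"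
        unfolding f_def using i[OF t(2)] by (intro Bochner_Integration.integral_diff) auto
      also have "(\<integral>s. (F s (s + x) - F s (s - x)) / 2 \<partial>lint 0 t) = z t x - z 0 x"
        using elim(3) by (intro time_integral t) auto
      also have "(\<integral>s. zt s x \<partial>lint 0 t) = z t x - z 0 x"
        using elim(1)[rule_format, OF t(1,2)] LBINT_0[of "\<lambda>s. zt s x" t] t(2) by simp
      finally show "(\<integral>s. f s \<partial>lint 0 t) = 0" by simp
    qed
    then have "AE s in lborel. \<forall>n::nat. s \<in> {0..real n} \<longrightarrow> f s = 0"
      unfolding AE_lint by (subst AE_all_countable) auto
    then show ?case
    proof eventually_elim
      case (elim s)
      obtain n :: nat where "s < real n" using reals_Archimedean2 by blast
      with elim have "0 \<le> s \<longrightarrow> f s = 0" by (metis atLeastAtMost_iff less_imp_le)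
      then show ?case by (simp add: f_def)
    qed
  qed
qed

text \<open>Fubini exchanges the two exceptional sets; the price is a null set of times.\<close>

lemma zt_eq: "AE s in lborel. 0 \<le> s \<longrightarrow> (AE x in lint 0 1. zt s x = (F s (s + x) - F s (s - x)) / 2)"
proof -
  interpret pair_sigma_finite lborel "lint 0 1" ..
  have "AE s in lborel. AE x in lint 0 1. 0 \<le> s \<longrightarrow> zt s x = (F s (s + x) - F s (s - x)) / 2"
    using zt_eq_x by (subst AE_commute) measurable
  then show ?thesis by eventually_elim auto
qed

text \<open>Closes the equation: the damping is expressed by \<open>F\<close> alone, with
  \<open>2 * s - y\<close> the mirror image of \<open>y\<close> about \<open>s\<close>. The identity
  for \<open>zt\<close> passes from [0,1] to the circle because both sides extend oddly and
  periodically in \<open>x\<close>.\<close>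

lemma damping_eq:
  "AE s in lborel. 0 \<le> s \<longrightarrow> (AE y in circ. g s (y - s) = evenext a (y - s) / 2 * (F s y - F s (2 * s - y)))"
  using zt_eq
proof eventually_elim
  case (elim s)
  show ?case
  proof
    assume s: "0 \<le> s"
    let ?P = "\<lambda>x. V s x = (F s (s + x) - F s (s - x)) / 2"
    have per: "F s (s + (x + 2)) = F s (s + x)" "F s (s - (x + 2)) = F s (s - x)" for x
      using F_per[of s "s + x"] F_per[of s "s - (x + 2)"] by (simp_all add: algebra_simps)
    have "AE x in circ. ?P x"
    proof (rule AE_circ_of_AE_01)
      show "AE x in lint 0 1. ?P x \<and> ?P (- x)"
        using elim[rule_format, OF s] AE_lint_open
        by eventually_elim (auto simp: V_def oddext_01 oddext_minus_01)
    qed measurable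
    then have "AE y in circ. ?P (- s + y)"
      by (rule AE_circ_shift[rotated 2]) (auto simp: per V_per)
    then show "AE y in circ. g s (y - s) = evenext a (y - s) / 2 * (F s y - F s (2 * s - y))"
    proof eventually_elim
      case (elim y)
      have "s + (- s + y) = y" "- s + y = y - s" "s - (y - s) = 2 * s - y" by simp_all
      with elim have "V s (y - s) = (F s y - F s (2 * s - y)) / 2" by metis
      then show ?case by (simp add: g_def)
    qed
  qed
qed

text \<open>For almost every \<open>y\<close> the integrands agree at almost all \<open>s\<close>,
  so one null set of \<open>y\<close> works for all \<open>T\<close>; integrability is first taken
  up to integer times for the same reason.\<close>

lemma evolution:
  "AE y in circ. \<forall>T\<ge>0. integrable (lint 0 T) (\<lambda>s. evenext a (y - s) / 2 * (F s y - F s (2 * s - y))) \<and>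
    F T y = F 0 y - (\<integral>s. evenext a (y - s) / 2 * (F s y - F s (2 * s - y)) \<partial>lint 0 T)"
proof -
  interpret pair_sigma_finite lborel circ ..
  have "AE y in circ. AE s in lborel. 0 \<le> s \<longrightarrow> g s (y - s) = evenext a (y - s) / 2 * (F s y - F s (2 * s - y))"
  proof (subst AE_commute[symmetric])
    show "AE s in lborel. AE y in circ. 0 \<le> s \<longrightarrow> g s (y - s) = evenext a (y - s) / 2 * (F s y - F s (2 * s - y))"
      using damping_eq by eventually_elim auto
  qed measurable
  moreover have "AE y in circ. \<forall>n::nat. integrable (lint 0 (real n)) (\<lambda>s. g s (y - s))"
    by (subst AE_all_countable, rule allI, rule lint_pair.AE_integrable_snd, rule integrable_g_strip(1)) simp
  ultimately show ?thesis
  proof eventually_elim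
    case (elim y)
    show ?case
    proof (intro allI impI)
      fix T :: real assume T: "0 \<le> T"
      obtain n :: nat where "T < real n" using reals_Archimedean2 by blast
      then have i: "integrable (lint 0 T) (\<lambda>s. g s (y - s))"
        using elim(2) integrable_lint_subset[of 0 "real n" "\<lambda>s. g s (y - s)" 0 T] by auto
      have eq: "AE s in lint 0 T. g s (y - s) = evenext a (y - s) / 2 * (F s y - F s (2 * s - y))"
        unfolding AE_lint using elim(1) by eventually_elim auto
      have "integrable (lint 0 T) (\<lambda>s. evenext a (y - s) / 2 * (F s y - F s (2 * s - y)))"
        using i by (subst (asm) integrable_cong_AE[OF _ _ eq]) auto
      moreover have "(\<integral>s. g s (y - s) \<partial>lint 0 T) = (\<integral>s. evenext a (y - s) / 2 * (F s y - F s (2 * s - y)) \<partial>lint 0 T)"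
        by (intro integral_cong_AE eq) auto
      moreover have "F T y = F 0 y - (\<integral>s. g s (y - s) \<partial>lint 0 T)"
        by (simp add: F_eq)
      ultimately show "integrable (lint 0 T) (\<lambda>s. evenext a (y - s) / 2 * (F s y - F s (2 * s - y))) \<and>
          F T y = F 0 y - (\<integral>s. evenext a (y - s) / 2 * (F s y - F s (2 * s - y)) \<partial>lint 0 T)"
        by simp
    qed
  qed
qed

end

section \<open>Exponential stability\<close>

context damped_wave
begin

text \<open>Centring the period at \<open>s\<close> pairs each \<open>s + x\<close> with its mirror
  \<open>s - x\<close>.\<close>

lemma energy_split:
  "(\<integral>\<^sup>+y. ennreal (\<bar>F s y\<bar> powr p) \<partial>circ)
    = (\<integral>\<^sup>+x. ennreal (\<bar>F s (s + x)\<bar> powr p) + ennreal (\<bar>F s (s - x)\<bar> powr p) \<partial>lint 0 1)"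
proof -
  have "(\<integral>\<^sup>+x. ennreal (\<bar>F s (s + x)\<bar> powr p) \<partial>lint (-1) (-1 + 2)) = (\<integral>\<^sup>+y. ennreal (\<bar>F s y\<bar> powr p) \<partial>circ)"
    by (rule nn_integral_period_shift[of "\<lambda>y. ennreal (\<bar>F s y\<bar> powr p)"]) (auto simp: F_per)
  then show ?thesis
    using nn_integral_symmetric[of "\<lambda>x. ennreal (\<bar>F s (s + x)\<bar> powr p)"] by simp
qed

text \<open>\<open>F s (s + x)\<close> and \<open>F s (s - x)\<close> are z_x + z_t and z_x - z_t,
  so the energy is that of the norm of X_p. The null set of times is inherited from
  \<open>zt_eq\<close>.\<close>

lemma energy_eq:
  "AE s in lborel. 0 \<le> s \<longrightarrow> (\<integral>\<^sup>+y. ennreal (\<bar>F s y\<bar> powr p) \<partial>circ)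
    = (\<integral>\<^sup>+x. ennreal (\<bar>zx s x + zt s x\<bar> powr p) + ennreal (\<bar>zx s x - zt s x\<bar> powr p) \<partial>lint 0 1)"
  using zt_eq
proof eventually_elim
  case (elim s)
  show ?case
  proof
    assume s: "0 \<le> s"
    show "(\<integral>\<^sup>+y. ennreal (\<bar>F s y\<bar> powr p) \<partial>circ)
      = (\<integral>\<^sup>+x. ennreal (\<bar>zx s x + zt s x\<bar> powr p) + ennreal (\<bar>zx s x - zt s x\<bar> powr p) \<partial>lint 0 1)"
      unfolding energy_split
    proof (rule nn_integral_cong_AE)
      show "AE x in lint 0 1. ennreal (\<bar>F s (s + x)\<bar> powr p) + ennreal (\<bar>F s (s - x)\<bar> powr p)
        = ennreal (\<bar>zx s x + zt s x\<bar> powr p) + ennreal (\<bar>zx s x - zt s x\<bar> powr p)"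
        using zx_eq[OF s] elim[rule_format, OF s]
      proof eventually_elim
        case (elim x)
        then have "zx s x + zt s x = F s (s + x)" "zx s x - zt s x = F s (s - x)"
          by (simp_all add: field_simps)
        then show ?case by simp
      qed
    qed
  qed
qed

text \<open>Time 0 could lie in the null set of \<open>energy_eq\<close>; here the energy is
  computed from the data, since \<open>F 0\<close> is \<open>\<rho>0\<close>.\<close>

lemma energy_0:
  "(\<integral>\<^sup>+y. ennreal (\<bar>F 0 y\<bar> powr p) \<partial>circ)
    = (\<integral>\<^sup>+x. ennreal (\<bar>z0' x + z1 x\<bar> powr p) + ennreal (\<bar>z0' x - z1 x\<bar> powr p) \<partial>lint 0 1)"
  unfolding energy_split
  by (rule nn_integral_cong_AE, use AE_lint_open in eventually_elim)
     (simp add: F_eq \<rho>0_def evenext_01 oddext_01 oddext_minus_01)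

end

section \<open>The norm of X_p\<close>

lemma nn_integral_sum_diff_powr_le:
  assumes p: "1 < p" and u: "Lp p u" and v: "Lp p v"
  shows "(\<integral>\<^sup>+x. ennreal (\<bar>u x + v x\<bar> powr p) + ennreal (\<bar>u x - v x\<bar> powr p) \<partial>lint 0 1)
    \<le> ennreal (2 * 2 powr p) * ((\<integral>\<^sup>+x. ennreal (\<bar>u x\<bar> powr p) \<partial>lint 0 1) + (\<integral>\<^sup>+x. ennreal (\<bar>v x\<bar> powr p) \<partial>lint 0 1))"
proof -
  note [measurable] = Lp_integrable(1)[OF p u] Lp_integrable(1)[OF p v]
  have "(\<integral>\<^sup>+x. ennreal (\<bar>u x + v x\<bar> powr p) + ennreal (\<bar>u x - v x\<bar> powr p) \<partial>lint 0 1)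
    \<le> (\<integral>\<^sup>+x. ennreal (2 * 2 powr p) * (ennreal (\<bar>u x\<bar> powr p) + ennreal (\<bar>v x\<bar> powr p)) \<partial>lint 0 1)"
  proof (rule nn_integral_mono)
    fix x
    have "\<bar>u x + v x\<bar> powr p + \<bar>u x - v x\<bar> powr p \<le> 2 * 2 powr p * (\<bar>u x\<bar> powr p + \<bar>v x\<bar> powr p)"
      using powr_add2_le[of p "u x" "v x"] powr_add2_le[of p "u x" "- v x"] p by simp
    from ennreal_leI[OF this]
    show "ennreal (\<bar>u x + v x\<bar> powr p) + ennreal (\<bar>u x - v x\<bar> powr p)
      \<le> ennreal (2 * 2 powr p) * (ennreal (\<bar>u x\<bar> powr p) + ennreal (\<bar>v x\<bar> powr p))"
      by (simp add: ennreal_plus ennreal_mult)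
  qed
  also have "\<dots> = ennreal (2 * 2 powr p) * ((\<integral>\<^sup>+x. ennreal (\<bar>u x\<bar> powr p) \<partial>lint 0 1) + (\<integral>\<^sup>+x. ennreal (\<bar>v x\<bar> powr p) \<partial>lint 0 1))"
    by (simp add: nn_integral_cmult nn_integral_add)
  finally show ?thesis .
qed

lemma nn_integral_Lp_finite:
  assumes p: "1 < p" and u: "Lp p u"
  shows "(\<integral>\<^sup>+x. ennreal (\<bar>u x\<bar> powr p) \<partial>lint 0 1) < \<infinity>"
  using Lp_integrable(2)[OF p u] by (simp add: integrable_iff_bounded)

lemma Xnorm_eq:
  assumes p: "1 < p" and u: "Lp p u" and v: "Lp p v"
  shows "(\<integral>\<^sup>+x. ennreal (\<bar>u x + v x\<bar> powr p) + ennreal (\<bar>u x - v x\<bar> powr p) \<partial>lint 0 1)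
    = ennreal (p * Xnorm p u v powr p)"
proof -
  note [measurable] = Lp_integrable(1)[OF p u] Lp_integrable(1)[OF p v]
  let ?f = "\<lambda>x. \<bar>u x + v x\<bar> powr p + \<bar>u x - v x\<bar> powr p"
  have eq: "(\<integral>\<^sup>+x. ennreal (\<bar>u x + v x\<bar> powr p) + ennreal (\<bar>u x - v x\<bar> powr p) \<partial>lint 0 1)
    = (\<integral>\<^sup>+x. ennreal (?f x) \<partial>lint 0 1)"
    by (intro nn_integral_cong) (simp add: ennreal_plus)
  have "(\<integral>\<^sup>+x. ennreal (?f x) \<partial>lint 0 1) < \<infinity>"
    unfolding eq[symmetric]
    using nn_integral_Lp_finite[OF p u] nn_integral_Lp_finite[OF p v]
    by (intro le_less_trans[OF nn_integral_sum_diff_powr_le[OF p u v]]) (simp add: ennreal_mult_less_top)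
  then have int: "integrable (lint 0 1) ?f"
    by (simp add: integrable_iff_bounded)
  have I: "0 \<le> (\<integral>x. ?f x \<partial>lint 0 1)" by (intro Bochner_Integration.integral_nonneg) simp
  have "Xnorm p u v = (1 / p * (\<integral>x. ?f x \<partial>lint 0 1)) powr (1 / p)"
    unfolding Xnorm_def by (subst LBINT_01) auto
  then have "Xnorm p u v powr p = 1 / p * (\<integral>x. ?f x \<partial>lint 0 1)"
    using p I by (simp add: powr_powr)
  then have "p * Xnorm p u v powr p = (\<integral>x. ?f x \<partial>lint 0 1)" using p by simp
  then show ?thesis
    unfolding eq by (subst nn_integral_eq_integral[OF int]) auto
qed

lemma Xnorm_nonneg: "0 \<le> Xnorm p u v"
  by (simp add: Xnorm_def)

lemma Lp_dist_eq:
  assumes p: "1 < p" and u: "Lp p u" and v: "Lp p v"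
  shows "(\<integral>\<^sup>+x. ennreal (\<bar>u x - v x\<bar> powr p) \<partial>lint 0 1) = ennreal (Lp_dist p u v)"
proof -
  note [measurable] = Lp_integrable(1)[OF p u] Lp_integrable(1)[OF p v]
  have "(\<integral>\<^sup>+x. ennreal (\<bar>u x - v x\<bar> powr p) \<partial>lint 0 1)
    \<le> (\<integral>\<^sup>+x. ennreal (\<bar>u x + v x\<bar> powr p) + ennreal (\<bar>u x - v x\<bar> powr p) \<partial>lint 0 1)"
    by (intro nn_integral_mono) simp
  also have "\<dots> < \<infinity>" by (simp add: Xnorm_eq[OF p u v])
  finally have "integrable (lint 0 1) (\<lambda>x. \<bar>u x - v x\<bar> powr p)"
    by (simp add: integrable_iff_bounded)
  then show ?thesis
    unfolding Lp_dist_def by (subst LBINT_01) (auto simp: nn_integral_eq_integral)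
qed

text \<open>A quasi-triangle inequality suffices, since constants are absorbed in \<open>M\<close>.\<close>

lemma Xnorm_perturb:
  assumes p: "1 < p" and u: "Lp p u" and v: "Lp p v" and u': "Lp p u'" and v': "Lp p v'"
  shows "Xnorm p u v powr p \<le> 3 powr p * (Xnorm p u' v' powr p + 2 * Lp_dist p u' u + 2 * Lp_dist p v' v)"
proof -
  note [measurable] = Lp_integrable(1)[OF p u] Lp_integrable(1)[OF p v] Lp_integrable(1)[OF p u'] Lp_integrable(1)[OF p v']
  have d0: "0 \<le> Lp_dist p u' u" "0 \<le> Lp_dist p v' v"
    unfolding Lp_dist_def by (subst LBINT_01; simp add: Bochner_Integration.integral_nonneg)+
  have "ennreal (p * Xnorm p u v powr p) \<le>
    (\<integral>\<^sup>+x. ennreal (3 powr p) * ((ennreal (\<bar>u' x + v' x\<bar> powr p) + ennreal (\<bar>u' x - v' x\<bar> powr p))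
      + 2 * ennreal (\<bar>u' x - u x\<bar> powr p) + 2 * ennreal (\<bar>v' x - v x\<bar> powr p)) \<partial>lint 0 1)"
    unfolding Xnorm_eq[OF p u v, symmetric]
  proof (rule nn_integral_mono)
    fix x
    have "\<bar>u x + v x\<bar> powr p = \<bar>(u' x + v' x) + - (u' x - u x) + - (v' x - v x)\<bar> powr p"
      by (simp add: algebra_simps)
    also have "\<dots> \<le> 3 powr p * (\<bar>u' x + v' x\<bar> powr p + \<bar>- (u' x - u x)\<bar> powr p + \<bar>- (v' x - v x)\<bar> powr p)"
      by (rule powr_add3_le) (use p in simp)
    finally have 1: "\<bar>u x + v x\<bar> powr p \<le> 3 powr p * (\<bar>u' x + v' x\<bar> powr p + \<bar>u' x - u x\<bar> powr p + \<bar>v' x - v x\<bar> powr p)"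
      by (simp only: abs_minus_cancel)
    have "\<bar>u x - v x\<bar> powr p = \<bar>(u' x - v' x) + - (u' x - u x) + (v' x - v x)\<bar> powr p"
      by (simp add: algebra_simps)
    also have "\<dots> \<le> 3 powr p * (\<bar>u' x - v' x\<bar> powr p + \<bar>- (u' x - u x)\<bar> powr p + \<bar>v' x - v x\<bar> powr p)"
      by (rule powr_add3_le) (use p in simp)
    finally have 2: "\<bar>u x - v x\<bar> powr p \<le> 3 powr p * (\<bar>u' x - v' x\<bar> powr p + \<bar>u' x - u x\<bar> powr p + \<bar>v' x - v x\<bar> powr p)"
      by (simp only: abs_minus_cancel)
    have "\<bar>u x + v x\<bar> powr p + \<bar>u x - v x\<bar> powr p \<le> 3 powr p * ((\<bar>u' x + v' x\<bar> powr p + \<bar>u' x - v' x\<bar> powr p)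
      + 2 * \<bar>u' x - u x\<bar> powr p + 2 * \<bar>v' x - v x\<bar> powr p)"
      using add_mono[OF 1 2] by (simp add: algebra_simps)
    from ennreal_leI[OF this]
    show "ennreal (\<bar>u x + v x\<bar> powr p) + ennreal (\<bar>u x - v x\<bar> powr p) \<le> ennreal (3 powr p) *
      ((ennreal (\<bar>u' x + v' x\<bar> powr p) + ennreal (\<bar>u' x - v' x\<bar> powr p))
      + 2 * ennreal (\<bar>u' x - u x\<bar> powr p) + 2 * ennreal (\<bar>v' x - v x\<bar> powr p))"
      by (simp add: ennreal_plus ennreal_mult)
  qed
  also have "\<dots> = ennreal (3 powr p) * ((\<integral>\<^sup>+x. ennreal (\<bar>u' x + v' x\<bar> powr p) + ennreal (\<bar>u' x - v' x\<bar> powr p) \<partial>lint 0 1)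
      + 2 * (\<integral>\<^sup>+x. ennreal (\<bar>u' x - u x\<bar> powr p) \<partial>lint 0 1) + 2 * (\<integral>\<^sup>+x. ennreal (\<bar>v' x - v x\<bar> powr p) \<partial>lint 0 1))"
    by (simp add: nn_integral_cmult nn_integral_add)
  also have "\<dots> = ennreal (3 powr p * (p * Xnorm p u' v' powr p + 2 * Lp_dist p u' u + 2 * Lp_dist p v' v))"
    using d0 p by (simp add: Xnorm_eq[OF p u' v'] Lp_dist_eq[OF p u' u] Lp_dist_eq[OF p v' v] ennreal_plus ennreal_mult)
  finally have "p * Xnorm p u v powr p \<le> 3 powr p * (p * Xnorm p u' v' powr p + 2 * Lp_dist p u' u + 2 * Lp_dist p v' v)"
    using d0 p by (subst (asm) ennreal_le_iff) auto
  also have "\<dots> \<le> 3 powr p * (p * Xnorm p u' v' powr p + p * (2 * Lp_dist p u' u) + p * (2 * Lp_dist p v' v))"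
  proof (intro mult_left_mono add_mono order_refl)
    show "2 * Lp_dist p u' u \<le> p * (2 * Lp_dist p u' u)" "2 * Lp_dist p v' v \<le> p * (2 * Lp_dist p v' v)"
      using d0 p mult_right_mono[of 1 p] by auto
  qed (use p in simp_all)
  also have "\<dots> = p * (3 powr p * (Xnorm p u' v' powr p + 2 * Lp_dist p u' u + 2 * Lp_dist p v' v))"
    by (simp add: algebra_simps)
  finally show ?thesis using p by simp
qed

context damped_wave
begin

lemma reflected_transport_F:
  assumes cd: "0 \<le> c" "c < d" "d \<le> 1" and b0: "0 < b0" and b_ge: "\<And>x. x \<in> {c..d} \<Longrightarrow> b0 \<le> evenext a x / 2"
  shows "reflected_transport p B b0 c d (\<lambda>x. evenext a x / 2) F"
proof
  show "(\<integral>\<^sup>+y. ennreal (\<bar>F 0 y\<bar> powr p) \<partial>circ) < \<infinity>"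
    unfolding energy_0 by (simp add: Xnorm_eq[OF p Lp_z0' z1])
  show "\<exists>C. AE t in lborel. 0 \<le> t \<longrightarrow> (\<integral>\<^sup>+y. ennreal (\<bar>F t y\<bar> powr p) \<partial>circ) \<le> ennreal C"
  proof -
    obtain C where C: "0 \<le> C"
      "\<And>s. 0 \<le> s \<Longrightarrow> (\<integral>\<^sup>+x. ennreal (\<bar>zt s x\<bar> powr p) \<partial>lint 0 1) \<le> ennreal C"
      "\<And>s. 0 \<le> s \<Longrightarrow> (\<integral>\<^sup>+x. ennreal (\<bar>zx s x\<bar> powr p) \<partial>lint 0 1) \<le> ennreal C"
      by (rule Lp_bounds) blast
    have "AE t in lborel. 0 \<le> t \<longrightarrow> (\<integral>\<^sup>+y. ennreal (\<bar>F t y\<bar> powr p) \<partial>circ) \<le> ennreal (2 * 2 powr p * (C + C))"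
      using energy_eq
    proof eventually_elim
      case (elim t)
      show ?case
      proof
        assume t: "0 \<le> t"
        with elim have "(\<integral>\<^sup>+y. ennreal (\<bar>F t y\<bar> powr p) \<partial>circ)
          \<le> ennreal (2 * 2 powr p) * ((\<integral>\<^sup>+x. ennreal (\<bar>zx t x\<bar> powr p) \<partial>lint 0 1) + (\<integral>\<^sup>+x. ennreal (\<bar>zt t x\<bar> powr p) \<partial>lint 0 1))"
          using nn_integral_sum_diff_powr_le[OF p Lp_zx[OF t] Lp_zt[OF t]] by simp
        also have "\<dots> \<le> ennreal (2 * 2 powr p) * (ennreal C + ennreal C)"
          by (intro mult_left_mono add_mono C t) simp
        also have "\<dots> = ennreal (2 * 2 powr p * (C + C))"
          using C(1) by (subst ennreal_plus[symmetric], simp, simp, subst ennreal_mult[symmetric]) auto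
        finally show "(\<integral>\<^sup>+y. ennreal (\<bar>F t y\<bar> powr p) \<partial>circ) \<le> ennreal (2 * 2 powr p * (C + C))" .
      qed
    qed
    then show ?thesis by blast
  qed
  show "AE y in circ. \<forall>T\<ge>0. integrable (lint 0 T) (\<lambda>s. evenext a (y - s) / 2 * (F s y - F s (2 * s - y))) \<and>
    F T y = F 0 y - (\<integral>s. evenext a (y - s) / 2 * (F s y - F s (2 * s - y)) \<partial>lint 0 T)"
    by (rule evolution)
qed (use p a_nonneg a_le cd b0 b_ge F_meas F_mean_zero in \<open>simp_all add: F_per\<close>)

text \<open>The energy bound gives decay of the norm at almost all times by
  \<open>energy_eq\<close>; continuity into X_p carries it to every \<open>t\<close>, at the price
  of the factor \<open>3 powr p\<close> of the quasi-triangle inequality.\<close>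

lemma Xnorm_decay:
  assumes K: "0 < K" and \<gamma>: "0 < \<gamma>"
    and decay: "\<And>t. 0 \<le> t \<Longrightarrow> (\<integral>\<^sup>+y. ennreal (\<bar>F t y\<bar> powr p) \<partial>circ)
      \<le> ennreal (K * exp (- \<gamma> * t)) * (\<integral>\<^sup>+y. ennreal (\<bar>F 0 y\<bar> powr p) \<partial>circ)"
    and t: "0 \<le> t"
  shows "Xnorm p (zx t) (zt t) powr p \<le> 3 powr p * (K * exp (- \<gamma> * t) * Xnorm p z0' z1 powr p)"
proof -
  let ?R = "K * exp (- \<gamma> * t) * Xnorm p z0' z1 powr p"
  have good: "AE s in lborel. 0 \<le> s \<longrightarrow> Xnorm p (zx s) (zt s) powr p \<le> K * exp (- \<gamma> * s) * Xnorm p z0' z1 powr p"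
    using energy_eq
  proof eventually_elim
    case (elim s)
    show ?case
    proof
      assume s: "0 \<le> s"
      have "ennreal (p * Xnorm p (zx s) (zt s) powr p) = (\<integral>\<^sup>+y. ennreal (\<bar>F s y\<bar> powr p) \<partial>circ)"
        using elim s by (simp add: Xnorm_eq[OF p Lp_zx[OF s] Lp_zt[OF s]])
      also have "\<dots> \<le> ennreal (K * exp (- \<gamma> * s)) * ennreal (p * Xnorm p z0' z1 powr p)"
        using decay[OF s] unfolding energy_0 Xnorm_eq[OF p Lp_z0' z1] .
      also have "\<dots> = ennreal (K * exp (- \<gamma> * s) * (p * Xnorm p z0' z1 powr p))"
        using K p by (intro ennreal_mult[symmetric]) auto
      finally have "p * Xnorm p (zx s) (zt s) powr p \<le> K * exp (- \<gamma> * s) * (p * Xnorm p z0' z1 powr p)"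
        using K p by (subst (asm) ennreal_le_iff) auto
      then have "p * Xnorm p (zx s) (zt s) powr p \<le> p * (K * exp (- \<gamma> * s) * Xnorm p z0' z1 powr p)"
        by (simp add: mult_ac)
      then show "Xnorm p (zx s) (zt s) powr p \<le> K * exp (- \<gamma> * s) * Xnorm p z0' z1 powr p"
        using p by simp
    qed
  qed
  show ?thesis
  proof (rule field_le_epsilon)
    fix e :: real assume e: "0 < e"
    \<comment> \<open>Each of the two distances enters with the factor \<open>2 * 3 powr p\<close>,
      so together they cost at most \<open>e\<close>.\<close>
    define \<eta> where "\<eta> = e / (3 powr p * 4)"
    have \<eta>: "0 < \<eta>" using e by (simp add: \<eta>_def)
    have "((\<lambda>s. Lp_dist p (zt s) (zt t)) \<longlongrightarrow> 0) (at t within {0..})" "((\<lambda>s. Lp_dist p (zx s) (zx t)) \<longlongrightarrow> 0) (at t within {0..})"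
      using sol t by (auto simp: weak_sol_def)
    then have "\<forall>\<^sub>F s in at t within {0..}. Lp_dist p (zt s) (zt t) < \<eta>" "\<forall>\<^sub>F s in at t within {0..}. Lp_dist p (zx s) (zx t) < \<eta>"
      using \<eta> by (auto intro: order_tendstoD)
    then have "\<forall>\<^sub>F s in at t within {0..}. Lp_dist p (zt s) (zt t) < \<eta> \<and> Lp_dist p (zx s) (zx t) < \<eta>"
      by (rule eventually_conj)
    then obtain \<delta> where \<delta>: "0 < \<delta>" "\<And>s. 0 \<le> s \<Longrightarrow> s \<noteq> t \<Longrightarrow> dist s t < \<delta> \<Longrightarrow>
        Lp_dist p (zt s) (zt t) < \<eta> \<and> Lp_dist p (zx s) (zx t) < \<eta>"
      unfolding eventually_at by auto
    \<comment> \<open>An interval of positive measure contains a good time. Taking it after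
      \<open>t\<close> makes the exponential at \<open>s\<close> no larger than at
      \<open>t\<close>.\<close>
    have "\<exists>s. t < s \<and> s < t + \<delta> \<and> (0 \<le> s \<longrightarrow> Xnorm p (zx s) (zt s) powr p \<le> K * exp (- \<gamma> * s) * Xnorm p z0' z1 powr p)"
    proof (rule ccontr)
      assume "\<not> ?thesis"
      then have "AE s in lborel. s \<notin> {t<..<t + \<delta>}"
        using good by (auto elim!: eventually_mono)
      then have "emeasure lborel {t<..<t + \<delta>} = 0"
        by (subst (asm) AE_iff_measurable[of "{t<..<t + \<delta>}"]) auto
      then show False using \<delta>(1) by simp
    qed
    then obtain s where s: "t < s" "s < t + \<delta>" and Xs: "Xnorm p (zx s) (zt s) powr p \<le> K * exp (- \<gamma> * s) * Xnorm p z0' z1 powr p"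
      using t by auto
    have s0: "0 \<le> s" using s t by simp
    have Xs': "Xnorm p (zx s) (zt s) powr p \<le> ?R"
      using s \<gamma> K by (intro order_trans[OF Xs] mult_right_mono mult_left_mono) auto
    have d: "Lp_dist p (zt s) (zt t) < \<eta>" "Lp_dist p (zx s) (zx t) < \<eta>"
      using \<delta>(2)[of s] s s0 by (auto simp: dist_real_def)
    have "Xnorm p (zx t) (zt t) powr p \<le> 3 powr p * (Xnorm p (zx s) (zt s) powr p + 2 * Lp_dist p (zx s) (zx t) + 2 * Lp_dist p (zt s) (zt t))"
      by (rule Xnorm_perturb[OF p Lp_zx[OF t] Lp_zt[OF t] Lp_zx[OF s0] Lp_zt[OF s0]])
    also have "\<dots> \<le> 3 powr p * (?R + 2 * \<eta> + 2 * \<eta>)"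
      using Xs' d by (intro mult_left_mono add_mono) auto
    also have "\<dots> = 3 powr p * ?R + e"
      by (simp add: \<eta>_def field_simps)
    finally show "Xnorm p (zx t) (zt t) powr p \<le> 3 powr p * ?R + e" .
  qed
qed

end

theorem mainTheorem1:
  fixes p :: real and a :: "real \<Rightarrow> real"
  assumes "1 < p" and "H1 a"
  shows "\<exists>M \<ge> 1. \<exists>\<gamma> > 0. \<forall>z0 z0' z1 z zx zt.
           W1p0 p z0 z0' \<and> Lp p z1 \<and> weak_sol p a z0 z1 z zx zt \<longrightarrow>
           (\<forall>t\<ge>0. Xnorm p (zx t) (zt t) \<le> M * exp (- \<gamma> * t) * Xnorm p z0' z1)"
proof -
  note p = \<open>1 < p\<close>
  obtain a0 c d where a: "continuous_on {0..1} a" "\<And>x. x \<in> {0..1} \<Longrightarrow> 0 \<le> a x"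
    and cd: "a0 > 0" "0 \<le> c" "c < d" "d \<le> 1" "\<And>x. x \<in> {c..d} \<Longrightarrow> a0 \<le> a x"
    using assms(2) unfolding H1_def by blast
  obtain A where A: "\<And>x. x \<in> {0..1} \<Longrightarrow> a x \<le> A"
  proof -
    obtain y where "y \<in> {0..1}" "\<forall>x\<in>{0..1}. a x \<le> a y"
      using continuous_attains_sup[of "{0..1::real}" a] a(1) by auto
    then show ?thesis using that[of "a y"] by blast
  qed
  define B where "B = A / 2 + 1"
  have w: "\<bar>wrap x\<bar> \<in> {0..1}" for x using wrap_bounds[of x] by auto
  have ext: "0 \<le> evenext a x" "evenext a x / 2 \<le> B" for x
    using a(2)[OF w[of x]] A[OF w[of x]] unfolding evenext_wrap B_def by linarith+
  have B: "0 < B" using a(2)[of 0] A[of 0] by (simp add: B_def)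
  \<comment> \<open>Shrinking the interval keeps it below 1, where \<open>evenext_01\<close>
    applies; \<open>d\<close> itself may be 1.\<close>
  define d' where "d' = (c + d) / 2"
  have d': "c < d'" "d' < d" using cd by (auto simp: d'_def)
  have low: "a0 / 2 \<le> evenext a x / 2" if "x \<in> {c..d'}" for x
    using that cd d' by (subst evenext_01) auto
  have a0: "0 < a0 / 2" using cd by simp
  obtain K \<gamma> where K: "0 < K" "0 < \<gamma>"
    "\<And>b F t. reflected_transport p B (a0 / 2) c d' b F \<Longrightarrow> 0 \<le> t \<Longrightarrow>
      (\<integral>\<^sup>+y. ennreal (\<bar>F t y\<bar> powr p) \<partial>circ) \<le> ennreal (K * exp (- \<gamma> * t)) * (\<integral>\<^sup>+y. ennreal (\<bar>F 0 y\<bar> powr p) \<partial>circ)"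
    by (rule reflected_transport_exp_decay[OF p d'(1) a0 B]) blast
  \<comment> \<open>The p-th root of the constant; the same root turns the rate
    \<open>\<gamma>\<close> of the energy into \<open>\<gamma> / p\<close> for the norm.\<close>
  define M where "M = max 1 ((3 powr p * K) powr (1 / p))"
  have "Xnorm p (zx t) (zt t) \<le> M * exp (- (\<gamma> / p) * t) * Xnorm p z0' z1"
    if "W1p0 p z0 z0'" "Lp p z1" "weak_sol p a z0 z1 z zx zt" and t: "0 \<le> t" for z0 z0' z1 z zx zt t
  proof -
    interpret damped_wave p B a z0 z0' z1 z zx zt
      using that p ext borel_measurable_evenext_continuous[OF a(1)] by unfold_locales
    have rt: "reflected_transport p B (a0 / 2) c d' (\<lambda>x. evenext a x / 2) F"
      using cd d' a0 low by (intro reflected_transport_F) auto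
    have "Xnorm p (zx t) (zt t) powr p \<le> 3 powr p * (K * exp (- \<gamma> * t) * Xnorm p z0' z1 powr p)"
      by (rule Xnorm_decay[OF K(1,2) K(3)[OF rt] t])
    then have "(Xnorm p (zx t) (zt t) powr p) powr (1 / p) \<le> ((3 powr p * K) * exp (- \<gamma> * t) * Xnorm p z0' z1 powr p) powr (1 / p)"
      using p by (intro powr_mono2) (auto simp: mult_ac)
    also have "\<dots> = (3 powr p * K) powr (1 / p) * exp (- \<gamma> * t) powr (1 / p) * (Xnorm p z0' z1 powr p) powr (1 / p)"
      by (simp only: powr_mult)
    also have "exp (- \<gamma> * t) powr (1 / p) = exp (- (\<gamma> / p) * t)"
      by (simp add: exp_powr_real)
    also have "(3 powr p * K) powr (1 / p) * exp (- (\<gamma> / p) * t) * (Xnorm p z0' z1 powr p) powr (1 / p)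
        \<le> M * exp (- (\<gamma> / p) * t) * (Xnorm p z0' z1 powr p) powr (1 / p)"
      by (intro mult_right_mono) (auto simp: M_def)
    finally show ?thesis
      using p by (simp add: powr_powr Xnorm_nonneg)
  qed
  moreover have "1 \<le> M" "0 < \<gamma> / p" using K p by (auto simp: M_def)
  ultimately show ?thesis by blast
qed

end
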